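(* Let $U\subset X$ be quasiopen and $u\in\hat N^{1,p}(U)$. Then the following are equivalent: (a) $u\in N^{1,p}(U)$; (b) $u$ is quasicontinuous (on $U$); (c) $u$ is absolutely continuous on $p$-almost every curve in $U$, i.e. for all curves $\gamma:[0,l_\gamma]\to U$ outside a family of zero $p$-modulus, $u\circ\gamma$ is absolutely continuous on $[0,l_\gamma]$.
   Context: Standing assumptions: $1<p<\infty$; $X=(X,d,\mu)$ is a complete metric space with a positive complete Borel measure $\mu$, $0<\mu(B)<\infty$ for all balls; $\mu$ is doubling; $X$ supports a $p$-Poincaré inequality (there are $C>0,\lambda\ge1$ with $\frac1{\mu(B)}\int_B|f-f_B|\,d\mu\le C\,\mathrm{diam}(B)(\frac1{\mu(\lambda B)}\int_{\lambda B}g^p\,d\mu)^{1/p}$ for all balls $B$, integrable $f$ and upper gradients $g$ of $f$). Measurable $E\subset X$ is regarded as a metric measure space with restricted metric and measure. Curves are nonconstant compact rectifiable curves parametrized by arc length. For $f:E\to[-\infty,\infty]$, a Borel $g:E\to[0,\infty]$ is an upper gradient of $f$ in $E$ if $|f(\gamma(0))-f(\gamma(l_\gamma))|\le\int_\gamma g\,ds$ for all curves $\gamma:[0,l_\gamma]\to E$ (left side $\infty$ if either value is infinite). The $p$-modulus of a curve family $\Gamma$ is $\inf\int\rho^p\,d\mu$ over Borel $\rho\ge0$ with $\int_\gamma\rho\,ds\ge1$ for all $\gamma\in\Gamma$. $N^{1,p}(E)$: everywhere defined measurable $f:E\to[-\infty,\infty]$ with $\|f\|_{N^{1,p}(E)}=(\int_E|f|^p\,d\mu+\inf_g\int_Eg^p\,d\mu)^{1/p}<\infty$,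 infimum over upper gradients in $E$. $\hat N^{1,p}(U)=\{u: u=v\text{ a.e. in }U\text{ for some }v\in N^{1,p}(U)\}$. $C_p(E)=\inf\|w\|^p_{N^{1,p}(X)}$ over $w\in N^{1,p}(X)$ with $w\ge1$ on $E$. $U$ is quasiopen if for every $\varepsilon>0$ there is open $G$ with $C_p(G)<\varepsilon$ and $U\cup G$ open. $u$ is quasicontinuous on $U$ if for every $\varepsilon>0$ there is open $G$ with $C_p(G)<\varepsilon$ and $u|_{U\setminus G}$ finite and continuous. *)

theory Defs
  imports "HOL-Analysis.Analysis"
begin

text \<open>Real power of an extended nonnegative real (for exponent q > 0): infinity stays infinity.\<close>
definition epow :: "ennreal \<Rightarrow> real \<Rightarrow> ennreal" where
  "epow x q = (if x = \<infinity> then \<infinity> else ennreal (enn2real x powr q))"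

definition curve_variation :: "(real \<Rightarrow> 'a::metric_space) \<Rightarrow> real \<Rightarrow> real \<Rightarrow> ennreal" where
  "curve_variation \<gamma> a b =
     (SUP nt \<in> {(n, t). t 0 = a \<and> t n = b \<and> (\<forall>i<n. t i \<le> t (Suc i))}.
        (\<Sum>i<fst nt. ennreal (dist (\<gamma> (snd nt i)) (\<gamma> (snd nt (Suc i))))))"

text \<open>A curve is a nonconstant compact rectifiable curve parametrized by arc length,
  with domain [0, l]: its length on every subinterval [s,t] equals t - s.\<close>
definition is_curve :: "(real \<Rightarrow> 'a::metric_space) \<Rightarrow> real \<Rightarrow> bool" where
  "is_curve \<gamma> l \<longleftrightarrow> 0 < l \<and>
     (\<forall>s t. 0 \<le> s \<and> s \<le> t \<and> t \<le> l \<longrightarrow> curve_variation \<gamma> s t = ennreal (t - s))"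

definition curve_in :: "'a::metric_space set \<Rightarrow> (real \<Rightarrow> 'a) \<Rightarrow> real \<Rightarrow> bool" where
  "curve_in E \<gamma> l \<longleftrightarrow> is_curve \<gamma> l \<and> \<gamma> ` {0..l} \<subseteq> E"

text \<open>Line integral of a nonnegative function along an arc-length parametrized curve.\<close>
definition line_integral :: "('a \<Rightarrow> ennreal) \<Rightarrow> (real \<Rightarrow> 'a) \<Rightarrow> real \<Rightarrow> ennreal" where
  "line_integral g \<gamma> l = (\<integral>\<^sup>+ t \<in> {0..l}. g (\<gamma> t) \<partial>lborel)"

definition ug_lhs :: "ereal \<Rightarrow> ereal \<Rightarrow> ennreal" where
  "ug_lhs a b = (if \<bar>a\<bar> = \<infinity> \<or> \<bar>b\<bar> = \<infinity> then \<infinity> else ennreal (real_of_ereal \<bar>a - b\<bar>))"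

definition upper_gradient :: "'a::metric_space set \<Rightarrow> ('a \<Rightarrow> ereal) \<Rightarrow> ('a \<Rightarrow> ennreal) \<Rightarrow> bool" where
  "upper_gradient E f g \<longleftrightarrow> g \<in> borel_measurable (restrict_space borel E) \<and>
     (\<forall>\<gamma> l. curve_in E \<gamma> l \<longrightarrow> ug_lhs (f (\<gamma> 0)) (f (\<gamma> l)) \<le> line_integral g \<gamma> l)"

definition N1p_normp :: "real \<Rightarrow> 'a::metric_space measure \<Rightarrow> 'a set \<Rightarrow> ('a \<Rightarrow> ereal) \<Rightarrow> ennreal" where
  "N1p_normp p M E f =
     (\<integral>\<^sup>+ x \<in> E. epow (e2ennreal \<bar>f x\<bar>) p \<partial>M) +
     (INF g \<in> {g. upper_gradient E f g}. \<integral>\<^sup>+ x \<in> E. epow (g x) p \<partial>M)"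

definition N1p :: "real \<Rightarrow> 'a::metric_space measure \<Rightarrow> 'a set \<Rightarrow> ('a \<Rightarrow> ereal) \<Rightarrow> bool" where
  "N1p p M E f \<longleftrightarrow> f \<in> borel_measurable (restrict_space M E) \<and> N1p_normp p M E f < \<infinity>"

definition N1p_hat :: "real \<Rightarrow> 'a::metric_space measure \<Rightarrow> 'a set \<Rightarrow> ('a \<Rightarrow> ereal) \<Rightarrow> bool" where
  "N1p_hat p M U u \<longleftrightarrow> (\<exists>v. N1p p M U v \<and> (AE x in M. x \<in> U \<longrightarrow> u x = v x))"

definition p_modulus :: "real \<Rightarrow> 'a::metric_space measure \<Rightarrow> ((real \<Rightarrow> 'a) \<times> real) set \<Rightarrow> ennreal" where
  "p_modulus p M \<Gamma> =
     (INF \<rho> \<in> {\<rho>. \<rho> \<in> borel_measurable borel \<and> (\<forall>(\<gamma>, l) \<in> \<Gamma>. 1 \<le> line_integral \<rho> \<gamma> l)}.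
        \<integral>\<^sup>+ x. epow (\<rho> x) p \<partial>M)"

definition capacity :: "real \<Rightarrow> 'a::metric_space measure \<Rightarrow> 'a set \<Rightarrow> ennreal" where
  "capacity p M E =
     (INF w \<in> {w. N1p p M UNIV w \<and> (\<forall>x\<in>E. 1 \<le> w x)}. N1p_normp p M UNIV w)"

definition quasiopen :: "real \<Rightarrow> 'a::metric_space measure \<Rightarrow> 'a set \<Rightarrow> bool" where
  "quasiopen p M U \<longleftrightarrow>
     (\<forall>\<epsilon>::real. \<epsilon> > 0 \<longrightarrow> (\<exists>G. open G \<and> capacity p M G < ennreal \<epsilon> \<and> open (U \<union> G)))"

definition quasicontinuous_on :: "real \<Rightarrow> 'a::metric_space measure \<Rightarrow> 'a set \<Rightarrow> ('a \<Rightarrow> ereal) \<Rightarrow> bool" where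
  "quasicontinuous_on p M U u \<longleftrightarrow>
     (\<forall>\<epsilon>::real. \<epsilon> > 0 \<longrightarrow> (\<exists>G. open G \<and> capacity p M G < ennreal \<epsilon> \<and>
        (\<forall>x \<in> U - G. \<bar>u x\<bar> \<noteq> \<infinity>) \<and> continuous_on (U - G) (\<lambda>x. real_of_ereal (u x))))"

definition abs_continuous_on :: "real \<Rightarrow> real \<Rightarrow> (real \<Rightarrow> ereal) \<Rightarrow> bool" where
  "abs_continuous_on a b h \<longleftrightarrow> (\<forall>t \<in> {a..b}. \<bar>h t\<bar> \<noteq> \<infinity>) \<and>
     (\<forall>\<epsilon>>0. \<exists>\<delta>>0. \<forall>(n::nat) (s::nat \<Rightarrow> real) (t::nat \<Rightarrow> real).
        (\<forall>i<n. a \<le> s i \<and> s i \<le> t i \<and> t i \<le> b) \<and>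
        (\<forall>i<n. \<forall>j<n. i \<noteq> j \<longrightarrow> t i \<le> s j \<or> t j \<le> s i) \<and>
        (\<Sum>i<n. t i - s i) < \<delta> \<longrightarrow>
        (\<Sum>i<n. \<bar>real_of_ereal (h (t i)) - real_of_ereal (h (s i))\<bar>) < \<epsilon>)"

definition doubling :: "'a::metric_space measure \<Rightarrow> bool" where
  "doubling M \<longleftrightarrow> (\<exists>C. \<forall>x r. r > 0 \<longrightarrow> emeasure M (ball x (2 * r)) \<le> ennreal C * emeasure M (ball x r))"

definition poincare :: "real \<Rightarrow> 'a::metric_space measure \<Rightarrow> bool" where
  "poincare p M \<longleftrightarrow> (\<exists>C>0. \<exists>lam\<ge>1. \<forall>x r (f::'a \<Rightarrow> real) g. r > 0 \<and> integrable M f \<and>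
     upper_gradient UNIV (\<lambda>y. ereal (f y)) g \<longrightarrow>
     ennreal ((1 / measure M (ball x r)) *
        (\<integral>y \<in> ball x r. \<bar>f y - (1 / measure M (ball x r)) * (\<integral>z \<in> ball x r. f z \<partial>M)\<bar> \<partial>M))
     \<le> ennreal C * ennreal (diameter (ball x r)) *
        epow ((1 / emeasure M (ball x (lam * r))) * (\<integral>\<^sup>+ y \<in> ball x (lam * r). epow (g y) p \<partial>M)) (1 / p))"

definition standing_assumptions :: "real \<Rightarrow> 'a::{metric_space,complete_space} measure \<Rightarrow> bool" where
  "standing_assumptions p M \<longleftrightarrow> 1 < p \<and>
     (\<exists>\<nu>. sets \<nu> = sets borel \<and> M = completion \<nu>) \<and>
     (\<forall>x r. r > 0 \<longrightarrow> 0 < emeasure M (ball x r) \<and> emeasure M (ball x r) < \<infinity>) \<and>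
     doubling M \<and> poincare p M"

end

theory Submission
  imports Defs
begin

text \<open>
  Everything rests on the fact that a bounded function
  \<open>w\<close> with an upper gradient in \<open>L\<^sup>p\<close> has a lower semicontinuous majorant \<open>h\<close> with \<open>h - w\<close> small
  in \<open>N\<^sup>1\<^sup>,\<^sup>p\<close>. Enlarge the gradient to a lower semicontinuous \<open>G \<ge> 1\<close>, let \<open>w\<close> be continuous on
  a closed set \<open>K\<close> whose complement is small for \<open>G\<^sup>p d\<mu>\<close>, and let \<open>h x\<close> be the infimum of
  \<open>w y + \<integral>\<^sub>\<gamma> G\<close> over curves \<open>\<gamma>\<close> from \<open>x\<close> to \<open>y \<in> K\<close>. Doubling and completeness make closed balls
  compact, so limits of curves exist and \<open>h\<close> is lower semicontinuous; since \<open>h = w\<close> on \<open>K\<close>, the function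
  \<open>h - w\<close> has an upper gradient living off \<open>K\<close>. Squeezing \<open>w\<close> between such majorants and minorants gives
  quasicontinuity on the whole space.

  For \<open>u\<close> in \<open>N\<^sup>1\<^sup>,\<^sup>p(U)\<close> with \<open>U\<close> quasiopen, pick a small open \<open>G\<close> with \<open>U \<union> G\<close> open and a capacity test
  function \<open>w\<close> for \<open>G\<close>. The cutoff \<open>\<eta> = min (1 - w) (dist (x, X - (U \<union> G)))\<close> vanishes off \<open>U\<close>, and
  \<open>min u\<^sup>+ (k \<eta>)\<close>, extended by zero, lies in \<open>N\<^sup>1\<^sup>,\<^sup>p\<close> of the whole space and agrees with \<open>u\<^sup>+\<close>
  where \<open>\<eta>\<close> is positive and \<open>k\<close> is large.

  Conversely, almost every curve avoids some member of a sequence of sets whose capacities tend to zero. So a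
  quasicontinuous \<open>u\<close> is continuous on almost every curve, where it then coincides with any representative
  in \<open>N\<^sup>1\<^sup>,\<^sup>p(U)\<close>, and so inherits absolute continuity and the upper gradient.
\<close>

subsection \<open>Powers of extended nonnegative reals\<close>

text \<open>Three obstacles shape the details. First, limits of arc-length curves are only
  1-Lipschitz and may be constant. The majorants therefore use Lipschitz paths, to which a one-sided
  change of variables carries the upper gradient inequality over; \<open>G \<ge> 1\<close> bounds
  the length of near-optimal paths, without which no limit path need exist. Second, functions are
  measurable for the completed measure, whereas line integrals need Borel integrands and can see
  null sets. So gradients on U get Borel extensions with the same integral, and test functions get
  Borel majorants that agree with them almost everywhere. Third, the truncation of the positive part
  by a multiple of the cutoff is blind to infinite values. The set where they occur needs its own
  argument: every curve through it has infinite gradient integral, so arbitrarily small multiples of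
  the gradient serve its indicator. Countable families are combined by suprema rather than sums,
  because the p-th power of a supremum is at most the sum of the p-th powers; Minkowski's inequality
  is thereby avoided.\<close>

lemma epow_ennreal: "0 \<le> x \<Longrightarrow> epow (ennreal x) q = ennreal (x powr q)"
  by (simp add: epow_def)

lemma epow_top [simp]: "epow \<infinity> q = \<infinity>" "epow top q = top"
  by (simp_all add: epow_def)

lemma epow_zero [simp]: "epow 0 q = 0"
  by (simp add: epow_def)

lemma epow_one [simp]: "epow 1 q = 1"
  by (simp add: epow_def)

lemma epow_mono:
  assumes "0 < q" "x \<le> y"
  shows "epow x q \<le> epow y q"
proof (cases y)
  case (real b)
  with assms obtain a where "x = ennreal a" "0 \<le> a" "a \<le> b"
    by (cases x) (auto simp: top_unique)
  with real assms show ?thesis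
    by (simp add: epow_ennreal powr_mono2)
qed simp

lemma epow_mult:
  assumes "0 < q"
  shows "epow (x * y) q = epow x q * epow y q"
proof (cases x; cases y)
  fix a b assume "x = ennreal a" "0 \<le> a" "y = ennreal b" "0 \<le> b"
  then show ?thesis
    by (simp add: epow_ennreal powr_mult flip: ennreal_mult)
next
  fix a assume "x = ennreal a" "0 \<le> a" "y = top"
  then show ?thesis
    by (cases "a = 0") (auto simp: epow_ennreal ennreal_mult_top)
next
  fix b assume "x = top" "y = ennreal b" "0 \<le> b"
  then show ?thesis
    by (cases "b = 0") (auto simp: epow_ennreal ennreal_top_mult)
qed (simp add: ennreal_mult_top)

lemma epow_epow:
  assumes "0 < q" "0 < r"
  shows "epow (epow x q) r = epow x (q * r)"
  by (cases x) (simp_all add: epow_ennreal powr_powr)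

lemma epow_exponent_one [simp]: "epow x 1 = x"
  by (cases x) (simp_all add: epow_ennreal)

lemma epow_indicator: "0 < q \<Longrightarrow> epow (x * indicator A z) q = epow x q * indicator A z"
  by (auto simp: indicator_def)

text \<open>Each term is at most the q-th root of the whole series, hence so is the supremum. This
  is how countably many test functions or gradients are combined without losing a constant.\<close>

lemma epow_SUP_le:
  fixes f :: "nat \<Rightarrow> ennreal"
  assumes "0 < q"
  shows "epow (SUP i. f i) q \<le> (\<Sum>i. epow (f i) q)"
proof -
  let ?y = "\<Sum>i. epow (f i) q"
  have "f i \<le> epow ?y (1 / q)" for i
  proof -
    have "epow (f i) q = (\<Sum>n\<in>{i}. epow (f n) q)"
      by simp
    also have "\<dots> \<le> ?y"
      by (rule sum_le_suminf) auto
    finally have "epow (epow (f i) q) (1 / q) \<le> epow ?y (1 / q)"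
      using assms by (intro epow_mono) auto
    then show ?thesis
      using assms by (simp add: epow_epow)
  qed
  then have "epow (SUP i. f i) q \<le> epow (epow ?y (1 / q)) q"
    using assms by (intro epow_mono SUP_least) auto
  then show ?thesis
    using assms by (simp add: epow_epow)
qed

text \<open>From \<open>x + y \<le> 2 * max x y\<close>. The constant is not sharp, but it is
  absorbed wherever it occurs by asking for smaller capacities beforehand.\<close>

lemma epow_add_le:
  assumes "0 < q"
  shows "epow (x + y) q \<le> ennreal (2 powr q) * (epow x q + epow y q)"
proof -
  have "x + y \<le> 2 * max x y"
    by (metis add_mono max.cobounded1 max.cobounded2 mult_2)
  then have "epow (x + y) q \<le> epow (ennreal 2 * max x y) q"
    using assms by (intro epow_mono) auto
  also have "\<dots> = ennreal (2 powr q) * epow (max x y) q"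
    by (subst epow_mult[OF assms]) (subst epow_ennreal, simp_all)
  also have "\<dots> \<le> ennreal (2 powr q) * (epow x q + epow y q)"
    by (intro mult_left_mono) (auto simp: max_def)
  finally show ?thesis .
qed

lemma borel_measurable_epow [measurable (raw)]:
  assumes "f \<in> borel_measurable N"
  shows "(\<lambda>x. epow (f x) q) \<in> borel_measurable N"
proof -
  have [measurable]: "f \<in> borel_measurable N" by fact
  show ?thesis
    unfolding epow_def by measurable
qed

subsection \<open>Length of curves\<close>

abbreviation partitions :: "real \<Rightarrow> real \<Rightarrow> (nat \<times> (nat \<Rightarrow> real)) set" where
  "partitions a b \<equiv> {(n, t). t 0 = a \<and> t n = b \<and> (\<forall>i<n. t i \<le> t (Suc i))}"

lemma partition_sum_le:
  assumes "t 0 = a" "t n = b" "\<And>i. i < n \<Longrightarrow> t i \<le> t (Suc i)"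
  shows "(\<Sum>i<n. ennreal (dist (\<gamma> (t i)) (\<gamma> (t (Suc i))))) \<le> curve_variation \<gamma> a b"
proof -
  have "(n, t) \<in> partitions a b" using assms by auto
  from SUP_upper[OF this, of "\<lambda>nt. \<Sum>i<fst nt. ennreal (dist (\<gamma> (snd nt i)) (\<gamma> (snd nt (Suc i))))"]
  show ?thesis by (simp add: curve_variation_def)
qed

lemma curve_variation_leI:
  assumes "\<And>n t. t 0 = a \<Longrightarrow> t n = b \<Longrightarrow> (\<And>i. i < n \<Longrightarrow> t i \<le> t (Suc i)) \<Longrightarrow>
     (\<Sum>i<n. ennreal (dist (\<gamma> (t i)) (\<gamma> (t (Suc i))))) \<le> c"
  shows "curve_variation \<gamma> a b \<le> c"
  unfolding curve_variation_def by (rule SUP_least) (use assms in auto)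

lemma partition_mono:
  fixes t :: "nat \<Rightarrow> real"
  assumes "\<And>i. i < n \<Longrightarrow> t i \<le> t (Suc i)" "i \<le> j" "j \<le> n"
  shows "t i \<le> t j"
  using assms(2,3)
proof (induction j rule: dec_induct)
  case (step k)
  then show ?case using assms(1)[of k] by linarith
qed simp

lemma dist_le_curve_variation:
  assumes "a \<le> b"
  shows "ennreal (dist (\<gamma> a) (\<gamma> b)) \<le> curve_variation \<gamma> a b"
  using partition_sum_le[of "\<lambda>i. if i = 0 then a else b" a 1 b \<gamma>] assms by simp

text \<open>Partitions are carried forward by \<open>\<phi>\<close>. Continuity of
  \<open>\<phi>\<close> is deliberately not assumed: in the arc-length parametrization it is a right
  inverse of the length function, which may jump.\<close>

lemma curve_variation_comp_le:
  assumes "\<And>x y. s \<le> x \<Longrightarrow> x \<le> y \<Longrightarrow> y \<le> t \<Longrightarrow> \<phi> x \<le> \<phi> y"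
  shows "curve_variation (\<lambda>x. \<gamma> (\<phi> x)) s t \<le> curve_variation \<gamma> (\<phi> s) (\<phi> t)"
proof (rule curve_variation_leI)
  fix n and r :: "nat \<Rightarrow> real"
  assume r: "r 0 = s" "r n = t" "\<And>i. i < n \<Longrightarrow> r i \<le> r (Suc i)"
  have "\<phi> (r i) \<le> \<phi> (r (Suc i))" if "i < n" for i
    using assms[of "r i" "r (Suc i)"] partition_mono[of n r 0 i, OF r(3)] partition_mono[of n r "Suc i" n, OF r(3)] r that
    by simp
  then show "(\<Sum>i<n. ennreal (dist (\<gamma> (\<phi> (r i))) (\<gamma> (\<phi> (r (Suc i)))))) \<le> curve_variation \<gamma> (\<phi> s) (\<phi> t)"
    using partition_sum_le[of "\<lambda>i. \<phi> (r i)" "\<phi> s" n "\<phi> t" \<gamma>] r by simp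
qed

lemma curve_variation_shift:
  "curve_variation (\<lambda>x. \<gamma> (a + x)) s t = curve_variation \<gamma> (a + s) (a + t)"
proof (rule antisym)
  show "curve_variation (\<lambda>x. \<gamma> (a + x)) s t \<le> curve_variation \<gamma> (a + s) (a + t)"
    by (rule curve_variation_comp_le) simp
  show "curve_variation \<gamma> (a + s) (a + t) \<le> curve_variation (\<lambda>x. \<gamma> (a + x)) s t"
    using curve_variation_comp_le[of "a + s" "a + t" "\<lambda>x. x - a" "\<lambda>x. \<gamma> (a + x)"] by simp
qed

lemma curve_variation_add:
  assumes "a \<le> b" "b \<le> c"
  shows "curve_variation \<gamma> a c = curve_variation \<gamma> a b + curve_variation \<gamma> b c"
proof (rule antisym)
  let ?d = "\<lambda>t i. ennreal (dist (\<gamma> (t i)) (\<gamma> (t (Suc i))))"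
  show "curve_variation \<gamma> a c \<le> curve_variation \<gamma> a b + curve_variation \<gamma> b c"
  proof (rule curve_variation_leI)
    fix n and t :: "nat \<Rightarrow> real"
    assume t: "t 0 = a" "t n = c" "\<And>i. i < n \<Longrightarrow> t i \<le> t (Suc i)"
    \<comment> \<open>Cutting at b: both sequences are partitions, of [a, b] and [b, c]. An interval
      of t that does not contain b is degenerate in one of them, and the one that contains b is
      split by the triangle inequality.\<close>
    let ?l = "\<lambda>i. min (t i) b" and ?r = "\<lambda>i. max (t i) b"
    have "?d t i \<le> ?d ?l i + ?d ?r i" if "i < n" for i
      using t(3)[OF that] dist_triangle[of "\<gamma> (t i)" "\<gamma> (t (Suc i))" "\<gamma> b"]
      by (auto simp: min_def max_def simp flip: ennreal_plus)
    then have "(\<Sum>i<n. ?d t i) \<le> (\<Sum>i<n. ?d ?l i) + (\<Sum>i<n. ?d ?r i)"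
      unfolding sum.distrib[symmetric] by (intro sum_mono) auto
    also have "\<dots> \<le> curve_variation \<gamma> a b + curve_variation \<gamma> b c"
      using assms t by (intro add_mono partition_sum_le) (force simp: min_def max_def)+
    finally show "(\<Sum>i<n. ?d t i) \<le> curve_variation \<gamma> a b + curve_variation \<gamma> b c" .
  qed
  have join: "(\<Sum>i<n. ?d t i) + (\<Sum>i<m. ?d r i) \<le> curve_variation \<gamma> a c"
    if "(n, t) \<in> partitions a b" "(m, r) \<in> partitions b c" for n t m r
  proof -
    \<comment> \<open>Concatenation; the two partitions share the point
      \<open>t n = b = r 0\<close>, so index n may be read off from either.\<close>
    define q where "q i = (if i \<le> n then t i else r (i - n))" for i
    have split: "(\<Sum>i<n+k. ?d q i) = (\<Sum>i<n. ?d q i) + (\<Sum>i<k. ?d q (n + i))" for k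
      by (induction k) (auto simp: add.assoc)
    have "?d q i = ?d t i" if "i < n" for i
      using that by (simp add: q_def)
    moreover have "?d q (n + i) = ?d r i" for i
      using that by (auto simp: q_def)
    ultimately have "(\<Sum>i<n. ?d t i) + (\<Sum>i<m. ?d r i) = (\<Sum>i<n+m. ?d q i)"
      by (simp add: split)
    also have "\<dots> \<le> curve_variation \<gamma> a c"
    proof (rule partition_sum_le)
      show "q 0 = a" "q (n + m) = c" using that by (auto simp: q_def)
      fix i assume "i < n + m"
      then consider "i < n" | "i = n" "0 < m" | "n < i" "i - n < m" by linarith
      then show "q i \<le> q (Suc i)"
      proof cases
        case 2
        then show ?thesis using that by (auto simp: q_def)
      next
        case 3
        then have "r (i - n) \<le> r (Suc (i - n))" using that by auto
        then show ?thesis using 3 by (simp add: q_def Suc_diff_le)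
      qed (use that in \<open>auto simp: q_def\<close>)
    qed
    finally show ?thesis .
  qed
  have ne: "partitions x y \<noteq> {}" if "x \<le> y" for x y
    using that by (auto intro!: exI[of _ 1] exI[of _ "\<lambda>i. if i = 0 then x else y"])
  show "curve_variation \<gamma> a b + curve_variation \<gamma> b c \<le> curve_variation \<gamma> a c"
    unfolding curve_variation_def[of \<gamma> a b] curve_variation_def[of \<gamma> b c]
    unfolding ennreal_SUP_add_left[OF ne[OF assms(1)], symmetric]
  proof (rule SUP_least)
    fix nt assume nt: "nt \<in> partitions a b"
    show "(\<Sum>i<fst nt. ?d (snd nt) i) + (SUP mr\<in>partitions b c. \<Sum>i<fst mr. ?d (snd mr) i) \<le> curve_variation \<gamma> a c"
      unfolding ennreal_SUP_add_right[OF ne[OF assms(2)]]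
    proof (rule SUP_least)
      fix mr assume mr: "mr \<in> partitions b c"
      show "(\<Sum>i<fst nt. ?d (snd nt) i) + (\<Sum>i<fst mr. ?d (snd mr) i) \<le> curve_variation \<gamma> a c"
        using join[of "fst nt" "snd nt" "fst mr" "snd mr"] nt mr by simp
    qed
  qed
qed

lemma is_curve_subcurve:
  assumes "is_curve \<gamma> l" "0 \<le> a" "a < b" "b \<le> l"
  shows "is_curve (\<lambda>t. \<gamma> (a + t)) (b - a)"
  using assms by (auto simp: is_curve_def curve_variation_shift)

lemma curve_in_subcurve:
  assumes "is_curve \<gamma> l" "0 \<le> a" "a < b" "b \<le> l" "\<gamma> ` {a..b} \<subseteq> E"
  shows "curve_in E (\<lambda>t. \<gamma> (a + t)) (b - a)"
  using is_curve_subcurve[OF assms(1-4)] assms(5) by (auto simp: curve_in_def image_subset_iff)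

lemma is_curve_lipschitz:
  assumes "is_curve \<gamma> l"
  shows "1-lipschitz_on {0..l} \<gamma>"
proof -
  have *: "dist (\<gamma> s) (\<gamma> t) \<le> t - s" if "0 \<le> s" "s \<le> t" "t \<le> l" for s t
  proof -
    have "ennreal (dist (\<gamma> s) (\<gamma> t)) \<le> ennreal (t - s)"
      using dist_le_curve_variation[of s t \<gamma>] assms that by (simp add: is_curve_def)
    then show ?thesis using that by (auto simp: ennreal_le_iff2)
  qed
  show ?thesis
  proof (rule lipschitz_onI)
    fix s t assume "s \<in> {0..l}" "t \<in> {0..l}"
    then show "dist (\<gamma> s) (\<gamma> t) \<le> 1 * dist s t"
      using *[of s t] *[of t s] by (cases "s \<le> t") (auto simp: dist_real_def dist_commute)
  qed simp
qed

lemma borel_measurable_along: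
  fixes g :: "'a::metric_space \<Rightarrow> ennreal" and a b :: real
  assumes "continuous_on {a..b} \<gamma>" "g \<in> borel_measurable (restrict_space borel E)" "\<gamma> ` {a..b} \<subseteq> E"
  shows "(\<lambda>t. g (\<gamma> t) * indicator {a..b} t) \<in> borel_measurable borel"
proof -
  have "\<gamma> \<in> restrict_space borel {a..b} \<rightarrow>\<^sub>M restrict_space borel E"
    using assms by (intro measurable_restrict_space2 borel_measurable_continuous_on_restrict) (auto simp: space_restrict_space)
  from measurable_comp[OF this assms(2)] show ?thesis
    by (subst (asm) borel_measurable_restrict_space_iff_ennreal) (simp_all add: o_def)
qed

lemma borel_measurable_along_UNIV:
  fixes g :: "'a::metric_space \<Rightarrow> ennreal" and a b :: real
  assumes "continuous_on {a..b} \<gamma>" "g \<in> borel_measurable borel"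
  shows "(\<lambda>t. g (\<gamma> t) * indicator {a..b} t) \<in> borel_measurable borel"
  using assms by (intro borel_measurable_along[where E=UNIV]) auto

lemma line_integral_shift:
  fixes g :: "'a::metric_space \<Rightarrow> ennreal"
  assumes "(\<lambda>t. g (\<gamma> t) * indicator {a..b} t) \<in> borel_measurable borel"
  shows "line_integral g (\<lambda>t. \<gamma> (a + t)) (b - a) = (\<integral>\<^sup>+ t\<in>{a..b}. g (\<gamma> t) \<partial>lborel)"
proof -
  have "(\<integral>\<^sup>+ t\<in>{a..b}. g (\<gamma> t) \<partial>lborel) = (\<integral>\<^sup>+ t. g (\<gamma> (a + 1 * t)) * indicator {a..b} (a + 1 * t) \<partial>lborel)"
    using assms by (subst nn_integral_real_affine[of _ 1 a]) auto
  also have "\<dots> = line_integral g (\<lambda>t. \<gamma> (a + t)) (b - a)"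
    unfolding line_integral_def by (intro nn_integral_cong) (auto simp: indicator_def)
  finally show ?thesis ..
qed

lemma set_nn_integral_Icc_split:
  fixes G :: "real \<Rightarrow> ennreal"
  assumes "(\<lambda>t. G t * indicator {a..c} t) \<in> borel_measurable borel" "a \<le> b" "b \<le> c"
  shows "(\<integral>\<^sup>+ t\<in>{a..c}. G t \<partial>lborel) = (\<integral>\<^sup>+ t\<in>{a..b}. G t \<partial>lborel) + (\<integral>\<^sup>+ t\<in>{b..c}. G t \<partial>lborel)"
proof -
  let ?G = "\<lambda>t. G t * indicator {a..c} t"
  have [measurable]: "?G \<in> borel_measurable borel" by fact
  \<comment> \<open>The closed halves overlap in b, which is counted twice on the right but is a
    null set.\<close>
  have "(\<integral>\<^sup>+ t\<in>{a..c}. G t \<partial>lborel) = (\<integral>\<^sup>+ t. ?G t * indicator {a..b} t + ?G t * indicator {b..c} t \<partial>lborel)"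
    by (rule nn_integral_cong_AE, rule AE_mp[OF AE_lborel_singleton[of b]])
      (use assms in \<open>auto simp: indicator_def\<close>)
  also have "\<dots> = (\<integral>\<^sup>+ t. ?G t * indicator {a..b} t \<partial>lborel) + (\<integral>\<^sup>+ t. ?G t * indicator {b..c} t \<partial>lborel)"
    by (intro nn_integral_add) auto
  also have "(\<integral>\<^sup>+ t. ?G t * indicator {a..b} t \<partial>lborel) = (\<integral>\<^sup>+ t\<in>{a..b}. G t \<partial>lborel)"
    by (intro nn_integral_cong) (use assms in \<open>auto simp: indicator_def\<close>)
  also have "(\<integral>\<^sup>+ t. ?G t * indicator {b..c} t \<partial>lborel) = (\<integral>\<^sup>+ t\<in>{b..c}. G t \<partial>lborel)"
    by (intro nn_integral_cong) (use assms in \<open>auto simp: indicator_def\<close>)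
  finally show ?thesis .
qed

subsection \<open>Arc-length reparametrization of Lipschitz curves\<close>

text \<open>A 1-Lipschitz map does not lengthen intervals, so the preimage of an interval is at
  least as long as its part in the range. Open sets are countable disjoint unions of intervals, and
  Borel sets follow by outer regularity of the finite image measure. This one-sided change of
  variables needs no derivative of s.\<close>

lemma mono_lipschitz_emeasure_le:
  fixes s :: "real \<Rightarrow> real"
  assumes mono: "\<And>x y. 0 \<le> x \<Longrightarrow> x \<le> y \<Longrightarrow> y \<le> L \<Longrightarrow> s x \<le> s y"
    and lip: "1-lipschitz_on {0..L} s" and s0: "s 0 = 0" and L: "0 \<le> L"
    and A: "A \<in> sets borel"
  shows "emeasure lborel (A \<inter> {0..s L}) \<le> emeasure lborel ({t\<in>{0..L}. s t \<in> A})"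
proof -
  have cont: "continuous_on {0..L} s"
    using lip lipschitz_on_continuous_on by blast
  have [measurable]: "s \<in> restrict_space lborel {0..L} \<rightarrow>\<^sub>M borel"
    using borel_measurable_continuous_on_restrict[OF cont] measurable_cong_sets[of "restrict_space lborel {0..L}" "restrict_space borel {0..L}"]
    by (auto simp: sets_restrict_space)
  define N where "N = distr (restrict_space lborel {0..L}) borel s"
  have N: "emeasure N B = emeasure lborel {t\<in>{0..L}. s t \<in> B}" if "B \<in> sets borel" for B
  proof -
    have "emeasure N B = emeasure (restrict_space lborel {0..L}) (s -` B \<inter> {0..L})"
      using that unfolding N_def by (subst emeasure_distr) (auto simp: space_restrict_space)
    also have "\<dots> = emeasure lborel (s -` B \<inter> {0..L})"
      by (subst emeasure_restrict_space) auto
    also have "s -` B \<inter> {0..L} = {t\<in>{0..L}. s t \<in> B}" by auto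
    finally show ?thesis .
  qed
  have pre: "{t\<in>{0..L}. s t \<in> B} \<in> sets lborel" if "B \<in> sets borel" for B
  proof -
    have "s -` B \<inter> space (restrict_space lborel {0..L}) \<in> sets (restrict_space lborel {0..L})"
      using that by measurable
    moreover have "s -` B \<inter> space (restrict_space lborel {0..L}) = {t\<in>{0..L}. s t \<in> B}"
      by (auto simp: space_restrict_space)
    ultimately show ?thesis by (simp add: sets_restrict_space_iff)
  qed
  have inverse: "\<exists>x\<in>{0..L}. s x = c" if "0 \<le> c" "c \<le> s L" for c
    using IVT'[of s 0 c L] that s0 L cont by auto
  have interval: "emeasure lborel (C \<inter> {0..s L}) \<le> emeasure N C" if C: "open C" "connected C" for C
  proof (cases "C \<inter> {0..s L} = {}")
    case False
    let ?C = "C \<inter> {0..s L}"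
    have bdd: "bdd_below ?C" "bdd_above ?C"
      by (auto intro!: bdd_belowI[of _ 0] bdd_aboveI[of _ "s L"])
    have *: "ennreal (d - c) \<le> emeasure N C" if "c \<in> ?C" "d \<in> ?C" "c \<le> d" for c d
    proof -
      obtain x y where xy: "x \<in> {0..L}" "s x = c" "y \<in> {0..L}" "s y = d"
        using inverse[of c] inverse[of d] \<open>c \<in> ?C\<close> \<open>d \<in> ?C\<close> by auto
      \<comment> \<open>The preimages x and y may come in the wrong order when \<open>c = d\<close>,
        hence \<open>min\<close> and \<open>max\<close>.\<close>
      have "{min x y..max x y} \<subseteq> {t\<in>{0..L}. s t \<in> C}"
      proof
        fix t assume t: "t \<in> {min x y..max x y}"
        then have "t \<in> {0..L}" using xy by auto
        have "s (min x y) \<le> s t" "s t \<le> s (max x y)"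
          using t xy by (auto intro!: mono)
        moreover have "s (min x y) = c \<or> s (min x y) = d" "s (max x y) = c \<or> s (max x y) = d"
          using xy by (auto simp: min_def max_def)
        ultimately have "s t \<in> {c..d}" using \<open>c \<le> d\<close> by auto
        then have "s t \<in> C"
          using connected_contains_Icc[OF C(2), of c d] that by auto
        with \<open>t \<in> {0..L}\<close> show "t \<in> {t\<in>{0..L}. s t \<in> C}" by auto
      qed
      then have "emeasure lborel {min x y..max x y} \<le> emeasure lborel {t\<in>{0..L}. s t \<in> C}"
        by (rule emeasure_mono[OF _ pre]) (rule borel_open[OF C(1)])
      also have "\<dots> = emeasure N C"
        by (rule N[symmetric]) (rule borel_open[OF C(1)])
      finally have "emeasure lborel {min x y..max x y} \<le> emeasure N C" .
      moreover have "d - c \<le> max x y - min x y"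
        using lipschitz_onD[OF lip xy(1,3)] xy by (auto simp: dist_real_def)
      then have "ennreal (d - c) \<le> emeasure lborel {min x y..max x y}"
        by (simp add: ennreal_leI)
      ultimately show ?thesis by (metis order_trans)
    qed
    have "?C \<subseteq> {Inf ?C..Sup ?C}"
      using bdd by (auto intro!: cInf_lower cSup_upper)
    then have "emeasure lborel ?C \<le> emeasure lborel {Inf ?C..Sup ?C}"
      by (intro emeasure_mono) auto
    also have "\<dots> = ennreal (Sup ?C - Inf ?C)"
      using cInf_le_cSup[OF False bdd(2,1)] by simp
    also have "\<dots> \<le> emeasure N C"
    proof (rule ennreal_le_epsilon)
      fix e :: real assume "0 < e"
      obtain c where c: "c \<in> ?C" "c < Inf ?C + e / 2"
        using cInf_lessD[OF False, of "Inf ?C + e / 2"] \<open>0 < e\<close> by auto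
      obtain d where d: "d \<in> ?C" "Sup ?C - e / 2 < d"
        using less_cSupE[of "Sup ?C - e / 2" ?C] False \<open>0 < e\<close> by auto
      \<comment> \<open>If the interval is shorter than e, the chosen points may satisfy
        \<open>d < c\<close>; the truncation at 0 covers that case.\<close>
      have "ennreal (Sup ?C - Inf ?C) \<le> ennreal (max 0 (d - c)) + ennreal e"
        using c d \<open>0 < e\<close> by (auto simp flip: ennreal_plus intro!: ennreal_leI)
      also have "\<dots> \<le> emeasure N C + ennreal e"
        using *[of c d] c(1) d(1) by (intro add_right_mono) (cases "c \<le> d"; simp add: max_def)
      finally show "ennreal (Sup ?C - Inf ?C) \<le> emeasure N C + ennreal e" .
    qed
    finally show ?thesis .
  qed simp
  have opens: "emeasure lborel (B \<inter> {0..s L}) \<le> emeasure N B" if "open B" for B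
  proof -
    have cc: "countable (components B)"
      using pairwise_disjoint_components[of B] open_components[OF that]
      by (intro countable_disjoint_open_subsets) (auto simp: pairwise_def disjnt_def disjoint_def)
    have disj: "disjoint_family_on (\<lambda>C. C) (components B)"
      using pairwise_disjoint_components[of B] by (auto simp: pairwise_def disjoint_family_on_def)
    have ob: "C \<in> sets borel" if "C \<in> components B" for C
      using open_components[OF \<open>open B\<close> that] by auto
    have "B \<inter> {0..s L} = (\<Union>C\<in>components B. C \<inter> {0..s L})"
      using Union_components[of B] by auto
    then have "emeasure lborel (B \<inter> {0..s L}) = (\<integral>\<^sup>+C. emeasure lborel (C \<inter> {0..s L}) \<partial>count_space (components B))"
      using disj ob cc by (simp only:) (intro emeasure_UN_countable, auto simp: disjoint_family_on_def)
    also have "\<dots> \<le> (\<integral>\<^sup>+C. emeasure N C \<partial>count_space (components B))"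
      by (intro nn_integral_mono interval) (auto intro: open_components[OF that] in_components_connected)
    also have "\<dots> = emeasure N (\<Union>C\<in>components B. C)"
      using disj ob cc by (intro emeasure_UN_countable[symmetric]) (auto simp: N_def)
    also have "(\<Union>C\<in>components B. C) = B"
      using Union_components[of B] by auto
    finally show ?thesis .
  qed
  have "emeasure lborel (A \<inter> {0..s L}) \<le> (INF B\<in>{B. A \<subseteq> B \<and> open B}. emeasure N B)"
  proof (rule INF_greatest, clarify)
    fix B assume B: "A \<subseteq> B" "open B"
    have "emeasure lborel (A \<inter> {0..s L}) \<le> emeasure lborel (B \<inter> {0..s L})"
      using B by (intro emeasure_mono) auto
    also have "\<dots> \<le> emeasure N B" by (rule opens[OF B(2)])
    finally show "emeasure lborel (A \<inter> {0..s L}) \<le> emeasure N B" .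
  qed
  also have "\<dots> = emeasure N A"
  proof (rule outer_regular[symmetric, OF _ _ A])
    show "sets N = sets borel" by (simp add: N_def)
    have "emeasure N (space N) \<le> emeasure lborel {0..L}"
      using N[of UNIV] by (simp add: N_def atLeastAtMost_def atLeast_def atMost_def Int_def)
    then show "emeasure N (space N) \<noteq> \<infinity>"
      using L by (auto simp: top_unique)
  qed
  finally show ?thesis using N[OF A] by simp
qed

text \<open>A path of speed at most 1 spends at least as much time as the length it covers, so
  integrating over time dominates integrating over length. Only this direction is wanted: the upper
  gradient inequality, known for arc length, passes to the larger side.\<close>

lemma mono_lipschitz_nn_integral_le:
  fixes s :: "real \<Rightarrow> real" and G :: "real \<Rightarrow> ennreal"
  assumes mono: "\<And>x y. 0 \<le> x \<Longrightarrow> x \<le> y \<Longrightarrow> y \<le> L \<Longrightarrow> s x \<le> s y"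
    and lip: "1-lipschitz_on {0..L} s" and s0: "s 0 = 0" and L: "0 \<le> L"
    and G: "(\<lambda>t. G t * indicator {0..s L} t) \<in> borel_measurable borel"
  shows "(\<integral>\<^sup>+ r\<in>{0..s L}. G r \<partial>lborel) \<le> (\<integral>\<^sup>+ t\<in>{0..L}. G (s t) \<partial>lborel)"
proof -
  let ?G = "\<lambda>t. G t * indicator {0..s L} t"
  have cont: "continuous_on {0..L} s"
    using lip lipschitz_on_continuous_on by blast
  have s: "s \<in> restrict_space lborel {0..L} \<rightarrow>\<^sub>M borel"
    using borel_measurable_continuous_on_restrict[OF cont] measurable_cong_sets[of "restrict_space lborel {0..L}" "restrict_space borel {0..L}"]
    by (auto simp: sets_restrict_space)
  define N where "N = distr (restrict_space lborel {0..L}) borel s"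
  define N' where "N' = density lborel (indicator {0..s L})"
  have "N' \<le> N"
  proof (subst le_measure)
    show "sets N' = sets N" by (simp add: N'_def N_def)
    show "\<forall>A\<in>sets N'. emeasure N' A \<le> emeasure N A"
    proof
      fix A assume "A \<in> sets N'"
      then have A: "A \<in> sets borel" by (simp add: N'_def)
      have "emeasure N' A = emeasure lborel (A \<inter> {0..s L})"
        using A unfolding N'_def by (simp add: emeasure_density nn_integral_cmult indicator_inter_arith[symmetric] Int_commute)
      also have "\<dots> \<le> emeasure lborel ({t\<in>{0..L}. s t \<in> A})"
        by (rule mono_lipschitz_emeasure_le[OF mono lip s0 L A])
      also have "{t\<in>{0..L}. s t \<in> A} = s -` A \<inter> {0..L}" by auto
      also have "emeasure lborel (s -` A \<inter> {0..L}) = emeasure N A"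
        using A s unfolding N_def by (subst emeasure_distr) (auto simp: space_restrict_space emeasure_restrict_space)
      finally show "emeasure N' A \<le> emeasure N A" .
    qed
  qed
  then have "(\<integral>\<^sup>+ r. ?G r \<partial>N') \<le> (\<integral>\<^sup>+ r. ?G r \<partial>N)"
    by (intro nn_integral_mono_measure) (auto simp: N_def N'_def)
  moreover have "(\<integral>\<^sup>+ r. ?G r \<partial>N') = (\<integral>\<^sup>+ r\<in>{0..s L}. G r \<partial>lborel)"
    unfolding N'_def using G by (subst nn_integral_density) (auto intro!: nn_integral_cong simp: indicator_def)
  moreover have "(\<integral>\<^sup>+ r. ?G r \<partial>N) = (\<integral>\<^sup>+ t\<in>{0..L}. ?G (s t) \<partial>lborel)"
    unfolding N_def using G s
    by (subst nn_integral_distr) (auto simp: nn_integral_restrict_space)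
  moreover have "(\<integral>\<^sup>+ t\<in>{0..L}. ?G (s t) \<partial>lborel) = (\<integral>\<^sup>+ t\<in>{0..L}. G (s t) \<partial>lborel)"
  proof (intro nn_integral_cong)
    fix t
    show "?G (s t) * indicator {0..L} t = G (s t) * indicator {0..L} t"
      using mono[of 0 t] mono[of t L] s0 by (auto simp: indicator_def)
  qed
  ultimately show ?thesis by simp
qed

text \<open>Take for s the length of \<open>\<gamma>\<close> on [0, t] and for
  \<open>\<gamma>'\<close> the composition of \<open>\<gamma>\<close> with any right inverse of s;
  the choice does not matter, since \<open>\<gamma>\<close> is constant wherever s is. A path of
  length 0 has no counterpart among the nonconstant curves and falls under the first alternative,
  where equality of the endpoints makes every upper gradient inequality trivial.\<close>

lemma lipschitz_curve_arc_length:
  fixes \<gamma> :: "real \<Rightarrow> 'a::metric_space"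
  assumes lip: "1-lipschitz_on {0..L} \<gamma>" and L: "0 \<le> L"
  obtains "\<gamma> 0 = \<gamma> L"
  | \<gamma>' s where "is_curve \<gamma>' (s L)" "\<And>t. t \<in> {0..L} \<Longrightarrow> \<gamma>' (s t) = \<gamma> t" "s 0 = 0"
      "\<And>x y. 0 \<le> x \<Longrightarrow> x \<le> y \<Longrightarrow> y \<le> L \<Longrightarrow> s x \<le> s y" "1-lipschitz_on {0..L} s"
proof -
  have cv_le: "curve_variation \<gamma> a b \<le> ennreal (b - a)" if "0 \<le> a" "a \<le> b" "b \<le> L" for a b
  proof (rule curve_variation_leI)
    fix n and t :: "nat \<Rightarrow> real"
    assume t: "t 0 = a" "t n = b" "\<And>i. i < n \<Longrightarrow> t i \<le> t (Suc i)"
    have "dist (\<gamma> (t i)) (\<gamma> (t (Suc i))) \<le> t (Suc i) - t i" if "i < n" for i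
      using lipschitz_onD[OF lip, of "t i" "t (Suc i)"] t(1,2) t(3)[OF that] partition_mono[of n t 0 i, OF t(3)]
        partition_mono[of n t "Suc i" n, OF t(3)] \<open>0 \<le> a\<close> \<open>b \<le> L\<close> that
      by (auto simp: dist_real_def)
    then have "(\<Sum>i<n. dist (\<gamma> (t i)) (\<gamma> (t (Suc i)))) \<le> (\<Sum>i<n. t (Suc i) - t i)"
      by (intro sum_mono) auto
    also have "\<dots> = b - a"
      using t by (simp add: sum_lessThan_telescope)
    finally show "(\<Sum>i<n. ennreal (dist (\<gamma> (t i)) (\<gamma> (t (Suc i))))) \<le> ennreal (b - a)"
      by (simp add: ennreal_leI)
  qed
  define s where "s t = enn2real (curve_variation \<gamma> 0 t)" for t
  have cv: "curve_variation \<gamma> a b = ennreal (s b - s a)" and s_diff: "0 \<le> s b - s a" "s b - s a \<le> b - a"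
    if ab: "0 \<le> a" "a \<le> b" "b \<le> L" for a b
  proof -
    obtain x where x: "curve_variation \<gamma> 0 a = ennreal x" "0 \<le> x"
      using cv_le[of 0 a] ab by (cases "curve_variation \<gamma> 0 a") (auto simp: top_unique)
    obtain y where y: "curve_variation \<gamma> a b = ennreal y" "0 \<le> y"
      using cv_le[of a b] ab by (cases "curve_variation \<gamma> a b") (auto simp: top_unique)
    have "curve_variation \<gamma> 0 b = ennreal (x + y)"
      using curve_variation_add[of 0 a b \<gamma>] that x y by simp
    then have "s b - s a = y"
      using x y by (simp add: s_def del: ennreal_plus)
    with y cv_le[of a b] that show "curve_variation \<gamma> a b = ennreal (s b - s a)" "0 \<le> s b - s a" "s b - s a \<le> b - a"
      by (auto simp: ennreal_le_iff2)
  qed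
  have s0: "s 0 = 0" using cv_le[of 0 0] L by (simp add: s_def)
  have mono: "s x \<le> s y" if "0 \<le> x" "x \<le> y" "y \<le> L" for x y
    using s_diff[OF that] by simp
  have lips: "1-lipschitz_on {0..L} s"
  proof (rule lipschitz_onI)
    fix x y assume "x \<in> {0..L}" "y \<in> {0..L}"
    then show "dist (s x) (s y) \<le> 1 * dist x y"
      using s_diff[of x y] s_diff[of y x] by (cases "x \<le> y") (auto simp: dist_real_def)
  qed simp
  have const_le: "\<gamma> a = \<gamma> b" if "0 \<le> a" "b \<le> L" "s a = s b" "a \<le> b" for a b
    using dist_le_curve_variation[of a b \<gamma>] cv[of a b] that by simp
  have const: "\<gamma> a = \<gamma> b" if "a \<in> {0..L}" "b \<in> {0..L}" "s a = s b" for a b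
  proof (cases "a \<le> b")
    case True
    with that show ?thesis by (intro const_le) auto
  next
    case False
    with that show ?thesis by (intro const_le[symmetric]) auto
  qed
  show thesis
  proof (cases "s L = 0")
    case True
    then have "\<gamma> 0 = \<gamma> L" using const[of 0 L] L s0 by simp
    then show thesis by (rule that(1))
  next
    case False
    then have "0 < s L" using mono[of 0 L] L s0 by simp
    have "\<exists>t\<in>{0..L}. s t = r" if "r \<in> {0..s L}" for r
      using IVT'[of s 0 r L] that s0 L lipschitz_on_continuous_on[OF lips] by auto
    then obtain \<tau> where \<tau>: "\<And>r. r \<in> {0..s L} \<Longrightarrow> \<tau> r \<in> {0..L}" "\<And>r. r \<in> {0..s L} \<Longrightarrow> s (\<tau> r) = r"
      by metis
    have \<tau>_mono: "\<tau> r \<le> \<tau> r'" if "0 \<le> r" "r \<le> r'" "r' \<le> s L" for r r'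
    proof (rule ccontr)
      assume less: "\<not> ?thesis"
      then have "s (\<tau> r') \<le> s (\<tau> r)"
        using \<tau>(1)[of r] \<tau>(1)[of r'] that by (intro mono) auto
      then have "r = r'" using \<tau>(2)[of r] \<tau>(2)[of r'] that by auto
      then show False using less by simp
    qed
    define \<gamma>' where "\<gamma>' r = \<gamma> (\<tau> r)" for r
    have \<gamma>': "\<gamma>' (s t) = \<gamma> t" if "t \<in> {0..L}" for t
    proof -
      have "s t \<in> {0..s L}" using that mono[of 0 t] mono[of t L] s0 by simp
      then show ?thesis unfolding \<gamma>'_def using that by (intro const \<tau>)
    qed
    have "is_curve \<gamma>' (s L)"
      unfolding is_curve_def
    proof (intro conjI allI impI)
      fix r r' assume r: "0 \<le> r \<and> r \<le> r' \<and> r' \<le> s L"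
      let ?a = "\<tau> r" and ?b = "\<tau> r'"
      have ab: "0 \<le> ?a" "?a \<le> ?b" "?b \<le> L" "s ?a = r" "s ?b = r'"
        using \<tau> \<tau>_mono r by auto
      then have "ennreal (r' - r) = curve_variation \<gamma> ?a ?b"
        using cv[of ?a ?b] by simp
      moreover have "curve_variation \<gamma>' r r' \<le> curve_variation \<gamma> ?a ?b"
        unfolding \<gamma>'_def using r by (intro curve_variation_comp_le \<tau>_mono) auto
      \<comment> \<open>A partition of the time interval is mapped by s to a partition of [r, r']
        with the same points on the curve, because
        \<open>\<gamma>' (s t) = \<gamma> t\<close>.\<close>
      moreover have "curve_variation \<gamma> ?a ?b \<le> curve_variation \<gamma>' r r'"
      proof (rule curve_variation_leI)
        fix n and t :: "nat \<Rightarrow> real"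
        assume t: "t 0 = ?a" "t n = ?b" "\<And>i. i < n \<Longrightarrow> t i \<le> t (Suc i)"
        have tin: "t i \<in> {0..L}" if "i \<le> n" for i
          using partition_mono[of n t 0 i, OF t(3)] partition_mono[of n t i n, OF t(3)] t that ab by auto
        have "(\<Sum>i<n. ennreal (dist (\<gamma> (t i)) (\<gamma> (t (Suc i))))) = (\<Sum>i<n. ennreal (dist (\<gamma>' (s (t i))) (\<gamma>' (s (t (Suc i))))))"
          using tin by (intro sum.cong) (auto simp: \<gamma>')
        also have "\<dots> \<le> curve_variation \<gamma>' r r'"
          using t ab tin by (intro partition_sum_le[of "\<lambda>i. s (t i)"] mono) (auto simp: Suc_leI)
        finally show "(\<Sum>i<n. ennreal (dist (\<gamma> (t i)) (\<gamma> (t (Suc i))))) \<le> curve_variation \<gamma>' r r'" .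
      qed
      ultimately show "curve_variation \<gamma>' r r' = ennreal (r' - r)" by simp
    qed fact
    then show thesis
      by (rule that(2)) (use \<gamma>' s0 mono lips in auto)
  qed
qed

section \<open>Upper gradients along Lipschitz paths\<close>

abbreviation real_upper_gradient :: "('a::metric_space \<Rightarrow> real) \<Rightarrow> ('a \<Rightarrow> ennreal) \<Rightarrow> bool" where
  "real_upper_gradient f g \<equiv> upper_gradient UNIV (\<lambda>x. ereal (f x)) g"

lemma ug_lhs_ereal [simp]: "ug_lhs (ereal a) (ereal b) = ennreal \<bar>a - b\<bar>"
  by (simp add: ug_lhs_def)

text \<open>The definition speaks of arc-length curves only, but concatenated paths, constant paths
  and limits of paths are merely Lipschitz. The passage costs nothing because the time integral
  dominates the length integral.\<close>

lemma real_upper_gradient_lipschitz: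
  fixes \<gamma> :: "real \<Rightarrow> 'a::metric_space"
  assumes ug: "real_upper_gradient f g" and lip: "1-lipschitz_on {0..L} \<gamma>" and L: "0 \<le> L"
  shows "ennreal \<bar>f (\<gamma> 0) - f (\<gamma> L)\<bar> \<le> (\<integral>\<^sup>+ t\<in>{0..L}. g (\<gamma> t) \<partial>lborel)"
  using lip L
proof (cases rule: lipschitz_curve_arc_length)
  case (2 \<gamma>' s)
  have "curve_in UNIV \<gamma>' (s L)" using 2 by (simp add: curve_in_def)
  then have "ug_lhs (ereal (f (\<gamma>' 0))) (ereal (f (\<gamma>' (s L)))) \<le> line_integral g \<gamma>' (s L)"
    using ug unfolding upper_gradient_def by blast
  also have "line_integral g \<gamma>' (s L) \<le> (\<integral>\<^sup>+ t\<in>{0..L}. g (\<gamma>' (s t)) \<partial>lborel)"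
    unfolding line_integral_def
  proof (rule mono_lipschitz_nn_integral_le)
    show "(\<lambda>t. g (\<gamma>' t) * indicator {0..s L} t) \<in> borel_measurable borel"
      using ug is_curve_lipschitz[OF 2(1)] by (intro borel_measurable_along_UNIV)
        (auto simp: upper_gradient_def intro: lipschitz_on_continuous_on)
  qed (use 2 L in auto)
  also have "\<dots> = (\<integral>\<^sup>+ t\<in>{0..L}. g (\<gamma> t) \<partial>lborel)"
    by (intro nn_integral_cong) (auto simp: indicator_def 2)
  finally show ?thesis using 2(2)[of 0] 2(2)[of L] 2(3) L by simp
qed simp

subsection \<open>Regularity of the measure\<close>

lemma suminf_half_powers: "0 \<le> e \<Longrightarrow> (\<Sum>i. ennreal (e * (1/2)^Suc i)) = ennreal e"
  using sums_mult[OF power_half_series, of e] by (intro suminf_ennreal_eq) (auto simp del: power_Suc)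

text \<open>The sets that can be squeezed between closed and open sets form a sigma-algebra:
  complements exchange the two roles, and closed sets belong to it as decreasing intersections of
  their open distance neighbourhoods.\<close>

lemma borel_regular_finite:
  fixes N :: "'a::metric_space measure"
  assumes "sets N = sets borel" "emeasure N UNIV < \<infinity>" "A \<in> sets borel" "0 < (e::real)"
  shows "\<exists>F G. closed F \<and> open G \<and> F \<subseteq> A \<and> A \<subseteq> G \<and> emeasure N (G - F) < ennreal e"
proof -
  have [simp]: "open S \<Longrightarrow> S \<in> sets N" "closed S \<Longrightarrow> S \<in> sets N" for S
    using assms(1) by auto
  have fin: "emeasure N S \<noteq> \<infinity>" for S
  proof (cases "S \<in> sets N")
    case True
    then have "emeasure N S \<le> emeasure N UNIV" using assms(1) by (intro emeasure_mono) auto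
    then show ?thesis using assms(2) by (auto simp: top_unique)
  qed (simp add: emeasure_notin_sets)
  have "A \<in> sigma_sets UNIV (Collect closed)"
    using assms(3) unfolding borel_eq_closed by (simp add: Collect_mono)
  then show ?thesis
    using \<open>0 < e\<close>
  proof (induction arbitrary: e rule: sigma_sets.induct)
    case (Basic A)
    then have A: "closed A" by simp
    \<comment> \<open>Since \<open>infdist x {} = 0\<close>, the neighbourhoods used below would not
      shrink to the empty set.\<close>
    show ?case
    proof (cases "A = {}")
      case True
      then show ?thesis using Basic by (auto intro!: exI[of _ "{}"])
    next
      case False
      define G where "G n = {x. infdist x A < 1 / real (Suc n)}" for n
      have G: "open (G n)" for n
        unfolding G_def by (intro open_Collect_less continuous_intros)
      have AG: "A \<subseteq> G n" for n by (auto simp: G_def)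
      have "(\<Inter>n. G n - A) = {}"
      proof (rule ccontr)
        assume "\<not> ?thesis"
        then obtain x where x: "\<And>n. x \<in> G n" "x \<notin> A" by auto
        then have "infdist x A > 0"
          using A False by (metis in_closed_iff_infdist_zero infdist_nonneg less_eq_real_def)
        then obtain n where "1 / real (Suc n) < infdist x A" using nat_approx_posE by blast
        then show False using x(1)[of n] by (simp add: G_def)
      qed
      moreover have "decseq (\<lambda>n. G n - A)"
        by (auto simp: decseq_def G_def intro!: frac_le elim!: less_le_trans)
      moreover have "range (\<lambda>n. G n - A) \<subseteq> sets N"
        using A G by auto
      ultimately have "(\<lambda>n. emeasure N (G n - A)) \<longlonglongrightarrow> emeasure N {}"
        using Lim_emeasure_decseq[of "\<lambda>n. G n - A" N] fin by metis
      then have "\<forall>\<^sub>F n in sequentially. emeasure N (G n - A) < ennreal e"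
        using Basic by (intro order_tendstoD) auto
      then obtain n where "emeasure N (G n - A) < ennreal e"
        by (auto simp: eventually_sequentially)
      then show ?thesis using A G AG by blast
    qed
  next
    case Empty
    then show ?case by (auto intro!: exI[of _ "{}"])
  next
    case (Compl A)
    obtain F G where "closed F" "open G" "F \<subseteq> A" "A \<subseteq> G" "emeasure N (G - F) < ennreal e"
      using Compl.IH[OF Compl.prems] by blast
    moreover have "- F - (- G) = G - F" by auto
    ultimately have "closed (- G) \<and> open (- F) \<and> - G \<subseteq> UNIV - A \<and> UNIV - A \<subseteq> - F \<and> emeasure N (- F - (- G)) < ennreal e"
      by auto
    then show ?case by blast
  next
    case (Union A)
    have "\<exists>F G. closed F \<and> open G \<and> F \<subseteq> A i \<and> A i \<subseteq> G \<and> emeasure N (G - F) < ennreal (e / 2 * (1/2)^Suc i)" for i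
      using Union(2)[of "e / 2 * (1/2)^Suc i" i] Union.prems by auto
    then obtain F G where FG: "\<And>i. closed (F i)" "\<And>i. open (G i)" "\<And>i. F i \<subseteq> A i" "\<And>i. A i \<subseteq> G i"
      "\<And>i. emeasure N (G i - F i) < ennreal (e / 2 * (1/2)^Suc i)"
      by metis
    have GF: "G i - F i \<in> sets N" for i using FG by auto
    then have "(\<Union>i. G i - F i) \<in> sets N" by blast
    then have "emeasure N ((\<Union>i. G i) - (\<Union>i. F i)) \<le> emeasure N (\<Union>i. G i - F i)"
      using FG by (intro emeasure_mono) auto
    also have "\<dots> \<le> (\<Sum>i. emeasure N (G i - F i))"
      using GF by (intro emeasure_subadditive_countably) auto
    also have "\<dots> \<le> (\<Sum>i. ennreal (e / 2 * (1/2)^Suc i))"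
      using FG(5) by (intro suminf_le) (auto intro: less_imp_le)
    also have "\<dots> = ennreal (e / 2)"
      using Union.prems by (intro suminf_half_powers) simp
    also have "\<dots> < ennreal e" using Union.prems by (simp add: ennreal_less_iff)
    finally have "emeasure N ((\<Union>i. G i) - (\<Union>i. F i)) < ennreal e" .
    \<comment> \<open>An infinite union of closed sets need not be closed. Continuity from above,
      with finite measure, allows stopping at a finite union while keeping the strict bound.\<close>
    moreover have "(\<lambda>n. emeasure N ((\<Union>i. G i) - (\<Union>i\<le>n. F i))) \<longlonglongrightarrow> emeasure N (\<Inter>n. (\<Union>i. G i) - (\<Union>i\<le>n. F i))"
      using FG fin by (intro Lim_emeasure_decseq) (auto simp: decseq_def intro!: closed_UN sets.Diff open_UN)
    moreover have "(\<Inter>n. (\<Union>i. G i) - (\<Union>i\<le>n. F i)) = (\<Union>i. G i) - (\<Union>i. F i)"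
      by auto
    ultimately have "\<forall>\<^sub>F n in sequentially. emeasure N ((\<Union>i. G i) - (\<Union>i\<le>n. F i)) < ennreal e"
      by (intro order_tendstoD) auto
    then obtain n where "emeasure N ((\<Union>i. G i) - (\<Union>i\<le>n. F i)) < ennreal e"
      by (auto simp: eventually_sequentially)
    moreover have "closed (\<Union>i\<le>n. F i)" "open (\<Union>i. G i)"
      using FG(1,2) by (auto intro!: closed_UN)
    moreover have "(\<Union>i\<le>n. F i) \<subseteq> (\<Union>i. A i)" "(\<Union>i. A i) \<subseteq> (\<Union>i. G i)"
      using FG(3,4) by blast+
    ultimately show ?case by blast
  qed
qed

section \<open>Approximation by open and closed sets for the completed measure\<close>

locale newtonian_space =
  fixes p :: real and M :: "'a::complete_space measure"
  assumes standing: "standing_assumptions p M"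
begin

lemma p_pos: "0 < p"
  using standing by (auto simp: standing_assumptions_def)

lemma borel_completion: "\<exists>\<nu>. sets \<nu> = sets borel \<and> M = completion \<nu>"
  using standing by (auto simp: standing_assumptions_def)

lemma space_M [simp]: "space M = UNIV"
proof -
  obtain \<nu> where "sets \<nu> = sets borel" "M = completion \<nu>" using borel_completion by blast
  then show ?thesis using sets_eq_imp_space_eq[of \<nu> borel] by simp
qed

lemma borel_sets_M [simp]: "A \<in> sets borel \<Longrightarrow> A \<in> sets M"
  using borel_completion by auto

lemma open_sets_M [simp, measurable]: "open A \<Longrightarrow> A \<in> sets M"
  and closed_sets_M [simp, measurable]: "closed A \<Longrightarrow> A \<in> sets M"
  by auto

lemma borel_measurable_M [measurable_dest]: "f \<in> borel_measurable borel \<Longrightarrow> f \<in> borel_measurable M"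
  using borel_completion by (auto simp: measurable_def sets_eq_imp_space_eq)

lemma emeasure_ball_pos: "0 < r \<Longrightarrow> 0 < emeasure M (ball x r)"
  and emeasure_ball_finite: "emeasure M (ball x r) < \<infinity>"
  using standing by (auto simp: standing_assumptions_def) (cases "0 < r"; simp add: ball_empty)

lemma null_subset: "A \<in> null_sets M \<Longrightarrow> B \<subseteq> A \<Longrightarrow> B \<in> null_sets M"
  using borel_completion null_sets_completion_subset by blast

lemma sets_M_sandwich:
  assumes "A \<in> sets M"
  obtains B where "B \<in> sets borel" "A \<subseteq> B" "B - A \<in> null_sets M"
proof -
  obtain \<nu> where \<nu>: "sets \<nu> = sets borel" "M = completion \<nu>" using borel_completion by blast
  obtain S N N' where "A = S \<union> N" "N \<subseteq> N'" "N' \<in> null_sets \<nu>" "S \<in> sets \<nu>"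
    using assms unfolding \<nu>(2) by (rule sets_completionE)
  then show thesis
    using \<nu> null_subset[of N' "S \<union> N' - A"] null_sets_completionI[of N' \<nu>]
    by (intro that[of "S \<union> N'"]) auto
qed

text \<open>The weighted measure is finite on balls only, so the finite case is applied on balls
  around a base point, the n-th one with a geometric share of e. The density is kept general because
  it serves twice: with \<open>h = 1\<close>, and with a density built from the p-th power of a
  gradient.\<close>

lemma outer_regular_density:
  assumes h [measurable]: "h \<in> borel_measurable M"
    and fin: "\<And>x r. (\<integral>\<^sup>+ y\<in>ball x r. h y \<partial>M) < \<infinity>"
    and A: "A \<in> sets M" and e: "0 < (e::real)"
  shows "\<exists>G. open G \<and> A \<subseteq> G \<and> (\<integral>\<^sup>+ x\<in>G - A. h x \<partial>M) < ennreal e"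
proof -
  obtain B where B: "B \<in> sets borel" "A \<subseteq> B" "B - A \<in> null_sets M"
    using sets_M_sandwich[OF A] .
  obtain x0 :: 'a where True by simp
  let ?B = "\<lambda>n::nat. ball x0 (real n)"
  \<comment> \<open>The image under the identity forgets the null sets that completion added, as the
    regularity lemma demands the Borel sigma-algebra.\<close>
  define N where "N n = distr (density M (\<lambda>x. h x * indicator (?B n) x)) borel (\<lambda>x. x)" for n
  have id: "(\<lambda>x. x) \<in> density M f \<rightarrow>\<^sub>M borel" for f
    by (auto simp: measurable_def)
  have N: "emeasure (N n) S = (\<integral>\<^sup>+ x\<in>S \<inter> ?B n. h x \<partial>M)" if "S \<in> sets borel" for S n
  proof -
    have "emeasure (N n) S = (\<integral>\<^sup>+ x. (h x * indicator (?B n) x) * indicator S x \<partial>M)"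
      unfolding N_def using that by (subst emeasure_distr[OF id]) (simp_all add: emeasure_density)
    also have "\<dots> = (\<integral>\<^sup>+ x\<in>S \<inter> ?B n. h x \<partial>M)"
      by (intro nn_integral_cong) (auto simp: indicator_def)
    finally show ?thesis .
  qed
  have "\<exists>F G. closed F \<and> open G \<and> F \<subseteq> B \<and> B \<subseteq> G \<and> emeasure (N n) (G - F) < ennreal (e / 2 * (1/2)^Suc n)" for n
    using N[of UNIV n] fin[of x0 n] B e by (intro borel_regular_finite) (auto simp: N_def)
  then obtain F G where FG: "\<And>n. closed (F n)" "\<And>n. open (G n)" "\<And>n. F n \<subseteq> B" "\<And>n. B \<subseteq> G n"
    "\<And>n. emeasure (N n) (G n - F n) < ennreal (e / 2 * (1/2)^Suc n)"
    by metis
  \<comment> \<open>Each \<open>G n\<close> is controlled only inside the n-th ball, so it is used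
    only there; since it contains A, the union still does.\<close>
  define G' where "G' = (\<Union>n. G n \<inter> ?B n)"
  have "x \<in> G'" if "x \<in> A" for x
    using reals_Archimedean2[of "dist x0 x"] FG(4) B(2) that by (auto simp: G'_def)
  moreover have "open G'" using FG by (auto simp: G'_def)
  moreover have "(\<integral>\<^sup>+ x\<in>G' - A. h x \<partial>M) < ennreal e"
  proof -
    have nn: "AE x in M. x \<notin> B - A" using B(3) by (rule AE_not_in)
    have "(\<integral>\<^sup>+ x\<in>G' - A. h x \<partial>M) \<le> (\<integral>\<^sup>+ x. (\<Sum>n. h x * indicator ((G n - F n) \<inter> ?B n) x) \<partial>M)"
    proof (rule nn_integral_mono_AE, use nn in eventually_elim)
      fix x assume x: "x \<notin> B - A"
      show "h x * indicator (G' - A) x \<le> (\<Sum>n. h x * indicator ((G n - F n) \<inter> ?B n) x)"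
      proof (cases "x \<in> G' - A")
        case True
        then obtain n where "x \<in> (G n - F n) \<inter> ?B n"
          using x FG(3) by (auto simp: G'_def)
        then have "h x * indicator (G' - A) x = (\<Sum>m\<in>{n}. h x * indicator ((G m - F m) \<inter> ?B m) x)"
          using True by simp
        also have "\<dots> \<le> (\<Sum>n. h x * indicator ((G n - F n) \<inter> ?B n) x)"
          by (rule sum_le_suminf) auto
        finally show ?thesis .
      qed simp
    qed
    also have "\<dots> = (\<Sum>n. \<integral>\<^sup>+ x\<in>(G n - F n) \<inter> ?B n. h x \<partial>M)"
      using FG by (intro nn_integral_suminf) auto
    also have "\<dots> = (\<Sum>n. emeasure (N n) (G n - F n))"
      using FG by (subst N) auto
    also have "\<dots> \<le> (\<Sum>i. ennreal (e / 2 * (1/2)^Suc i))"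
      using FG(5) by (intro suminf_le) (auto intro: less_imp_le)
    also have "\<dots> = ennreal (e / 2)"
      using e by (intro suminf_half_powers) simp
    also have "\<dots> < ennreal e" using e by (simp add: ennreal_less_iff)
    finally show ?thesis .
  qed
  ultimately show ?thesis by blast
qed

text \<open>For every rational q the sets where f exceeds q and where it does not are enlarged to
  open sets, and all overlaps of such pairs are discarded. On the remaining closed set each pair is
  complementary, so both sets are relatively open there and f is continuous.\<close>

lemma lusin_density:
  fixes f :: "'a \<Rightarrow> real"
  assumes h [measurable]: "h \<in> borel_measurable M"
    and fin: "\<And>x r. (\<integral>\<^sup>+ y\<in>ball x r. h y \<partial>M) < \<infinity>"
    and f [measurable]: "f \<in> borel_measurable M" and e: "0 < (e::real)"
  obtains K where "closed K" "continuous_on K f" "(\<integral>\<^sup>+ x\<in>- K. h x \<partial>M) < ennreal e"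
proof -
  define A where "A n = {x. of_rat (from_nat n) < f x}" for n
  have A [measurable]: "A n \<in> sets M" for n
  proof -
    have "{x\<in>space M. of_rat (from_nat n) < f x} \<in> sets M" by measurable
    then show ?thesis by (simp add: A_def)
  qed
  have cA: "- A n \<in> sets M" for n
    using A[of n] by (metis Compl_eq_Diff_UNIV sets.compl_sets space_M)
  \<comment> \<open>Two enlargements for each n, and a total of \<open>e / 2\<close> so that the
    final inequality is strict.\<close>
  define c where "c n = e / 4 * (1/2)^Suc n" for n
  have c: "0 < c n" for n using e by (simp add: c_def)
  have "\<exists>G. open G \<and> A n \<subseteq> G \<and> (\<integral>\<^sup>+ x\<in>G - A n. h x \<partial>M) < ennreal (c n)" for n
    by (rule outer_regular_density[OF h fin A c])
  then obtain G where G: "\<And>n. open (G n)" "\<And>n. A n \<subseteq> G n" "\<And>n. (\<integral>\<^sup>+ x\<in>G n - A n. h x \<partial>M) < ennreal (c n)"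
    by metis
  have "\<exists>G. open G \<and> - A n \<subseteq> G \<and> (\<integral>\<^sup>+ x\<in>G - (- A n). h x \<partial>M) < ennreal (c n)" for n
    by (rule outer_regular_density[OF h fin cA c])
  then obtain H where H: "\<And>n. open (H n)" "\<And>n. - A n \<subseteq> H n" "\<And>n. (\<integral>\<^sup>+ x\<in>H n - (- A n). h x \<partial>M) < ennreal (c n)"
    by metis
  define K where "K = - (\<Union>n. G n \<inter> H n)"
  have "closed K" unfolding K_def closed_def using G(1) H(1) by auto
  moreover have "continuous_on K f"
    unfolding continuous_on_eq_continuous_within continuous_within tendsto_iff
  proof (intro ballI allI impI)
    fix x and d :: real assume x: "x \<in> K" and d: "0 < d"
    obtain q where q: "f x - d < of_rat q" "of_rat q < f x"
      using of_rat_dense[of "f x - d" "f x"] d by auto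
    obtain q' where q': "f x < of_rat q'" "of_rat q' < f x + d"
      using of_rat_dense[of "f x" "f x + d"] d by auto
    let ?n = "to_nat q" and ?m = "to_nat q'"
    have "x \<in> G ?n" using q G(2)[of ?n] by (auto simp: A_def)
    moreover have "x \<in> H ?m" using q' H(2)[of ?m] by (auto simp: A_def)
    ultimately have "\<forall>\<^sub>F y in at x within K. y \<in> G ?n \<inter> H ?m"
      using G(1)[of ?n] H(1)[of ?m] unfolding eventually_at_topological by blast
    moreover have "\<forall>\<^sub>F y in at x within K. y \<in> K"
      by (simp add: eventually_at_filter)
    ultimately show "\<forall>\<^sub>F y in at x within K. dist (f y) (f x) < d"
    proof eventually_elim
      case (elim y)
      then have "y \<notin> H ?n" "y \<notin> G ?m" by (auto simp: K_def)
      then have "y \<in> A ?n" "y \<notin> A ?m" using H(2)[of ?n] G(2)[of ?m] by auto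
      then show ?case using q q' by (auto simp: A_def dist_real_def)
    qed
  qed
  moreover have "(\<integral>\<^sup>+ x\<in>- K. h x \<partial>M) < ennreal e"
  proof -
    have GM [measurable]: "G n \<in> sets M" "H n \<in> sets M" for n using G(1) H(1) by auto
    have "(\<integral>\<^sup>+ x\<in>- K. h x \<partial>M) \<le> (\<integral>\<^sup>+ x. (\<Sum>n. h x * indicator (G n - A n) x + h x * indicator (H n - (- A n)) x) \<partial>M)"
    proof (rule nn_integral_mono)
      fix x
      show "h x * indicator (- K) x \<le> (\<Sum>n. h x * indicator (G n - A n) x + h x * indicator (H n - (- A n)) x)"
      proof (cases "x \<in> K")
        case False
        then obtain n where "x \<in> G n" "x \<in> H n" by (auto simp: K_def)
        then have "h x * indicator (- K) x \<le> (\<Sum>m\<in>{n}. h x * indicator (G m - A m) x + h x * indicator (H m - (- A m)) x)"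
          using False by (auto simp: indicator_def)
        also have "\<dots> \<le> (\<Sum>n. h x * indicator (G n - A n) x + h x * indicator (H n - (- A n)) x)"
          by (rule sum_le_suminf) auto
        finally show ?thesis .
      qed simp
    qed
    also have "\<dots> = (\<Sum>n. (\<integral>\<^sup>+ x\<in>G n - A n. h x \<partial>M) + (\<integral>\<^sup>+ x\<in>H n - (- A n). h x \<partial>M))"
      by (subst nn_integral_suminf) (auto intro!: suminf_cong nn_integral_add borel_measurable_times_ennreal borel_measurable_indicator sets.Diff cA simp del: Diff_Compl)
    also have "\<dots> \<le> (\<Sum>n. ennreal (e / 2 * (1/2)^Suc n))"
    proof (intro suminf_le)
      fix n
      have "(\<integral>\<^sup>+ x\<in>G n - A n. h x \<partial>M) + (\<integral>\<^sup>+ x\<in>H n - (- A n). h x \<partial>M) \<le> ennreal (c n) + ennreal (c n)"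
        using G(3) H(3) by (intro add_mono) (auto intro: less_imp_le)
      also have "\<dots> = ennreal (e / 2 * (1/2)^Suc n)"
        using c[of n] by (subst ennreal_plus[symmetric]) (auto simp: c_def)
      finally show "(\<integral>\<^sup>+ x\<in>G n - A n. h x \<partial>M) + (\<integral>\<^sup>+ x\<in>H n - (- A n). h x \<partial>M) \<le> ennreal (e / 2 * (1/2)^Suc n)" .
    qed auto
    also have "\<dots> = ennreal (e / 2)"
      using e by (intro suminf_half_powers) simp
    also have "\<dots> < ennreal e" using e by (simp add: ennreal_less_iff)
    finally show ?thesis .
  qed
  ultimately show thesis by (rule that)
qed

text \<open>A dyadic version of the Vitali-Caratheodory theorem. On the layer between
  \<open>2^n\<close> and \<open>2^Suc n\<close> the function g is replaced by the upper value, and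
  the layer by an open hull; a supremum of multiples of indicators of open sets is lower
  semicontinuous. Values up to 1 lie in no layer and are covered by the added constant, which is
  kept outside r because constants need not be p-integrable. Rounding up costs the factor
  \<open>2 powr p\<close>, the hulls cost 1.\<close>

lemma lower_semicontinuous_majorant:
  fixes g :: "'a \<Rightarrow> ennreal"
  assumes g [measurable]: "g \<in> borel_measurable M" and int: "(\<integral>\<^sup>+ x. epow (g x) p \<partial>M) < \<infinity>"
  obtains r where "\<And>a. open {x. a < r x}" "(\<integral>\<^sup>+ x. epow (r x) p \<partial>M) < \<infinity>" "\<And>x. g x \<le> 1 + r x"
proof -
  have two_power: "(2::ennreal)^n = ennreal (2^n)" for n
    by (metis ennreal_numeral ennreal_power zero_le_numeral)
  define A where "A n = {x. (2^n < g x \<and> g x \<le> 2^Suc n) \<or> g x = \<infinity>}" for n :: nat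
  have A [measurable]: "A n \<in> sets M" for n
  proof -
    have "{x\<in>space M. (2^n < g x \<and> g x \<le> 2^Suc n) \<or> g x = \<infinity>} \<in> sets M" by measurable
    then show ?thesis by (simp add: A_def)
  qed
  define a where "a n = (2^Suc n) powr p" for n :: nat
  have a: "0 < a n" for n by (simp add: a_def)
  \<comment> \<open>Dividing by \<open>a n\<close>, the p-th power of the value on the hull, makes
    the excess of the n-th hull contribute at most \<open>(1/2)^Suc n\<close> to the
    integral.\<close>
  have "\<exists>G. open G \<and> A n \<subseteq> G \<and> (\<integral>\<^sup>+ x\<in>G - A n. 1 \<partial>M) < ennreal ((1/2)^Suc n / a n)" for n
    by (rule outer_regular_density) (use a emeasure_ball_finite in auto)
  then obtain G where G: "\<And>n. open (G n)" "\<And>n. A n \<subseteq> G n" "\<And>n. (\<integral>\<^sup>+ x\<in>G n - A n. 1 \<partial>M) < ennreal ((1/2)^Suc n / a n)"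
    by metis
  have [measurable]: "G n \<in> sets M" for n using G by auto
  have emG: "emeasure M (G n) \<le> emeasure M (A n) + ennreal ((1/2)^Suc n / a n)" for n
  proof -
    have "emeasure M (G n) = emeasure M (A n) + emeasure M (G n - A n)"
      using G(2) by (subst plus_emeasure) (auto intro!: arg_cong[where f="emeasure M"])
    moreover have "emeasure M (G n - A n) \<le> ennreal ((1/2)^Suc n / a n)"
      using G(3)[of n] by (auto intro: less_imp_le)
    ultimately show ?thesis by (simp add: add_left_mono)
  qed
  define r where "r x = (SUP n. 2^Suc n * indicator (G n) x :: ennreal)" for x
  have "open {x. b < r x}" for b
  proof -
    have "{x. b < r x} = (\<Union>n. {x. b < 2^Suc n * indicator (G n) x})"
      by (auto simp: r_def less_SUP_iff)
    moreover have "{x. b < 2^Suc n * indicator (G n) x} = (if b < 2^Suc n then G n else {})" for n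
      by (auto simp: indicator_def)
    ultimately show ?thesis using G(1) by auto
  qed
  moreover have "g x \<le> 1 + r x" for x
  proof -
    consider "g x \<le> 1" | "g x = \<infinity>" | "1 < g x" "g x \<noteq> \<infinity>" by force
    then show ?thesis
    proof cases
      case 1
      then show ?thesis by (meson add_increasing2 order_refl zero_le)
    next
      case 2
      have ge: "ennreal (real n) \<le> r x" for n
      proof -
        have "x \<in> G n" using 2 G(2)[of n] by (auto simp: A_def)
        have "real n \<le> 2 ^ Suc n"
          using of_nat_less_two_power[of "Suc n", where 'a=real] by simp
        then have "ennreal (real n) \<le> ennreal (2^Suc n)" by (intro ennreal_leI)
        also have "\<dots> = 2^Suc n * indicator (G n) x"
          using \<open>x \<in> G n\<close> by (simp add: two_power del: power_Suc)
        also have "\<dots> \<le> r x" unfolding r_def by (intro SUP_upper) auto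
        finally show ?thesis .
      qed
      have "r x = \<infinity>"
      proof (rule ccontr)
        assume "r x \<noteq> \<infinity>"
        then obtain b where "r x = ennreal b" "0 \<le> b" by (cases "r x") auto
        moreover obtain n where "b < real n" using reals_Archimedean2 by blast
        ultimately show False using ge[of n] by simp
      qed
      then show ?thesis by simp
    next
      case 3
      then obtain b where b: "g x = ennreal b" "1 < b" by (cases "g x") (auto simp: ennreal_1[symmetric] ennreal_less_iff simp del: ennreal_1)
      define n where "n = (LEAST n. b \<le> 2^Suc n)"
      have ex: "\<exists>n. b \<le> 2^Suc n"
        using real_arch_pow[of 2 b] by (meson less_imp_le less_trans lessI one_less_numeral_iff power_strict_increasing semiring_norm(76))
      then have n: "b \<le> 2^Suc n" unfolding n_def by (rule LeastI_ex)
      have "2^n < b"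
      proof (cases n)
        case (Suc m)
        then show ?thesis using not_less_Least[of m "\<lambda>n. b \<le> 2^Suc n"] n_def by auto
      qed (use b in simp)
      with n b have "x \<in> A n"
        by (auto simp: A_def ennreal_less_iff two_power intro!: ennreal_leI simp del: power_Suc)
      then have "x \<in> G n" using G(2) by auto
      then have "g x \<le> 2^Suc n * indicator (G n) x"
        using n b by (simp add: two_power ennreal_leI del: power_Suc)
      also have "\<dots> \<le> r x" unfolding r_def by (intro SUP_upper) auto
      finally show ?thesis by (simp add: add_increasing)
    qed
  qed
  moreover have "(\<integral>\<^sup>+ x. epow (r x) p \<partial>M) < \<infinity>"
  proof -
    have ep: "epow (2^Suc n) p = ennreal (a n)" for n
      by (simp add: a_def two_power epow_ennreal del: power_Suc)
    have "(\<integral>\<^sup>+ x. epow (r x) p \<partial>M) \<le> (\<integral>\<^sup>+ x. (\<Sum>n. ennreal (a n) * indicator (G n) x) \<partial>M)"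
    proof (rule nn_integral_mono)
      fix x
      have "epow (r x) p \<le> (\<Sum>n. epow (2^Suc n * indicator (G n) x) p)"
        unfolding r_def by (rule epow_SUP_le[OF p_pos])
      then show "epow (r x) p \<le> (\<Sum>n. ennreal (a n) * indicator (G n) x)"
        by (simp only: epow_indicator[OF p_pos] ep)
    qed
    also have "\<dots> = (\<Sum>n. ennreal (a n) * emeasure M (G n))"
      by (subst nn_integral_suminf) (auto simp: nn_integral_cmult)
    also have "\<dots> \<le> (\<Sum>n. ennreal (a n) * emeasure M (A n) + ennreal ((1/2)^Suc n))"
    proof (intro suminf_le)
      fix n
      have "ennreal (a n) * emeasure M (G n) \<le> ennreal (a n) * (emeasure M (A n) + ennreal ((1/2)^Suc n / a n))"
        using emG by (intro mult_left_mono) auto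
      also have "\<dots> = ennreal (a n) * emeasure M (A n) + ennreal ((1/2)^Suc n)"
        using a[of n] by (simp add: distrib_left ennreal_mult[symmetric])
      finally show "ennreal (a n) * emeasure M (G n) \<le> \<dots>" .
    qed auto
    also have "\<dots> = (\<Sum>n. ennreal (a n) * emeasure M (A n)) + (\<Sum>n. ennreal ((1/2)^Suc n))"
      by (rule suminf_add[symmetric]) auto
    also have "(\<Sum>n. ennreal ((1/2)^Suc n)) = 1"
      using suminf_half_powers[of 1, simplified mult_1] by (simp only: zero_le_one simp_thms ennreal_1)
    also have "(\<Sum>n. ennreal (a n) * emeasure M (A n)) = (\<integral>\<^sup>+ x. (\<Sum>n. ennreal (a n) * indicator (A n) x) \<partial>M)"
      by (subst nn_integral_suminf) (auto simp: nn_integral_cmult)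
    also have "\<dots> \<le> (\<integral>\<^sup>+ x. ennreal (2 powr p) * epow (g x) p \<partial>M)"
    proof (rule nn_integral_mono)
      fix x
      \<comment> \<open>The layers are disjoint except where \<open>g x\<close> is infinite, and
        there the right side is infinite. Otherwise the sum has at most one term.\<close>
      show "(\<Sum>n. ennreal (a n) * indicator (A n) x) \<le> ennreal (2 powr p) * epow (g x) p"
      proof (cases "g x = \<infinity> \<or> (\<forall>n. x \<notin> A n)")
        case True
        then show ?thesis by (auto simp: ennreal_mult_top)
      next
        case False
        then obtain n where n: "x \<in> A n" "g x \<noteq> \<infinity>" by auto
        have uniq: "x \<notin> A m" if "m \<noteq> n" for m
        proof
          assume m: "x \<in> A m"
          have "\<not> i < j" if "x \<in> A i" "x \<in> A j" for i j
          proof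
            assume "i < j"
            then have "(2::ennreal)^Suc i \<le> 2^j" by (intro power_increasing) auto
            then show False using that n by (auto simp: A_def)
          qed
          then show False using m n that by (metis linorder_neqE_nat)
        qed
        have "(\<Sum>n. ennreal (a n) * indicator (A n) x) = (\<Sum>m\<in>{n}. ennreal (a m) * indicator (A m) x)"
          using uniq by (intro suminf_finite) auto
        also have "\<dots> = epow (2 * 2^n) p" using n ep[of n] by simp
        also have "\<dots> \<le> epow (ennreal 2 * g x) p"
          using n by (intro epow_mono p_pos mult_mono) (auto simp: A_def)
        also have "\<dots> = ennreal (2 powr p) * epow (g x) p"
          by (subst epow_mult[OF p_pos]) (subst epow_ennreal, simp_all)
        finally show ?thesis .
      qed
    qed
    also have "\<dots> = ennreal (2 powr p) * (\<integral>\<^sup>+ x. epow (g x) p \<partial>M)"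
      by (rule nn_integral_cmult) measurable
    finally have "(\<integral>\<^sup>+ x. epow (r x) p \<partial>M) \<le> ennreal (2 powr p) * (\<integral>\<^sup>+ x. epow (g x) p \<partial>M) + 1"
      by (simp add: add_right_mono)
    also have "\<dots> < \<infinity>" using int by (auto simp: ennreal_mult_less_top)
    finally show ?thesis .
  qed
  ultimately show thesis by (intro that)
qed

end

subsection \<open>Compactness of families of Lipschitz curves\<close>

context newtonian_space begin

lemma doubling_iterate:
  obtains C where "0 \<le> C" "\<And>x r m. 0 < r \<Longrightarrow> emeasure M (ball x (2^m * r)) \<le> ennreal (C^m) * emeasure M (ball x r)"
proof -
  obtain C where C: "\<And>x r. 0 < r \<Longrightarrow> emeasure M (ball x (2 * r)) \<le> ennreal C * emeasure M (ball x r)"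
    using standing by (auto simp: standing_assumptions_def doubling_def)
  have *: "emeasure M (ball x (2^m * r)) \<le> ennreal (max C 0 ^ m) * emeasure M (ball x r)" if "0 < r" for x r m
  proof (induction m)
    case (Suc m)
    have "emeasure M (ball x (2^Suc m * r)) \<le> ennreal (max C 0) * emeasure M (ball x (2^m * r))"
      using C[of "2^m * r" x] that by (auto simp: max_def ennreal_neg mult.assoc)
    also have "\<dots> \<le> ennreal (max C 0) * (ennreal (max C 0 ^ m) * emeasure M (ball x r))"
      using Suc by (intro mult_left_mono) auto
    also have "\<dots> = ennreal (max C 0 ^ Suc m) * emeasure M (ball x r)"
      by (simp add: ennreal_mult mult.assoc)
    finally show ?case .
  qed simp
  show thesis by (rule that[of "max C 0"]) (use * in auto)
qed

text \<open>The balls of radius \<open>e / 2\<close> around the points are disjoint and lie in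
  \<open>ball x (R + e)\<close>, while doubling gives each of them a fixed fraction of the measure
  of that ball.\<close>

lemma separated_card_bound:
  fixes x :: 'a
  assumes "0 < e" "0 < R"
  shows "\<exists>N. \<forall>S. finite S \<and> S \<subseteq> cball x R \<and> (\<forall>y\<in>S. \<forall>z\<in>S. y \<noteq> z \<longrightarrow> e \<le> dist y z) \<longrightarrow> card S \<le> N"
proof -
  obtain C where C: "0 \<le> C" "\<And>x r m. 0 < r \<Longrightarrow> emeasure M (ball x (2^m * r)) \<le> ennreal (C^m) * emeasure M (ball x r)"
    using doubling_iterate by blast
  \<comment> \<open>After m doublings, the ball of radius \<open>e / 2\<close> around any point of
    \<open>cball x R\<close> contains all of \<open>ball x (R + e)\<close>.\<close>
  obtain m where "(2 * R + e) / (e / 2) < 2^m"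
    using real_arch_pow[of 2 "(2 * R + e) / (e / 2)"] by auto
  then have m: "2 * R + e < 2^m * (e / 2)"
    using assms by (simp add: field_simps)
  obtain b where b: "emeasure M (ball x (R + e)) = ennreal b" "0 < b"
    using emeasure_ball_finite[of x "R + e"] emeasure_ball_pos[of "R + e" x] assms
    by (cases "emeasure M (ball x (R + e))") auto
  show ?thesis
  proof (intro exI[of _ "nat \<lceil>C^m\<rceil>"] allI impI)
    fix S assume S': "finite S \<and> S \<subseteq> cball x R \<and> (\<forall>y\<in>S. \<forall>z\<in>S. y \<noteq> z \<longrightarrow> e \<le> dist y z)"
    then have S: "finite S" "S \<subseteq> cball x R" "\<And>y z. y \<in> S \<Longrightarrow> z \<in> S \<Longrightarrow> y \<noteq> z \<Longrightarrow> e \<le> dist y z"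
      by blast+
    have disj: "disjoint_family_on (\<lambda>y. ball y (e / 2)) S"
    proof (clarsimp simp: disjoint_family_on_def disjoint_iff)
      fix y z w assume "y \<in> S" "z \<in> S" "y \<noteq> z" "dist y w * 2 < e" "dist z w * 2 < e"
      then show False
        using S(3)[of y z] dist_triangle[of y z w] by (simp add: dist_commute)
    qed
    have "ennreal (real (card S) * b) = (\<Sum>y\<in>S. emeasure M (ball x (R + e)))"
      using b by (simp add: ennreal_of_nat_eq_real_of_nat ennreal_mult)
    also have "\<dots> \<le> (\<Sum>y\<in>S. ennreal (C^m) * emeasure M (ball y (e / 2)))"
    proof (rule sum_mono)
      fix y assume "y \<in> S"
      then have y: "dist x y \<le> R" using S by auto
      have "ball x (R + e) \<subseteq> ball y (2^m * (e / 2))"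
      proof
        fix z assume "z \<in> ball x (R + e)"
        then show "z \<in> ball y (2^m * (e / 2))"
          using m y dist_triangle[of y z x] by (simp add: dist_commute)
      qed
      then have "emeasure M (ball x (R + e)) \<le> emeasure M (ball y (2^m * (e / 2)))"
        by (intro emeasure_mono) auto
      also have "\<dots> \<le> ennreal (C^m) * emeasure M (ball y (e / 2))"
        using assms by (intro C) simp
      finally show "emeasure M (ball x (R + e)) \<le> ennreal (C^m) * emeasure M (ball y (e / 2))" .
    qed
    also have "\<dots> = ennreal (C^m) * emeasure M (\<Union>y\<in>S. ball y (e / 2))"
      using S(1) disj by (subst sum_emeasure[symmetric]) (auto simp: sum_distrib_left)
    also have "\<dots> \<le> ennreal (C^m) * emeasure M (ball x (R + e))"
    proof (intro mult_left_mono emeasure_mono)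
      show "(\<Union>y\<in>S. ball y (e / 2)) \<subseteq> ball x (R + e)"
      proof clarify
        fix y z assume "y \<in> S" "z \<in> ball y (e / 2)"
        then show "z \<in> ball x (R + e)"
          using S(2) dist_triangle[of x z y] assms by (auto simp: subset_iff)
      qed
    qed auto
    also have "\<dots> = ennreal (C^m * b)" using b C by (simp add: ennreal_mult)
    finally have "real (card S) * b \<le> C^m * b"
      using b C(1) by (subst (asm) ennreal_le_iff) auto
    then show "card S \<le> nat \<lceil>C^m\<rceil>" using b by (simp add: real_nat_ceiling_ge le_nat_iff) linarith
  qed
qed

text \<open>An e-separated set with the largest possible number of points is an e-net: a point far
  from all of them could be added. So closed balls are totally bounded, and completeness does the
  rest.\<close>

lemma compact_cball: "compact (cball (x::'a) R)"
proof (cases "0 < R")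
  case False
  then have "cball x R \<subseteq> {x}" using zero_le_dist[of x] by (auto simp: not_less) (metis dist_le_zero_iff order_trans)
  then show ?thesis by (metis finite.simps finite_imp_compact rev_finite_subset)
next
  case True
  show ?thesis
    unfolding compact_eq_totally_bounded
  proof (intro conjI allI impI)
    show "complete (cball x R)" by (simp add: complete_eq_closed)
    fix e :: real assume "0 < e"
    define P where "P n \<longleftrightarrow> (\<exists>S. finite S \<and> S \<subseteq> cball x R \<and> (\<forall>y\<in>S. \<forall>z\<in>S. y \<noteq> z \<longrightarrow> e \<le> dist y z) \<and> card S = n)" for n
    obtain N where card: "\<forall>S. finite S \<and> S \<subseteq> cball x R \<and> (\<forall>y\<in>S. \<forall>z\<in>S. y \<noteq> z \<longrightarrow> e \<le> dist y z) \<longrightarrow> card S \<le> N"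
      using separated_card_bound[OF \<open>0 < e\<close> True, of x] by (elim exE)
    have N: "\<forall>n. P n \<longrightarrow> n \<le> N"
    proof (intro allI impI)
      fix n assume "P n"
      then obtain S where "finite S \<and> S \<subseteq> cball x R \<and> (\<forall>y\<in>S. \<forall>z\<in>S. y \<noteq> z \<longrightarrow> e \<le> dist y z)" "card S = n"
        unfolding P_def by (elim exE conjE) simp
      then show "n \<le> N" using card by auto
    qed
    have P0: "P 0" unfolding P_def by (rule exI[of _ "{}"]) auto
    obtain S where S: "finite S" "S \<subseteq> cball x R" "\<And>y z. y \<in> S \<Longrightarrow> z \<in> S \<Longrightarrow> y \<noteq> z \<Longrightarrow> e \<le> dist y z"
      "card S = Greatest P"
    proof -
      have "P (Greatest P)" by (rule GreatestI_nat[of P 0 N, OF P0]) (use N in blast)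
      then show thesis using that unfolding P_def by auto
    qed
    have "cball x R \<subseteq> (\<Union>y\<in>S. ball y e)"
    proof (rule ccontr)
      assume "\<not> ?thesis"
      then obtain z where z: "z \<in> cball x R" "\<And>y. y \<in> S \<Longrightarrow> e \<le> dist y z" by force
      then have "z \<notin> S" using \<open>0 < e\<close> by force
      have "P (Suc (Greatest P))"
        unfolding P_def[of "Suc (Greatest P)"]
      proof (intro exI[of _ "insert z S"] conjI ballI impI)
        fix a b assume "a \<in> insert z S" "b \<in> insert z S" "a \<noteq> b"
        then show "e \<le> dist a b" using z S(3) by (auto simp: dist_commute)
      qed (use S z \<open>z \<notin> S\<close> in auto)
      then have "Suc (Greatest P) \<le> Greatest P"
        using Greatest_le_nat[of P _ N] N by blast
      then show False by simp
    qed
    with S(1) show "\<exists>k. finite k \<and> cball x R \<subseteq> (\<Union>x\<in>k. ball x e)" by blast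
  qed
qed

text \<open>An Arzela-Ascoli argument in which the diagonal sequence is hidden in a product: the
  restrictions to rational times lie in a countable product of compact balls, which is compact and
  metrizable and hence sequentially compact. The common Lipschitz bound then extends convergence to
  all real times.\<close>

lemma lipschitz_curves_subsequence:
  fixes \<sigma> :: "nat \<Rightarrow> real \<Rightarrow> 'a"
  assumes lip: "\<And>n. 1-lipschitz_on UNIV (\<sigma> n)" and conv: "(\<lambda>n. \<sigma> n 0) \<longlonglongrightarrow> x"
  obtains k \<gamma> where "strict_mono k" "1-lipschitz_on UNIV \<gamma>" "\<And>t. (\<lambda>n. \<sigma> (k n) t) \<longlonglongrightarrow> \<gamma> t"
proof -
  have "bounded (range (\<lambda>n. \<sigma> n 0))"
    using convergent_imp_bounded conv by blast
  then obtain R where R: "\<And>n. dist x (\<sigma> n 0) \<le> R"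
    unfolding bounded_any_center[of _ x] by auto
  have d: "dist (\<sigma> n s) (\<sigma> n t) \<le> \<bar>s - t\<bar>" for n s t
    using lipschitz_onD[OF lip, of s t n] by (simp add: dist_real_def)
  \<comment> \<open>Each curve starts within R of x and moves by at most the absolute value of q up
    to time q.\<close>
  define S where "S = PiE UNIV (\<lambda>q::rat. cball x (R + \<bar>real_of_rat q\<bar>))"
  have "compactin (product_topology (\<lambda>i::rat. euclidean) UNIV) S"
    unfolding S_def compactin_PiE using compact_cball by auto
  then have "compact S" by (simp add: euclidean_product_topology)
  then have "seq_compact S" by (simp add: compact_eq_seq_compact_metric)
  moreover have "\<forall>n. (\<lambda>q. \<sigma> n (real_of_rat q)) \<in> S"
  proof
    fix n
    have "dist x (\<sigma> n (real_of_rat q)) \<le> R + \<bar>real_of_rat q\<bar>" for q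
      using dist_triangle[of x "\<sigma> n (real_of_rat q)" "\<sigma> n 0"] R[of n] d[of n 0 "real_of_rat q"] by simp
    then show "(\<lambda>q. \<sigma> n (real_of_rat q)) \<in> S" unfolding S_def by (intro PiE_I) auto
  qed
  ultimately obtain l k where k: "strict_mono (k :: nat \<Rightarrow> nat)" "((\<lambda>n q. \<sigma> n (real_of_rat q)) \<circ> k) \<longlonglongrightarrow> l"
    by (rule seq_compactE)
  have rat: "(\<lambda>n. \<sigma> (k n) (real_of_rat q)) \<longlonglongrightarrow> l q" for q
  proof -
    have "continuous_on UNIV (\<lambda>f :: rat \<Rightarrow> 'a. f q)"
      by (rule continuous_on_product_coordinates)
    then have "isCont (\<lambda>f :: rat \<Rightarrow> 'a. f q) l"
      by (metis UNIV_I continuous_on_eq_continuous_at open_UNIV)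
    from isCont_tendsto_compose[OF this k(2)] show ?thesis by (simp add: o_def)
  qed
  have "convergent (\<lambda>n. \<sigma> (k n) t)" for t
  proof (rule Cauchy_convergent, rule metric_CauchyI)
    fix e :: real assume "0 < e"
    obtain q where q: "t < of_rat q" "of_rat q < t + e / 3"
      using of_rat_dense[of t "t + e / 3"] \<open>0 < e\<close> by auto
    obtain N where N: "\<And>m n. N \<le> m \<Longrightarrow> N \<le> n \<Longrightarrow> dist (\<sigma> (k m) (of_rat q)) (\<sigma> (k n) (of_rat q)) < e / 3"
      using metric_CauchyD[OF LIMSEQ_imp_Cauchy[OF rat[of q]], of "e / 3"] \<open>0 < e\<close> by auto
    have "dist (\<sigma> (k m) t) (\<sigma> (k n) t) < e" if "N \<le> m" "N \<le> n" for m n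
      using N[OF that] d[of "k m" t "of_rat q"] d[of "k n" t "of_rat q"] q
        dist_triangle[of "\<sigma> (k m) t" "\<sigma> (k n) t" "\<sigma> (k m) (of_rat q)"]
        dist_triangle2[of "\<sigma> (k m) (of_rat q)" "\<sigma> (k n) t" "\<sigma> (k n) (of_rat q)"]
      by linarith
    then show "\<exists>N. \<forall>m\<ge>N. \<forall>n\<ge>N. dist (\<sigma> (k m) t) (\<sigma> (k n) t) < e" by blast
  qed
  then obtain \<gamma> where \<gamma>: "\<And>t. (\<lambda>n. \<sigma> (k n) t) \<longlonglongrightarrow> \<gamma> t"
    unfolding convergent_def by metis
  have "1-lipschitz_on UNIV \<gamma>"
  proof (rule lipschitz_onI)
    fix s t
    have "(\<lambda>n. dist (\<sigma> (k n) s) (\<sigma> (k n) t)) \<longlonglongrightarrow> dist (\<gamma> s) (\<gamma> t)"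
      by (intro tendsto_dist \<gamma>)
    then have "dist (\<gamma> s) (\<gamma> t) \<le> \<bar>s - t\<bar>"
      by (rule tendsto_upperbound) (auto simp: d)
    then show "dist (\<gamma> s) (\<gamma> t) \<le> 1 * dist s t" by (simp add: dist_real_def)
  qed simp
  with k(1) show thesis using \<gamma> by (rule that)
qed

end

lemma lsc_le_liminf:
  fixes G :: "'a::metric_space \<Rightarrow> ennreal"
  assumes "\<And>a. open {x. a < G x}" "X \<longlonglongrightarrow> x"
  shows "G x \<le> liminf (\<lambda>n. G (X n))"
  unfolding le_Liminf_iff
proof (intro allI impI)
  fix y assume "y < G x"
  then show "\<forall>\<^sub>F n in sequentially. y < G (X n)"
    using topological_tendstoD[OF assms(2) assms(1)[of y]] by simp
qed

lemma lsc_borel_measurable: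
  fixes G :: "'a::topological_space \<Rightarrow> 'b::{linorder_topology, second_countable_topology}"
  assumes "\<And>a. open {x. a < G x}"
  shows "G \<in> borel_measurable borel"
  by (rule borel_measurableI_greater) (use assms in simp)

subsection \<open>Localizing upper gradients\<close>

lemma upper_gradient_subcurve:
  fixes \<gamma> :: "real \<Rightarrow> 'a::metric_space"
  assumes ug: "upper_gradient E f g" and \<gamma>: "is_curve \<gamma> l" and ab: "0 \<le> a" "a < b" "b \<le> l"
    and sub: "\<gamma> ` {a..b} \<subseteq> E"
  shows "ug_lhs (f (\<gamma> a)) (f (\<gamma> b)) \<le> (\<integral>\<^sup>+ t\<in>{a..b}. g (\<gamma> t) \<partial>lborel)"
proof -
  have "ug_lhs (f (\<gamma> (a + 0))) (f (\<gamma> (a + (b - a)))) \<le> line_integral g (\<lambda>t. \<gamma> (a + t)) (b - a)"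
    using ug curve_in_subcurve[OF \<gamma> ab sub] unfolding upper_gradient_def by blast
  also have "\<dots> = (\<integral>\<^sup>+ t\<in>{a..b}. g (\<gamma> t) \<partial>lborel)"
  proof (rule line_integral_shift, rule borel_measurable_along[OF _ _ sub])
    show "continuous_on {a..b} \<gamma>"
      using lipschitz_on_continuous_on[OF is_curve_lipschitz[OF \<gamma>]] ab by (auto intro: continuous_on_subset)
  qed (use ug in \<open>simp add: upper_gradient_def\<close>)
  finally show ?thesis by simp
qed

lemma real_upper_gradient_subcurve:
  fixes \<gamma> :: "real \<Rightarrow> 'a::metric_space"
  assumes "real_upper_gradient f g" "is_curve \<gamma> l" "0 \<le> a" "a \<le> b" "b \<le> l"
  shows "ennreal \<bar>f (\<gamma> a) - f (\<gamma> b)\<bar> \<le> (\<integral>\<^sup>+ t\<in>{a..b}. g (\<gamma> t) \<partial>lborel)"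
  using upper_gradient_subcurve[OF assms(1,2,3) _ assms(5)] assms(4) by (cases "a = b") auto

lemma real_upper_gradientI:
  assumes "g \<in> borel_measurable borel"
    "\<And>\<gamma> l. is_curve \<gamma> l \<Longrightarrow> ennreal \<bar>f (\<gamma> 0) - f (\<gamma> l)\<bar> \<le> (\<integral>\<^sup>+ t\<in>{0..l}. g (\<gamma> t) \<partial>lborel)"
  shows "real_upper_gradient f g"
  using assms by (auto simp: upper_gradient_def curve_in_def line_integral_def)

lemma real_upper_gradientD:
  assumes "real_upper_gradient f g"
  shows "g \<in> borel_measurable borel"
    "is_curve \<gamma> l \<Longrightarrow> ennreal \<bar>f (\<gamma> 0) - f (\<gamma> l)\<bar> \<le> (\<integral>\<^sup>+ t\<in>{0..l}. g (\<gamma> t) \<partial>lborel)"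
  using assms by (auto simp: upper_gradient_def curve_in_def line_integral_def)

lemma curve_measurable:
  assumes "is_curve \<gamma> l" "g \<in> borel_measurable borel" "0 \<le> a" "b \<le> l"
  shows "(\<lambda>t. g (\<gamma> t) * indicator {a..b} t :: ennreal) \<in> borel_measurable borel"
  using lipschitz_on_continuous_on[OF is_curve_lipschitz[OF assms(1)]] assms
  by (intro borel_measurable_along_UNIV) (auto intro: continuous_on_subset)

lemma real_upper_gradient_zero_on_closed:
  fixes f :: "'a::metric_space \<Rightarrow> real"
  assumes ug: "real_upper_gradient f g" and F: "closed F" "\<And>x. x \<in> F \<Longrightarrow> f x = 0"
  shows "real_upper_gradient f (\<lambda>x. g x * indicator (- F) x)"
proof (rule real_upper_gradientI)
  let ?g = "\<lambda>x. g x * indicator (- F) x"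
  have [measurable]: "g \<in> borel_measurable borel" using real_upper_gradientD[OF ug] by simp
  have [measurable]: "F \<in> sets borel" using F by auto
  show gm: "?g \<in> borel_measurable borel" by measurable
  fix \<gamma> :: "real \<Rightarrow> 'a" and l assume \<gamma>: "is_curve \<gamma> l"
  then have l: "0 < l" by (simp add: is_curve_def)
  define T where "T = {0..l} \<inter> \<gamma> -` F"
  have "continuous_on {0..l} \<gamma>" using lipschitz_on_continuous_on[OF is_curve_lipschitz[OF \<gamma>]] .
  then have "closed T" unfolding T_def using F(1) by (intro continuous_closed_preimage) auto
  then have "compact T" using compact_Int_closed[of "{0..l}" T] by (simp add: T_def Int_absorb1 inf.absorb2)
  show "ennreal \<bar>f (\<gamma> 0) - f (\<gamma> l)\<bar> \<le> (\<integral>\<^sup>+ t\<in>{0..l}. ?g (\<gamma> t) \<partial>lborel)"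
  proof (cases "T = {}")
    case True
    have "(\<integral>\<^sup>+ t\<in>{0..l}. g (\<gamma> t) \<partial>lborel) = (\<integral>\<^sup>+ t\<in>{0..l}. ?g (\<gamma> t) \<partial>lborel)"
      by (intro nn_integral_cong) (use True in \<open>auto simp: T_def indicator_def\<close>)
    then show ?thesis using real_upper_gradientD(2)[OF ug \<gamma>] by simp
  next
    case False
    obtain a where a: "a \<in> T" "\<And>t. t \<in> T \<Longrightarrow> a \<le> t"
      using compact_attains_inf[OF \<open>compact T\<close> False] by blast
    obtain b where b: "b \<in> T" "\<And>t. t \<in> T \<Longrightarrow> t \<le> b"
      using compact_attains_sup[OF \<open>compact T\<close> False] by blast
    have ab: "0 \<le> a" "a \<le> b" "b \<le> l" using a b by (auto simp: T_def)
    have "ennreal \<bar>f (\<gamma> 0) - f (\<gamma> l)\<bar> \<le> ennreal \<bar>f (\<gamma> 0) - f (\<gamma> a)\<bar> + ennreal \<bar>f (\<gamma> b) - f (\<gamma> l)\<bar>"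
      using a(1) b(1) F(2) by (auto simp: T_def simp flip: ennreal_plus intro!: ennreal_leI)
    also have "\<dots> \<le> (\<integral>\<^sup>+ t\<in>{0..a}. g (\<gamma> t) \<partial>lborel) + (\<integral>\<^sup>+ t\<in>{b..l}. g (\<gamma> t) \<partial>lborel)"
      using ab by (intro add_mono real_upper_gradient_subcurve[OF ug \<gamma>]) auto
    also have "(\<integral>\<^sup>+ t\<in>{0..a}. g (\<gamma> t) \<partial>lborel) = (\<integral>\<^sup>+ t\<in>{0..a}. ?g (\<gamma> t) \<partial>lborel)"
    proof (rule nn_integral_cong_AE, rule AE_mp[OF AE_lborel_singleton[of a]], intro AE_I2 impI)
      fix t assume "t \<noteq> a"
      show "g (\<gamma> t) * indicator {0..a} t = ?g (\<gamma> t) * indicator {0..a} t"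
        using a(2)[of t] ab \<open>t \<noteq> a\<close> by (auto simp: indicator_def T_def)
    qed
    also have "(\<integral>\<^sup>+ t\<in>{b..l}. g (\<gamma> t) \<partial>lborel) = (\<integral>\<^sup>+ t\<in>{b..l}. ?g (\<gamma> t) \<partial>lborel)"
    proof (rule nn_integral_cong_AE, rule AE_mp[OF AE_lborel_singleton[of b]], intro AE_I2 impI)
      fix t assume "t \<noteq> b"
      show "g (\<gamma> t) * indicator {b..l} t = ?g (\<gamma> t) * indicator {b..l} t"
        using b(2)[of t] ab \<open>t \<noteq> b\<close> by (auto simp: indicator_def T_def)
    qed
    also have "(\<integral>\<^sup>+ t\<in>{0..a}. ?g (\<gamma> t) \<partial>lborel) + (\<integral>\<^sup>+ t\<in>{b..l}. ?g (\<gamma> t) \<partial>lborel)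
        \<le> (\<integral>\<^sup>+ t\<in>{0..a}. ?g (\<gamma> t) \<partial>lborel) + ((\<integral>\<^sup>+ t\<in>{a..b}. ?g (\<gamma> t) \<partial>lborel) + (\<integral>\<^sup>+ t\<in>{b..l}. ?g (\<gamma> t) \<partial>lborel))"
      by (intro add_left_mono) simp
    also have "(\<integral>\<^sup>+ t\<in>{a..b}. ?g (\<gamma> t) \<partial>lborel) + (\<integral>\<^sup>+ t\<in>{b..l}. ?g (\<gamma> t) \<partial>lborel) = (\<integral>\<^sup>+ t\<in>{a..l}. ?g (\<gamma> t) \<partial>lborel)"
      using ab by (intro set_nn_integral_Icc_split[symmetric] curve_measurable[OF \<gamma> gm]) auto
    also have "(\<integral>\<^sup>+ t\<in>{0..a}. ?g (\<gamma> t) \<partial>lborel) + (\<integral>\<^sup>+ t\<in>{a..l}. ?g (\<gamma> t) \<partial>lborel) = (\<integral>\<^sup>+ t\<in>{0..l}. ?g (\<gamma> t) \<partial>lborel)"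
      using ab by (intro set_nn_integral_Icc_split[symmetric] curve_measurable[OF \<gamma> gm]) auto
    finally show ?thesis .
  qed
qed

subsection \<open>Lower semicontinuous majorants\<close>

text \<open>The number c only has to dominate the path integral, so all costs stay real. Paths are
  Lipschitz rather than parametrized by arc length, and \<open>L = 0\<close> is allowed, so that the
  class contains the trivial path and is stable under concatenation and limits.\<close>

definition reaches ::
  "'a::metric_space set \<Rightarrow> ('a \<Rightarrow> real) \<Rightarrow> ('a \<Rightarrow> ennreal) \<Rightarrow> 'a \<Rightarrow> real \<Rightarrow> bool" where
  "reaches K w G x v \<longleftrightarrow> (\<exists>\<gamma> (L::real) c. 0 \<le> L \<and> 1-lipschitz_on {0..L} \<gamma> \<and> \<gamma> 0 = x \<and> \<gamma> L \<in> K \<and> 0 \<le> c \<and>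
     v = w (\<gamma> L) + c \<and> (\<integral>\<^sup>+ t\<in>{0..L}. G (\<gamma> t) \<partial>lborel) \<le> ennreal c)"

text \<open>The largest function below \<open>b\<close> with boundary values \<open>w\<close> on \<open>K\<close> that has \<open>G\<close> as an upper gradient.\<close>

definition path_inf ::
  "'a::metric_space set \<Rightarrow> ('a \<Rightarrow> real) \<Rightarrow> ('a \<Rightarrow> ennreal) \<Rightarrow> real \<Rightarrow> 'a \<Rightarrow> real" where
  "path_inf K w G b x = Inf (insert b {v. reaches K w G x v})"

lemma lipschitz_reverse:
  assumes "1-lipschitz_on {0..l} \<sigma>"
  shows "1-lipschitz_on {0..l} (\<lambda>t. \<sigma> (l - t :: real))"
proof (rule lipschitz_onI)
  fix s t assume "s \<in> {0..l}" "t \<in> {0..l}"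
  then show "dist (\<sigma> (l - s)) (\<sigma> (l - t)) \<le> 1 * dist s t"
    using lipschitz_onD[OF assms, of "l - s" "l - t"] by (auto simp: dist_real_def)
qed simp

lemma nn_integral_reverse:
  fixes \<sigma> :: "real \<Rightarrow> 'a::metric_space"
  assumes "1-lipschitz_on {0..l} \<sigma>" "G \<in> borel_measurable borel"
  shows "(\<integral>\<^sup>+ t\<in>{0..l}. G (\<sigma> (l - t)) \<partial>lborel) = (\<integral>\<^sup>+ t\<in>{0..l}. G (\<sigma> t) \<partial>lborel)"
proof -
  have "(\<lambda>t. G (\<sigma> t) * indicator {0..l} t) \<in> borel_measurable borel"
    using assms by (intro borel_measurable_along_UNIV) (auto intro: lipschitz_on_continuous_on)
  then have "(\<integral>\<^sup>+ t\<in>{0..l}. G (\<sigma> t) \<partial>lborel) = (\<integral>\<^sup>+ t. G (\<sigma> (l + (-1) * t)) * indicator {0..l} (l + (-1) * t) \<partial>lborel)"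
    by (subst nn_integral_real_affine[of _ "-1" l]) auto
  also have "\<dots> = (\<integral>\<^sup>+ t\<in>{0..l}. G (\<sigma> (l - t)) \<partial>lborel)"
    by (intro nn_integral_cong) (auto simp: indicator_def)
  finally show ?thesis ..
qed

lemma reaches_concat:
  fixes \<sigma> :: "real \<Rightarrow> 'a::metric_space"
  assumes G: "G \<in> borel_measurable borel"
    and \<sigma>: "0 \<le> l" "1-lipschitz_on {0..l} \<sigma>" "\<sigma> 0 = x" "\<sigma> l = y" "0 \<le> i"
      "(\<integral>\<^sup>+ t\<in>{0..l}. G (\<sigma> t) \<partial>lborel) \<le> ennreal i"
    and y: "reaches K w G y v"
  shows "reaches K w G x (v + i)"
proof -
  obtain \<gamma> c and L :: real where \<gamma>: "0 \<le> L" "1-lipschitz_on {0..L} \<gamma>" "\<gamma> 0 = y" "\<gamma> L \<in> K" "0 \<le> c"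
    "v = w (\<gamma> L) + c" "(\<integral>\<^sup>+ t\<in>{0..L}. G (\<gamma> t) \<partial>lborel) \<le> ennreal c"
    using y unfolding reaches_def by auto
  define \<gamma>' where "\<gamma>' t = (if t \<le> l then \<sigma> t else \<gamma> (t - l))" for t
  have "1-lipschitz_on {l..l + L} (\<lambda>t. \<gamma> (t - l))"
  proof (rule lipschitz_onI)
    fix s t assume "s \<in> {l..l + L}" "t \<in> {l..l + L}"
    then show "dist (\<gamma> (s - l)) (\<gamma> (t - l)) \<le> 1 * dist s t"
      using lipschitz_onD[OF \<gamma>(2), of "s - l" "t - l"] by (auto simp: dist_real_def)
  qed simp
  then have lip: "1-lipschitz_on {0..l + L} \<gamma>'"
    unfolding \<gamma>'_def using \<sigma> \<gamma> by (intro lipschitz_on_concat) auto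
  have m: "(\<lambda>t. G (\<gamma>' t) * indicator {0..l + L} t) \<in> borel_measurable borel"
    using lip G by (intro borel_measurable_along_UNIV) (auto intro: lipschitz_on_continuous_on)
  have m': "(\<lambda>t. G (\<gamma>' t) * indicator {l..l + L} t) \<in> borel_measurable borel"
    using lip G \<sigma>(1) by (intro borel_measurable_along_UNIV) (auto intro: lipschitz_on_continuous_on continuous_on_subset)
  have "(\<integral>\<^sup>+ t\<in>{0..l + L}. G (\<gamma>' t) \<partial>lborel) = (\<integral>\<^sup>+ t\<in>{0..l}. G (\<gamma>' t) \<partial>lborel) + (\<integral>\<^sup>+ t\<in>{l..l + L}. G (\<gamma>' t) \<partial>lborel)"
    using m \<sigma>(1) \<gamma>(1) by (intro set_nn_integral_Icc_split) auto
  also have "(\<integral>\<^sup>+ t\<in>{0..l}. G (\<gamma>' t) \<partial>lborel) = (\<integral>\<^sup>+ t\<in>{0..l}. G (\<sigma> t) \<partial>lborel)"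
    by (intro nn_integral_cong) (auto simp: indicator_def \<gamma>'_def)
  also have "(\<integral>\<^sup>+ t\<in>{l..l + L}. G (\<gamma>' t) \<partial>lborel) = line_integral G (\<lambda>t. \<gamma>' (l + t)) L"
    using line_integral_shift[of G \<gamma>' l "l + L", OF m'] by simp
  also have "\<dots> = (\<integral>\<^sup>+ t\<in>{0..L}. G (\<gamma> t) \<partial>lborel)"
    unfolding line_integral_def using \<sigma> \<gamma>
    by (intro nn_integral_cong) (auto simp: indicator_def \<gamma>'_def)
  finally have "(\<integral>\<^sup>+ t\<in>{0..l + L}. G (\<gamma>' t) \<partial>lborel) \<le> ennreal i + ennreal c"
    using \<sigma>(6) \<gamma>(7) by (simp add: add_mono)
  then have "(\<integral>\<^sup>+ t\<in>{0..l + L}. G (\<gamma>' t) \<partial>lborel) \<le> ennreal (c + i)"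
    using \<sigma>(5) \<gamma>(5) by (simp add: ennreal_plus add.commute)
  moreover have "\<gamma>' 0 = x" "\<gamma>' (l + L) = \<gamma> L"
    using \<sigma> \<gamma> by (auto simp: \<gamma>'_def)
  ultimately show ?thesis
    unfolding reaches_def using lip \<sigma> \<gamma>
    by (intro exI[of _ \<gamma>'] exI[of _ "l + L"] exI[of _ "c + i"]) auto
qed

context
  fixes K :: "'a::metric_space set" and w :: "'a \<Rightarrow> real" and G :: "'a \<Rightarrow> ennreal" and b :: real
  assumes w: "\<And>x. 0 \<le> w x" "\<And>x. w x \<le> b"
    and ug: "real_upper_gradient w G"
begin

lemma G_measurable: "G \<in> borel_measurable borel"
  using real_upper_gradientD[OF ug] by simp

text \<open>This is the upper gradient inequality for w along the path. It bounds all competitors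
  below, which makes the infimum meaningful and puts it above w.\<close>

lemma reaches_ge: "reaches K w G x v \<Longrightarrow> w x \<le> v"
proof -
  assume "reaches K w G x v"
  then obtain \<gamma> c and L :: real where \<gamma>: "0 \<le> L" "1-lipschitz_on {0..L} \<gamma>" "\<gamma> 0 = x" "\<gamma> L \<in> K" "0 \<le> c"
    "v = w (\<gamma> L) + c" "(\<integral>\<^sup>+ t\<in>{0..L}. G (\<gamma> t) \<partial>lborel) \<le> ennreal c"
    unfolding reaches_def by auto
  have "ennreal \<bar>w (\<gamma> 0) - w (\<gamma> L)\<bar> \<le> ennreal c"
    using real_upper_gradient_lipschitz[OF ug \<gamma>(2,1)] \<gamma>(7) by (rule order_trans)
  then have "\<bar>w (\<gamma> 0) - w (\<gamma> L)\<bar> \<le> c" using \<gamma>(5) by simp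
  then show ?thesis using \<gamma> by auto
qed

lemma path_inf_bdd: "bdd_below (insert b {v. reaches K w G x v})"
  using reaches_ge w by (intro bdd_belowI[of _ "w x"]) auto

lemma path_inf_le: "path_inf K w G b x \<le> b"
  unfolding path_inf_def by (rule cInf_lower) (use path_inf_bdd in auto)

lemma path_inf_le_reaches: "reaches K w G x v \<Longrightarrow> path_inf K w G b x \<le> v"
  unfolding path_inf_def by (rule cInf_lower) (use path_inf_bdd in auto)

lemma path_inf_ge: "w x \<le> path_inf K w G b x"
  unfolding path_inf_def by (rule cInf_greatest) (use reaches_ge w in auto)

lemma path_inf_eq: "x \<in> K \<Longrightarrow> path_inf K w G b x = w x"
proof (rule antisym[OF path_inf_le_reaches path_inf_ge])
  assume x: "x \<in> K"
  have "(\<integral>\<^sup>+ t\<in>{0..0::real}. G x \<partial>lborel) = 0"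
    by (subst nn_integral_cmult) auto
  then show "reaches K w G x (w x)"
    unfolding reaches_def using x
    by (intro exI[of _ "\<lambda>_. x"] exI[of _ 0]) (auto simp: lipschitz_on_def)
qed

text \<open>Every path from y can be preceded by \<open>\<sigma>\<close> at extra cost i, and the
  competitor b only improves when a nonnegative i is added. Used in both directions of a curve, this
  gives the upper gradient inequality.\<close>

lemma path_inf_step:
  fixes l :: real
  assumes \<sigma>: "0 \<le> l" "1-lipschitz_on {0..l} \<sigma>" "\<sigma> 0 = x" "\<sigma> l = y" "0 \<le> i"
      "(\<integral>\<^sup>+ t\<in>{0..l}. G (\<sigma> t) \<partial>lborel) \<le> ennreal i"
  shows "path_inf K w G b x \<le> path_inf K w G b y + i"
proof -
  have "path_inf K w G b x - i \<le> path_inf K w G b y"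
    unfolding path_inf_def[of K w G b y]
  proof (rule cInf_greatest)
    fix v assume "v \<in> insert b {v. reaches K w G y v}"
    then consider "v = b" | "reaches K w G y v" by auto
    then show "path_inf K w G b x - i \<le> v"
    proof cases
      case 2
      show ?thesis using path_inf_le_reaches[OF reaches_concat[OF G_measurable \<sigma> 2]] by simp
    qed (use path_inf_le[of x] \<sigma>(5) in auto)
  qed simp
  then show ?thesis by simp
qed

lemma path_inf_upper_gradient: "real_upper_gradient (path_inf K w G b) G"
proof (rule real_upper_gradientI[OF G_measurable])
  fix \<gamma> :: "real \<Rightarrow> 'a" and l assume \<gamma>: "is_curve \<gamma> l"
  then have l: "0 \<le> l" by (simp add: is_curve_def)
  note lip = is_curve_lipschitz[OF \<gamma>]
  show "ennreal \<bar>path_inf K w G b (\<gamma> 0) - path_inf K w G b (\<gamma> l)\<bar> \<le> (\<integral>\<^sup>+ t\<in>{0..l}. G (\<gamma> t) \<partial>lborel)"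
  proof (cases "\<integral>\<^sup>+ t\<in>{0..l}. G (\<gamma> t) \<partial>lborel")
    case (real i)
    have "path_inf K w G b (\<gamma> 0) \<le> path_inf K w G b (\<gamma> l) + i"
      using l lip real by (intro path_inf_step[where \<sigma>=\<gamma>]) auto
    moreover have "path_inf K w G b (\<gamma> l) \<le> path_inf K w G b (\<gamma> 0) + i"
      using l lipschitz_reverse[OF lip] real nn_integral_reverse[OF lip G_measurable]
      by (intro path_inf_step[where \<sigma>="\<lambda>t. \<gamma> (l - t)"]) auto
    ultimately show ?thesis using real by (auto intro!: ennreal_leI)
  qed simp
qed

end

section \<open>Semicontinuous approximation in energy\<close>

context newtonian_space begin

text \<open>A near-optimal path from each \<open>X n\<close> has length at most b because
  \<open>G \<ge> 1\<close>, so a subsequence converges to a path from x. Its endpoint remains in the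
  closed set K, where w is continuous, and Fatou's lemma with the semicontinuity of G bounds its
  cost by the limit of the costs. Thus the limit path itself is a competitor of value a.\<close>

lemma path_inf_lsc:
  fixes K :: "'a set"
  assumes w: "\<And>x. 0 \<le> w x" "\<And>x. w x \<le> b"
    and ug: "real_upper_gradient w G"
    and K: "closed K" "continuous_on K w"
    and lsc: "\<And>a. open {x. a < G x}" and G1: "\<And>x. 1 \<le> G x"
  shows "open {x. a < path_inf K w G b x}"
proof -
  let ?h = "path_inf K w G b"
  note le = path_inf_le[OF w ug, of K] and le_reaches = path_inf_le_reaches[OF w ug, of K]
  have "closed {x. ?h x \<le> a}"
    unfolding closed_sequential_limits
  proof (intro allI impI, elim conjE, rule CollectI)
    fix X x assume X: "\<forall>n. X n \<in> {x. ?h x \<le> a}" "X \<longlonglongrightarrow> x"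
    show "?h x \<le> a"
    proof (cases "b \<le> a")
      case True
      then show ?thesis using le[of x] by simp
    next
      case False
      \<comment> \<open>Since \<open>a + e n \<le> b\<close>, a competitor below
        \<open>a + e n\<close> cannot be the constant b and must come from a path.\<close>
      define e where "e n = (b - a) / real (Suc n)" for n
      have e: "0 < e n" "a + e n \<le> b" for n
        using False by (auto simp: e_def field_simps intro!: mult_right_mono)
      have e0: "e \<longlonglongrightarrow> 0"
        unfolding e_def by (rule LIMSEQ_Suc[OF lim_const_over_n[of "b - a"]])
      have "\<exists>v. reaches K w G (X n) v \<and> v < a + e n" for n
      proof -
        have "Inf (insert b {v. reaches K w G (X n) v}) < a + e n"
          using X(1) e(1)[of n] unfolding path_inf_def by (smt (verit) mem_Collect_eq)
        then obtain v where "v \<in> insert b {v. reaches K w G (X n) v}" "v < a + e n"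
          using cInf_lessD[of "insert b {v. reaches K w G (X n) v}"] by auto
        with e(2)[of n] show ?thesis by auto
      qed
      define P where "P n \<gamma> L c \<longleftrightarrow> 0 \<le> L \<and> 1-lipschitz_on {0..L} \<gamma> \<and> \<gamma> 0 = X n \<and> \<gamma> L \<in> K \<and> 0 \<le> c \<and>
          w (\<gamma> L) + c < a + e n \<and> (\<integral>\<^sup>+ t\<in>{0..L}. G (\<gamma> t) \<partial>lborel) \<le> ennreal c" for n \<gamma> and L :: real and c
      have "\<exists>\<gamma> L c. P n \<gamma> L c" for n
        using \<open>\<And>n. \<exists>v. reaches K w G (X n) v \<and> v < a + e n\<close>[of n] unfolding reaches_def P_def by auto
      then obtain \<gamma> L c where P: "\<And>n. P n (\<gamma> n) (L n) (c n)"
        by metis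
      have \<gamma>: "\<And>n. 0 \<le> L n" "\<And>n. 1-lipschitz_on {0..L n} (\<gamma> n)" "\<And>n. \<gamma> n 0 = X n"
        "\<And>n. \<gamma> n (L n) \<in> K" "\<And>n. 0 \<le> c n" "\<And>n. w (\<gamma> n (L n)) + c n < a + e n"
        "\<And>n. (\<integral>\<^sup>+ t\<in>{0..L n}. G (\<gamma> n t) \<partial>lborel) \<le> ennreal (c n)"
        using P unfolding P_def by auto
      have Lb: "L n \<le> b" for n
      proof -
        have "ennreal (L n) = (\<integral>\<^sup>+ t\<in>{0..L n}. 1 \<partial>lborel)" using \<gamma>(1)[of n] by simp
        also have "\<dots> \<le> (\<integral>\<^sup>+ t\<in>{0..L n}. G (\<gamma> n t) \<partial>lborel)"
          by (intro nn_integral_mono mult_right_mono G1) simp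
        also have "\<dots> \<le> ennreal (c n)" by (rule \<gamma>)
        finally have "L n \<le> c n" using \<gamma>(5)[of n] by simp
        also have "c n \<le> b" using \<gamma>(6)[of n] w(1)[of "\<gamma> n (L n)"] e(2)[of n] by linarith
        finally show ?thesis .
      qed
      have "bounded (range L)"
        using \<gamma>(1) Lb by (intro boundedI[of _ b]) auto
      then obtain L0 k1 where k1: "strict_mono k1" "(L \<circ> k1) \<longlonglongrightarrow> L0"
        using bounded_imp_convergent_subsequence by blast
      \<comment> \<open>Clamping time to [0, L n] extends all paths to the real line as constants
        outside their intervals, so that they share one domain despite their different
        lengths.\<close>
      define cl where "cl n t = max 0 (min t (L n))" for n t
      define \<sigma> where "\<sigma> n t = \<gamma> (k1 n) (cl (k1 n) t)" for n t
      have "1-lipschitz_on UNIV (\<sigma> n)" for n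
      proof (rule lipschitz_onI)
        fix s t :: real
        have "dist (\<sigma> n s) (\<sigma> n t) \<le> 1 * dist (cl (k1 n) s) (cl (k1 n) t)"
          unfolding \<sigma>_def using \<gamma>(1) by (intro lipschitz_onD[OF \<gamma>(2)]) (auto simp: cl_def)
        also have "\<dots> \<le> 1 * dist s t" by (auto simp: cl_def dist_real_def max_def min_def)
        finally show "dist (\<sigma> n s) (\<sigma> n t) \<le> 1 * dist s t" .
      qed simp
      moreover have "(\<lambda>n. \<sigma> n 0) \<longlonglongrightarrow> x"
        using LIMSEQ_subseq_LIMSEQ[OF X(2) k1(1)] \<gamma>(1,3) by (simp add: \<sigma>_def cl_def o_def)
      ultimately obtain k2 \<gamma>0 where k2: "strict_mono k2" "1-lipschitz_on UNIV \<gamma>0"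
        "\<And>t. (\<lambda>n. \<sigma> (k2 n) t) \<longlonglongrightarrow> \<gamma>0 t"
        by (rule lipschitz_curves_subsequence) (rule that)
      define k where "k n = k1 (k2 n)" for n
      have k: "strict_mono k" using k1(1) k2(1) by (simp add: k_def strict_mono_def)
      have Lk: "(\<lambda>n. L (k n)) \<longlonglongrightarrow> L0"
        using LIMSEQ_subseq_LIMSEQ[OF k1(2) k2(1)] by (simp add: k_def o_def)
      have ek: "(\<lambda>n. e (k n)) \<longlonglongrightarrow> 0"
        using LIMSEQ_subseq_LIMSEQ[OF e0 k] by (simp add: o_def)
      have L0: "0 \<le> L0"
        using Lk \<gamma>(1) by (intro tendsto_lowerbound[OF Lk]) auto
      have lim: "(\<lambda>n. \<gamma> (k n) (cl (k n) t)) \<longlonglongrightarrow> \<gamma>0 t" for t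
        using k2(3)[of t] by (simp add: \<sigma>_def k_def)
      have "\<gamma>0 0 = x"
      proof (rule LIMSEQ_unique[OF lim])
        show "(\<lambda>n. \<gamma> (k n) (cl (k n) 0)) \<longlonglongrightarrow> x"
          using LIMSEQ_subseq_LIMSEQ[OF X(2) k] \<gamma>(1,3) by (simp add: cl_def o_def)
      qed
      have y: "(\<lambda>n. \<gamma> (k n) (L (k n))) \<longlonglongrightarrow> \<gamma>0 L0"
      proof (rule tendsto_dist_iff[THEN iffD2])
        have le_L: "dist (\<gamma> (k n) (L (k n))) (\<gamma> (k n) (cl (k n) L0)) \<le> \<bar>L (k n) - L0\<bar>" for n
          using lipschitz_onD[OF \<gamma>(2), of "L (k n)" "k n" "cl (k n) L0"] \<gamma>(1)[of "k n"] L0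
          by (auto simp: cl_def dist_real_def max_def min_def split: if_splits)
        have "(\<lambda>n. \<bar>L (k n) - L0\<bar>) \<longlonglongrightarrow> 0"
          using Lk by (simp add: LIM_zero_iff tendsto_rabs_zero)
        moreover have "(\<lambda>n. dist (\<gamma> (k n) (cl (k n) L0)) (\<gamma>0 L0)) \<longlonglongrightarrow> 0"
          by (rule tendsto_dist_iff[THEN iffD1, OF lim])
        ultimately have sum0: "(\<lambda>n. \<bar>L (k n) - L0\<bar> + dist (\<gamma> (k n) (cl (k n) L0)) (\<gamma>0 L0)) \<longlonglongrightarrow> 0"
          using tendsto_add by fastforce
        have "dist (\<gamma> (k n) (L (k n))) (\<gamma>0 L0) \<le> \<bar>L (k n) - L0\<bar> + dist (\<gamma> (k n) (cl (k n) L0)) (\<gamma>0 L0)" for n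
          using le_L[of n] dist_triangle[of "\<gamma> (k n) (L (k n))" "\<gamma>0 L0" "\<gamma> (k n) (cl (k n) L0)"] by linarith
        then show "(\<lambda>n. dist (\<gamma> (k n) (L (k n))) (\<gamma>0 L0)) \<longlonglongrightarrow> 0"
          by (intro Lim_null_comparison[OF _ sum0]) auto
      qed
      have yK: "\<gamma>0 L0 \<in> K"
        by (rule closed_sequentially[OF K(1) _ y]) (rule \<gamma>(4))
      have wy: "(\<lambda>n. w (\<gamma> (k n) (L (k n)))) \<longlonglongrightarrow> w (\<gamma>0 L0)"
        by (rule continuous_on_tendsto_compose[OF K(2) y yK]) (simp add: \<gamma>)
      define d where "d n = a + e (k n) - w (\<gamma> (k n) (L (k n)))" for n
      have d: "d \<longlonglongrightarrow> a - w (\<gamma>0 L0)"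
        unfolding d_def using tendsto_diff[OF tendsto_add[OF tendsto_const ek] wy] by simp
      have cd: "c (k n) \<le> d n" for n using \<gamma>(6)[of "k n"] by (simp add: d_def)
      have "0 \<le> d n" for n using cd[of n] \<gamma>(5)[of "k n"] by linarith
      then have "0 \<le> a - w (\<gamma>0 L0)"
        by (intro tendsto_lowerbound[OF d]) auto
      moreover have "(\<integral>\<^sup>+ t\<in>{0..L0}. G (\<gamma>0 t) \<partial>lborel) \<le> ennreal (a - w (\<gamma>0 L0))"
      proof -
        \<comment> \<open>The single time \<open>L0\<close> has to be excluded: if the lengths
          approach \<open>L0\<close> from below, all indicators on the right vanish there.\<close>
        have "(\<integral>\<^sup>+ t\<in>{0..L0}. G (\<gamma>0 t) \<partial>lborel) \<le> (\<integral>\<^sup>+ t. liminf (\<lambda>n. G (\<gamma> (k n) t) * indicator {0..L (k n)} t) \<partial>lborel)"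
        proof (rule nn_integral_mono_AE, rule AE_mp[OF AE_lborel_singleton[of L0]], intro AE_I2 impI)
          fix t assume "t \<noteq> L0"
          show "G (\<gamma>0 t) * indicator {0..L0} t \<le> liminf (\<lambda>n. G (\<gamma> (k n) t) * indicator {0..L (k n)} t)"
          proof (cases "t \<in> {0..L0}")
            case True
            then have "t < L0" using \<open>t \<noteq> L0\<close> by simp
            then have ev: "\<forall>\<^sub>F n in sequentially. t < L (k n)"
              using order_tendstoD(1)[OF Lk] by blast
            have "G (\<gamma>0 t) * indicator {0..L0} t \<le> liminf (\<lambda>n. G (\<gamma> (k n) (cl (k n) t)))"
              using True lsc_le_liminf[OF lsc lim[of t]] by simp
            also have "\<dots> = liminf (\<lambda>n. G (\<gamma> (k n) t) * indicator {0..L (k n)} t)"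
              by (rule Liminf_eq, use ev in eventually_elim) (use True in \<open>auto simp: cl_def\<close>)
            finally show ?thesis .
          qed simp
        qed
        also have "\<dots> \<le> liminf (\<lambda>n. \<integral>\<^sup>+ t\<in>{0..L (k n)}. G (\<gamma> (k n) t) \<partial>lborel)"
        proof (rule nn_integral_liminf)
          fix n
          show "(\<lambda>t. G (\<gamma> (k n) t) * indicator {0..L (k n)} t) \<in> borel_measurable lborel"
            using borel_measurable_along_UNIV[OF lipschitz_on_continuous_on[OF \<gamma>(2)], of G "k n"]
              G_measurable[OF w ug] by simp
        qed
        also have "\<dots> \<le> liminf (\<lambda>n. ennreal (d n))"
          using \<gamma>(7) cd by (intro Liminf_mono always_eventually allI) (meson ennreal_leI order_trans)
        also have "\<dots> = ennreal (a - w (\<gamma>0 L0))"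
          using d by (intro lim_imp_Liminf tendsto_ennrealI) auto
        finally show ?thesis .
      qed
      ultimately have "reaches K w G x a"
        unfolding reaches_def using L0 k2(2) \<open>\<gamma>0 0 = x\<close> yK
        by (intro exI[of _ \<gamma>0] exI[of _ L0] exI[of _ "a - w (\<gamma>0 L0)"]) (auto intro: lipschitz_on_subset)
      then show ?thesis by (rule le_reaches)
    qed
  qed
  moreover have "{x. a < ?h x} = - {x. ?h x \<le> a}" by auto
  ultimately show ?thesis by (simp only: open_Compl)
qed

text \<open>The p-th power of the Newtonian norm with one chosen gradient in place of the infimum
  over all of them.\<close>

definition energy :: "('a \<Rightarrow> real) \<Rightarrow> ('a \<Rightarrow> ennreal) \<Rightarrow> ennreal" where
  "energy f g = (\<integral>\<^sup>+ x. ennreal (\<bar>f x\<bar> powr p) \<partial>M) + (\<integral>\<^sup>+ x. epow (g x) p \<partial>M)"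

text \<open>The difference of majorant and function vanishes on K, lies between 0 and b elsewhere,
  and has an upper gradient \<open>2 * G\<close> that may be cut down to the complement of K. Its
  energy is therefore at most an integral over that complement, which Lusin's theorem makes
  small.\<close>

lemma lsc_majorant:
  fixes w :: "'a \<Rightarrow> real"
  assumes wm [measurable]: "w \<in> borel_measurable M" and w: "\<And>x. 0 \<le> w x" "\<And>x. w x \<le> b"
    and ug: "real_upper_gradient w g" and int: "(\<integral>\<^sup>+ x. epow (g x) p \<partial>M) < \<infinity>" and e: "0 < (e::real)"
  obtains h \<rho> where "\<And>a. open {x. a < h x}" "\<And>x. w x \<le> h x" "\<And>x. h x \<le> b"
    "real_upper_gradient (\<lambda>x. h x - w x) \<rho>" "energy (\<lambda>x. h x - w x) \<rho> < ennreal e"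
proof -
  have gm [measurable]: "g \<in> borel_measurable borel" using real_upper_gradientD[OF ug] by simp
  obtain r where r: "\<And>a. open {x. a < r x}" "(\<integral>\<^sup>+ x. epow (r x) p \<partial>M) < \<infinity>" "\<And>x. g x \<le> 1 + r x"
    by (rule lower_semicontinuous_majorant[OF borel_measurable_M[OF gm] int]) (rule that)
  have [measurable]: "r \<in> borel_measurable borel" using r(1) by (rule lsc_borel_measurable)
  define G where "G x = 1 + r x" for x
  have [measurable]: "G \<in> borel_measurable borel" unfolding G_def by measurable
  have lsc: "open {x. a < G x}" for a
  proof (cases "a < 1")
    case True
    then have "{x. a < G x} = UNIV" by (auto simp: G_def intro: less_le_trans)
    then show ?thesis by simp
  next
    case False
    then have a: "1 + (a - 1) = a" by simp
    have "a < G x \<longleftrightarrow> a - 1 < r x" for x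
      unfolding G_def by (subst a[symmetric]) (metis a add.commute ennreal_add_left_cancel_less ennreal_one_neq_top infinity_ennreal_def)
    then have "{x. a < G x} = {x. a - 1 < r x}" by simp
    then show ?thesis using r(1) by simp
  qed
  have ugG: "real_upper_gradient w G"
  proof (rule real_upper_gradientI)
    fix \<gamma> :: "real \<Rightarrow> 'a" and l assume "is_curve \<gamma> l"
    then have "ennreal \<bar>w (\<gamma> 0) - w (\<gamma> l)\<bar> \<le> (\<integral>\<^sup>+ t\<in>{0..l}. g (\<gamma> t) \<partial>lborel)"
      by (rule real_upper_gradientD(2)[OF ug])
    also have "\<dots> \<le> (\<integral>\<^sup>+ t\<in>{0..l}. G (\<gamma> t) \<partial>lborel)"
      unfolding G_def by (intro nn_integral_mono mult_right_mono r) simp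
    finally show "ennreal \<bar>w (\<gamma> 0) - w (\<gamma> l)\<bar> \<le> (\<integral>\<^sup>+ t\<in>{0..l}. G (\<gamma> t) \<partial>lborel)" .
  qed measurable
  \<comment> \<open>Exactly the integrand that bounds the energy of the difference. It is only
    locally integrable, because of the constants in it, which is why the regularity lemmas assume no
    more.\<close>
  define d where "d x = ennreal (b powr p) + epow (2 * G x) p" for x
  have d [measurable]: "d \<in> borel_measurable borel" unfolding d_def by measurable
  have b: "0 \<le> b" using w[of undefined] by linarith
  have dfin: "(\<integral>\<^sup>+ y\<in>ball x R. d y \<partial>M) < \<infinity>" for x R
  proof -
    let ?c = "ennreal (2 powr p)"
    have d_le: "d y \<le> ennreal (b powr p) + ?c * (?c * (1 + epow (r y) p))" for y
    proof -
      have "epow (2 * G y) p = ?c * epow (G y) p"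
        using epow_mult[OF p_pos, of "ennreal 2" "G y"] epow_ennreal[of 2 p] by simp
      also have "\<dots> \<le> ?c * (?c * (1 + epow (r y) p))"
        unfolding G_def using epow_add_le[OF p_pos, of 1 "r y"] by (intro mult_left_mono) auto
      finally show ?thesis unfolding d_def by (rule add_left_mono)
    qed
    have "(\<integral>\<^sup>+ y\<in>ball x R. d y \<partial>M) \<le> (\<integral>\<^sup>+ y. (ennreal (b powr p) + ?c * ?c) * indicator (ball x R) y + ?c * ?c * epow (r y) p \<partial>M)"
      by (intro nn_integral_mono) (use d_le in \<open>auto simp: indicator_def distrib_left add.assoc mult.assoc\<close>)
    also have "\<dots> = (ennreal (b powr p) + ?c * ?c) * emeasure M (ball x R) + ?c * ?c * (\<integral>\<^sup>+ y. epow (r y) p \<partial>M)"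
      by (subst nn_integral_add) (auto simp: nn_integral_cmult)
    also have "\<dots> < \<infinity>"
      using r(2) emeasure_ball_finite[of x R] by (simp add: ennreal_mult_less_top)
    finally show ?thesis .
  qed
  obtain K where K: "closed K" "continuous_on K w" "(\<integral>\<^sup>+ x\<in>- K. d x \<partial>M) < ennreal e"
    by (rule lusin_density[OF borel_measurable_M[OF d] dfin wm e]) (rule that)
  let ?h = "path_inf K w G b"
  have G1: "1 \<le> G x" for x by (simp add: G_def)
  have h_lsc: "open {x. a < ?h x}" for a
    by (rule path_inf_lsc[OF w ugG K(1,2) lsc G1])
  let ?\<rho> = "\<lambda>x. (2 * G x) * indicator (- K) x"
  have "real_upper_gradient (\<lambda>x. ?h x - w x) (\<lambda>x. 2 * G x)"
  proof (rule real_upper_gradientI)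
    fix \<gamma> :: "real \<Rightarrow> 'a" and l assume \<gamma>: "is_curve \<gamma> l"
    have m: "(\<lambda>t. G (\<gamma> t) * indicator {0..l} t) \<in> borel_measurable borel"
      by (rule curve_measurable[OF \<gamma>]) auto
    have "ennreal \<bar>(?h (\<gamma> 0) - w (\<gamma> 0)) - (?h (\<gamma> l) - w (\<gamma> l))\<bar> \<le> ennreal \<bar>?h (\<gamma> 0) - ?h (\<gamma> l)\<bar> + ennreal \<bar>w (\<gamma> 0) - w (\<gamma> l)\<bar>"
      by (auto simp flip: ennreal_plus intro!: ennreal_leI)
    also have "\<dots> \<le> (\<integral>\<^sup>+ t\<in>{0..l}. G (\<gamma> t) \<partial>lborel) + (\<integral>\<^sup>+ t\<in>{0..l}. G (\<gamma> t) \<partial>lborel)"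
      by (intro add_mono real_upper_gradientD(2)[OF _ \<gamma>] path_inf_upper_gradient[OF w ugG] ugG)
    also have "\<dots> = (\<integral>\<^sup>+ t\<in>{0..l}. 2 * G (\<gamma> t) \<partial>lborel)"
      using m by (subst nn_integral_add[symmetric]) (auto intro!: nn_integral_cong simp: indicator_def mult_2)
    finally show "ennreal \<bar>(?h (\<gamma> 0) - w (\<gamma> 0)) - (?h (\<gamma> l) - w (\<gamma> l))\<bar> \<le> (\<integral>\<^sup>+ t\<in>{0..l}. 2 * G (\<gamma> t) \<partial>lborel)" .
  qed measurable
  then have ug_diff: "real_upper_gradient (\<lambda>x. ?h x - w x) ?\<rho>"
    using K(1) by (rule real_upper_gradient_zero_on_closed) (simp add: path_inf_eq[OF w ugG])
  have [measurable]: "?h \<in> borel_measurable borel" using h_lsc by (rule lsc_borel_measurable)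
  have [measurable]: "K \<in> sets M" using K(1) by simp
  then have [measurable]: "- K \<in> sets M" by (metis Compl_eq_Diff_UNIV sets.compl_sets space_M)
  have "energy (\<lambda>x. ?h x - w x) ?\<rho> \<le> (\<integral>\<^sup>+ x. ennreal (b powr p) * indicator (- K) x \<partial>M) + (\<integral>\<^sup>+ x. epow (2 * G x) p * indicator (- K) x \<partial>M)"
    unfolding energy_def
  proof (intro add_mono nn_integral_mono)
    fix x
    show "ennreal (\<bar>?h x - w x\<bar> powr p) \<le> ennreal (b powr p) * indicator (- K) x"
    proof (cases "x \<in> K")
      case True
      then show ?thesis using path_inf_eq[OF w ugG, of x K] by simp
    next
      case False
      have "\<bar>?h x - w x\<bar> powr p \<le> b powr p"
        using path_inf_ge[OF w ugG, of x K] path_inf_le[OF w ugG, of K x] w(1)[of x] p_pos by (intro powr_mono2) auto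
      then show ?thesis using False by (simp add: ennreal_leI)
    qed
    show "epow (?\<rho> x) p \<le> epow (2 * G x) p * indicator (- K) x"
      by (simp add: epow_indicator[OF p_pos])
  qed
  also have "\<dots> = (\<integral>\<^sup>+ x\<in>- K. d x \<partial>M)"
    by (subst nn_integral_add[symmetric]) (auto intro!: nn_integral_cong simp: d_def indicator_def)
  also have "\<dots> < ennreal e" by (rule K)
  finally have en: "energy (\<lambda>x. ?h x - w x) ?\<rho> < ennreal e" .
  show thesis
    by (rule that[OF h_lsc path_inf_ge[OF w ugG] path_inf_le[OF w ugG] ug_diff en])
qed

end

subsection \<open>Capacity and quasicontinuity\<close>

lemma real_upper_gradient_add:
  fixes f f' :: "'a::metric_space \<Rightarrow> real"
  assumes f: "real_upper_gradient f g" and f': "real_upper_gradient f' g'"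
  shows "real_upper_gradient (\<lambda>x. f x + f' x) (\<lambda>x. g x + g' x)"
proof (rule real_upper_gradientI)
  note gm [measurable] = real_upper_gradientD(1)[OF f] real_upper_gradientD(1)[OF f']
  show "(\<lambda>x. g x + g' x) \<in> borel_measurable borel" by measurable
  fix \<gamma> :: "real \<Rightarrow> 'a" and l assume \<gamma>: "is_curve \<gamma> l"
  have "ennreal \<bar>(f (\<gamma> 0) + f' (\<gamma> 0)) - (f (\<gamma> l) + f' (\<gamma> l))\<bar> \<le> ennreal \<bar>f (\<gamma> 0) - f (\<gamma> l)\<bar> + ennreal \<bar>f' (\<gamma> 0) - f' (\<gamma> l)\<bar>"
    by (auto simp flip: ennreal_plus intro!: ennreal_leI)
  also have "\<dots> \<le> (\<integral>\<^sup>+ t\<in>{0..l}. g (\<gamma> t) \<partial>lborel) + (\<integral>\<^sup>+ t\<in>{0..l}. g' (\<gamma> t) \<partial>lborel)"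
    by (intro add_mono real_upper_gradientD(2)[OF _ \<gamma>] f f')
  also have "\<dots> = (\<integral>\<^sup>+ t\<in>{0..l}. g (\<gamma> t) + g' (\<gamma> t) \<partial>lborel)"
    using curve_measurable[OF \<gamma> gm(1), of 0 l] curve_measurable[OF \<gamma> gm(2), of 0 l]
    by (subst nn_integral_add[symmetric]) (auto intro!: nn_integral_cong simp: indicator_def)
  finally show "ennreal \<bar>(f (\<gamma> 0) + f' (\<gamma> 0)) - (f (\<gamma> l) + f' (\<gamma> l))\<bar> \<le> (\<integral>\<^sup>+ t\<in>{0..l}. g (\<gamma> t) + g' (\<gamma> t) \<partial>lborel)" .
qed

lemma real_upper_gradient_cmult:
  fixes f :: "'a::metric_space \<Rightarrow> real"
  assumes f: "real_upper_gradient f g" and c: "0 \<le> c"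
  shows "real_upper_gradient (\<lambda>x. c * f x) (\<lambda>x. ennreal c * g x)"
proof (rule real_upper_gradientI)
  note gm [measurable] = real_upper_gradientD(1)[OF f]
  show "(\<lambda>x. ennreal c * g x) \<in> borel_measurable borel" by measurable
  fix \<gamma> :: "real \<Rightarrow> 'a" and l assume \<gamma>: "is_curve \<gamma> l"
  have "\<bar>c * f (\<gamma> 0) - c * f (\<gamma> l)\<bar> = c * \<bar>f (\<gamma> 0) - f (\<gamma> l)\<bar>"
    using c by (metis abs_mult abs_of_nonneg right_diff_distrib)
  then have "ennreal \<bar>c * f (\<gamma> 0) - c * f (\<gamma> l)\<bar> = ennreal c * ennreal \<bar>f (\<gamma> 0) - f (\<gamma> l)\<bar>"
    using c by (simp add: ennreal_mult)
  also have "\<dots> \<le> ennreal c * (\<integral>\<^sup>+ t\<in>{0..l}. g (\<gamma> t) \<partial>lborel)"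
    by (intro mult_left_mono real_upper_gradientD(2)[OF f \<gamma>]) simp
  also have "\<dots> = (\<integral>\<^sup>+ t\<in>{0..l}. ennreal c * g (\<gamma> t) \<partial>lborel)"
    using curve_measurable[OF \<gamma> gm, of 0 l] by (subst nn_integral_cmult[symmetric]) (auto simp: mult.assoc)
  finally show "ennreal \<bar>c * f (\<gamma> 0) - c * f (\<gamma> l)\<bar> \<le> (\<integral>\<^sup>+ t\<in>{0..l}. ennreal c * g (\<gamma> t) \<partial>lborel)" .
qed

lemma measurable_restrict_UNIV: "measurable (restrict_space N UNIV) L = measurable N L"
  by (rule measurable_cong_sets) (simp_all add: sets_restrict_UNIV)

lemma INF_add_lessD:
  fixes a c :: ennreal
  assumes "a + (INF i\<in>I. f i) < c"
  obtains i where "i \<in> I" "a + f i < c"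
proof -
  have "\<exists>i\<in>I. a + f i < c"
  proof (rule ccontr)
    assume "\<not> ?thesis"
    then have le: "c \<le> a + f i" if "i \<in> I" for i using that by (auto simp: not_less)
    have a: "a \<noteq> top" using assms by auto
    have "c - a \<le> (INF i\<in>I. f i)"
    proof (rule INF_greatest)
      fix i assume "i \<in> I"
      then show "c - a \<le> f i" using le[of i] a by (simp add: ennreal_minus_le_iff)
    qed
    moreover have "a \<le> c"
      using order_trans[OF le_iff_add[THEN iffD2] less_imp_le[OF assms]] by blast
    ultimately have "c \<le> a + (INF i\<in>I. f i)"
      by (metis add.commute add_right_mono diff_add_cancel_ennreal)
    then show False using assms by simp
  qed
  then show thesis using that by blast
qed

section \<open>Test functions, subadditivity of capacity and bounded functions\<close>

context newtonian_space begin

lemma energy_cmult: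
  assumes "f \<in> borel_measurable M" "g \<in> borel_measurable M" "0 \<le> c"
  shows "energy (\<lambda>x. c * f x) (\<lambda>x. ennreal c * g x) = ennreal (c powr p) * energy f g"
proof -
  have [measurable]: "f \<in> borel_measurable M" "g \<in> borel_measurable M" by fact+
  have "energy (\<lambda>x. c * f x) (\<lambda>x. ennreal c * g x) =
      (\<integral>\<^sup>+ x. ennreal (c powr p) * ennreal (\<bar>f x\<bar> powr p) \<partial>M) + (\<integral>\<^sup>+ x. ennreal (c powr p) * epow (g x) p \<partial>M)"
    using assms(3) p_pos by (simp add: energy_def epow_mult epow_ennreal abs_mult powr_mult ennreal_mult)
  then show ?thesis
    by (simp add: nn_integral_cmult energy_def distrib_left)
qed

lemma energy_add_le:
  assumes "f \<in> borel_measurable M" "g \<in> borel_measurable M" "f' \<in> borel_measurable M" "g' \<in> borel_measurable M"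
  shows "energy (\<lambda>x. f x + f' x) (\<lambda>x. g x + g' x) \<le> ennreal (2 powr p) * (energy f g + energy f' g')"
proof -
  have [measurable]: "f \<in> borel_measurable M" "g \<in> borel_measurable M" "f' \<in> borel_measurable M" "g' \<in> borel_measurable M"
    by fact+
  have "(\<integral>\<^sup>+ x. ennreal (\<bar>f x + f' x\<bar> powr p) \<partial>M) \<le>
      (\<integral>\<^sup>+ x. ennreal (2 powr p) * (ennreal (\<bar>f x\<bar> powr p) + ennreal (\<bar>f' x\<bar> powr p)) \<partial>M)"
  proof (rule nn_integral_mono)
    fix x
    have "ennreal (\<bar>f x + f' x\<bar> powr p) \<le> ennreal ((\<bar>f x\<bar> + \<bar>f' x\<bar>) powr p)"
      using p_pos by (intro ennreal_leI powr_mono2) auto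
    also have "\<dots> = epow (ennreal \<bar>f x\<bar> + ennreal \<bar>f' x\<bar>) p"
      by (subst ennreal_plus[symmetric]) (simp_all add: epow_ennreal del: ennreal_plus)
    also have "\<dots> \<le> ennreal (2 powr p) * (epow (ennreal \<bar>f x\<bar>) p + epow (ennreal \<bar>f' x\<bar>) p)"
      by (rule epow_add_le[OF p_pos])
    finally show "ennreal (\<bar>f x + f' x\<bar> powr p) \<le> ennreal (2 powr p) * (ennreal (\<bar>f x\<bar> powr p) + ennreal (\<bar>f' x\<bar> powr p))"
      by (simp add: epow_ennreal)
  qed
  moreover have "(\<integral>\<^sup>+ x. epow (g x + g' x) p \<partial>M) \<le> (\<integral>\<^sup>+ x. ennreal (2 powr p) * (epow (g x) p + epow (g' x) p) \<partial>M)"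
    by (intro nn_integral_mono epow_add_le p_pos)
  ultimately have "energy (\<lambda>x. f x + f' x) (\<lambda>x. g x + g' x) \<le>
      (\<integral>\<^sup>+ x. ennreal (2 powr p) * (ennreal (\<bar>f x\<bar> powr p) + ennreal (\<bar>f' x\<bar> powr p)) \<partial>M) +
      (\<integral>\<^sup>+ x. ennreal (2 powr p) * (epow (g x) p + epow (g' x) p) \<partial>M)"
    unfolding energy_def by (rule add_mono)
  also have "\<dots> = ennreal (2 powr p) * (energy f g + energy f' g')"
    by (simp add: nn_integral_cmult nn_integral_add energy_def distrib_left add.assoc add.commute add.left_commute)
  finally show ?thesis .
qed

lemma capacity_le_energy:
  assumes f: "f \<in> borel_measurable M" and ug: "real_upper_gradient f g" and E: "\<And>x. x \<in> E \<Longrightarrow> 1 \<le> f x"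
  shows "capacity p M E \<le> energy f g"
proof (cases "energy f g = \<infinity>")
  case False
  let ?f = "\<lambda>x. ereal (f x)"
  have "N1p_normp p M UNIV ?f \<le> energy f g"
    unfolding N1p_normp_def energy_def using ug
    by (intro add_mono INF_lower2[of g]) (auto simp: epow_ennreal)
  moreover from this have "N1p p M UNIV ?f"
    using f False by (auto simp: N1p_def measurable_restrict_UNIV less_top top_unique)
  ultimately show ?thesis
    unfolding capacity_def using E by (intro INF_lower2[of ?f]) auto
qed simp

text \<open>Truncating a test function to [0, 1] keeps its upper gradients, does not increase the
  integral, and makes it real-valued.\<close>

lemma capacity_less_test:
  assumes "capacity p M E < c"
  obtains f g where "f \<in> borel_measurable M" "real_upper_gradient f g" "\<And>x. 0 \<le> f x" "\<And>x. f x \<le> 1"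
    "\<And>x. x \<in> E \<Longrightarrow> f x = 1" "energy f g < c"
proof -
  obtain w where w: "N1p p M UNIV w" "\<And>x. x \<in> E \<Longrightarrow> 1 \<le> w x" "N1p_normp p M UNIV w < c"
    using assms unfolding capacity_def INF_less_iff by auto
  obtain g where g: "upper_gradient UNIV w g"
    "(\<integral>\<^sup>+ x\<in>UNIV. epow (e2ennreal \<bar>w x\<bar>) p \<partial>M) + (\<integral>\<^sup>+ x\<in>UNIV. epow (g x) p \<partial>M) < c"
    using INF_add_lessD[OF w(3)[unfolded N1p_normp_def]] by auto
  have wm [measurable]: "w \<in> borel_measurable M" using w(1) by (simp add: N1p_def measurable_restrict_UNIV)
  define f where "f x = real_of_ereal (min 1 (max 0 (w x)))" for x
  have f01: "0 \<le> f x" "f x \<le> 1" and f1: "1 \<le> w x \<Longrightarrow> f x = 1" for x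
    by (cases "w x"; auto simp: f_def min_def max_def)+
  have fw: "ennreal \<bar>f x - f y\<bar> \<le> ug_lhs (w x) (w y)" for x y
    by (cases "w x"; cases "w y") (auto simp: ug_lhs_def f_def min_def max_def intro!: ennreal_leI)
  have "f \<in> borel_measurable M" unfolding f_def by measurable
  moreover have "real_upper_gradient f g"
  proof (rule real_upper_gradientI)
    show "g \<in> borel_measurable borel" using g(1) by (simp add: upper_gradient_def measurable_restrict_UNIV)
    fix \<gamma> :: "real \<Rightarrow> 'a" and l assume "is_curve \<gamma> l"
    then have "ug_lhs (w (\<gamma> 0)) (w (\<gamma> l)) \<le> (\<integral>\<^sup>+ t\<in>{0..l}. g (\<gamma> t) \<partial>lborel)"
      using g(1) by (auto simp: upper_gradient_def curve_in_def line_integral_def)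
    with fw show "ennreal \<bar>f (\<gamma> 0) - f (\<gamma> l)\<bar> \<le> (\<integral>\<^sup>+ t\<in>{0..l}. g (\<gamma> t) \<partial>lborel)"
      using order_trans by blast
  qed
  moreover have "energy f g < c"
  proof -
    have "ennreal (\<bar>f x\<bar> powr p) \<le> epow (e2ennreal \<bar>w x\<bar>) p" for x
    proof -
      have "ennreal \<bar>f x\<bar> \<le> e2ennreal \<bar>w x\<bar>"
        by (cases "w x") (auto simp: f_def min_def max_def intro!: ennreal_leI)
      then have "epow (ennreal \<bar>f x\<bar>) p \<le> epow (e2ennreal \<bar>w x\<bar>) p" by (rule epow_mono[OF p_pos])
      then show ?thesis by (simp add: epow_ennreal)
    qed
    then have "energy f g \<le> (\<integral>\<^sup>+ x. epow (e2ennreal \<bar>w x\<bar>) p \<partial>M) + (\<integral>\<^sup>+ x. epow (g x) p \<partial>M)"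
      unfolding energy_def by (intro add_right_mono nn_integral_mono)
    then show ?thesis using g(2) by simp
  qed
  ultimately show thesis using f01 f1[OF w(2)] by (intro that[of f g])
qed

text \<open>The supremum of test functions for the single sets tests the union and has the supremum
  of their gradients as an upper gradient. Its energy is at most the sum of the energies.\<close>

lemma capacity_UN_le:
  fixes E :: "nat \<Rightarrow> 'a set"
  assumes e: "0 \<le> e" and E: "\<And>i. capacity p M (E i) < ennreal (e * (1/2)^Suc i)"
  shows "capacity p M (\<Union>i. E i) \<le> ennreal e"
proof -
  define P where "P i f g \<longleftrightarrow> f \<in> borel_measurable M \<and> real_upper_gradient f g \<and> (\<forall>x. 0 \<le> f x) \<and> (\<forall>x. f x \<le> 1) \<and>
    (\<forall>x\<in>E i. f x = 1) \<and> energy f g < ennreal (e * (1/2)^Suc i)" for i f g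
  have "\<exists>f g. P i f g" for i
    by (rule capacity_less_test[OF E[of i]]) (unfold P_def, blast)
  then obtain f g where P: "\<And>i. P i (f i) (g i)" by metis
  have f [measurable]: "\<And>i. f i \<in> borel_measurable M" and ug: "\<And>i. real_upper_gradient (f i) (g i)"
    and f0: "\<And>i x. 0 \<le> f i x" and f1: "\<And>i x. f i x \<le> 1" and fE: "\<And>i x. x \<in> E i \<Longrightarrow> f i x = 1"
    and en: "\<And>i. energy (f i) (g i) < ennreal (e * (1/2)^Suc i)"
    using P by (auto simp: P_def)
  have gm [measurable]: "\<And>i. g i \<in> borel_measurable borel" using real_upper_gradientD(1)[OF ug] .
  define F where "F x = (SUP i. f i x)" for x
  define G where "G x = (SUP i. g i x)" for x
  have bdd: "bdd_above (range (\<lambda>i. f i x))" for x using f1 by (auto intro!: bdd_aboveI[of _ 1])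
  have fF: "f i x \<le> F x" for i x unfolding F_def using bdd by (intro cSUP_upper) auto
  have F_le: "F x \<le> c" if "\<And>i. f i x \<le> c" for x c
    unfolding F_def using that by (intro cSUP_least) auto
  have F01: "0 \<le> F x" for x using fF[of 0 x] f0[of 0 x] by linarith
  have [measurable]: "F \<in> borel_measurable M"
    unfolding F_def using bdd by (intro borel_measurable_cSUP) auto
  have [measurable]: "G \<in> borel_measurable borel" unfolding G_def by measurable
  have "real_upper_gradient F G"
  proof (rule real_upper_gradientI)
    fix \<gamma> :: "real \<Rightarrow> 'a" and l assume \<gamma>: "is_curve \<gamma> l"
    show "ennreal \<bar>F (\<gamma> 0) - F (\<gamma> l)\<bar> \<le> (\<integral>\<^sup>+ t\<in>{0..l}. G (\<gamma> t) \<partial>lborel)"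
    proof (cases "\<integral>\<^sup>+ t\<in>{0..l}. G (\<gamma> t) \<partial>lborel")
      case (real r)
      have *: "\<bar>f i (\<gamma> 0) - f i (\<gamma> l)\<bar> \<le> r" for i
      proof -
        have "ennreal \<bar>f i (\<gamma> 0) - f i (\<gamma> l)\<bar> \<le> (\<integral>\<^sup>+ t\<in>{0..l}. g i (\<gamma> t) \<partial>lborel)"
          by (rule real_upper_gradientD(2)[OF ug \<gamma>])
        also have "\<dots> \<le> ennreal r"
          unfolding real(2)[symmetric] G_def by (intro nn_integral_mono mult_right_mono SUP_upper) auto
        finally show ?thesis using real(1) by simp
      qed
      have "F (\<gamma> 0) \<le> F (\<gamma> l) + r"
      proof (rule F_le)
        fix i show "f i (\<gamma> 0) \<le> F (\<gamma> l) + r" using *[of i] fF[of i "\<gamma> l"] by linarith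
      qed
      moreover have "F (\<gamma> l) \<le> F (\<gamma> 0) + r"
      proof (rule F_le)
        fix i show "f i (\<gamma> l) \<le> F (\<gamma> 0) + r" using *[of i] fF[of i "\<gamma> 0"] by linarith
      qed
      ultimately show ?thesis using real by (auto intro!: ennreal_leI)
    qed simp
  qed measurable
  then have "capacity p M (\<Union>i. E i) \<le> energy F G"
    using fF fE by (intro capacity_le_energy) (auto, metis)
  also have "\<dots> \<le> (\<integral>\<^sup>+ x. (\<Sum>i. ennreal (\<bar>f i x\<bar> powr p)) \<partial>M) + (\<integral>\<^sup>+ x. (\<Sum>i. epow (g i x) p) \<partial>M)"
    unfolding energy_def
  proof (intro add_mono nn_integral_mono)
    fix x
    have "ennreal (F x) \<le> (SUP i. ennreal (f i x))"
    proof (cases "SUP i. ennreal (f i x)")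
      case (real s)
      have "f i x \<le> s" for i
      proof -
        have "ennreal (f i x) \<le> ennreal s" unfolding real(2)[symmetric] by (rule SUP_upper) simp
        then show ?thesis using real(1) by simp
      qed
      then show ?thesis using real F_le by (auto intro!: ennreal_leI)
    next
      case top
      then show ?thesis by (metis top_greatest)
    qed
    then have "epow (ennreal (F x)) p \<le> epow (SUP i. ennreal (f i x)) p" by (rule epow_mono[OF p_pos])
    also have "\<dots> \<le> (\<Sum>i. epow (ennreal (f i x)) p)" by (rule epow_SUP_le[OF p_pos])
    finally show "ennreal (\<bar>F x\<bar> powr p) \<le> (\<Sum>i. ennreal (\<bar>f i x\<bar> powr p))"
      using F01 f0 by (simp add: epow_ennreal)
    show "epow (G x) p \<le> (\<Sum>i. epow (g i x) p)"
      unfolding G_def by (rule epow_SUP_le[OF p_pos])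
  qed
  also have "\<dots> = (\<Sum>i. energy (f i) (g i))"
    unfolding energy_def by (subst (1 2) nn_integral_suminf) (auto intro: suminf_add)
  also have "\<dots> \<le> (\<Sum>i. ennreal (e * (1/2)^Suc i))"
    using en by (intro suminf_le) (auto intro: less_imp_le)
  also have "\<dots> = ennreal e" by (rule suminf_half_powers[OF e])
  finally show ?thesis .
qed

text \<open>The bounds \<open>e / 4\<close> and \<open>e / 8\<close> are the first two terms of the
  series \<open>e / 2 * (1/2)^Suc i\<close>; the remaining sets are empty.\<close>

lemma capacity_Un_small:
  assumes "0 < e" "capacity p M A < ennreal (e / 4)" "capacity p M B < ennreal (e / 8)"
  shows "capacity p M (A \<union> B) < ennreal e"
proof -
  define E where "E i = (if i = 0 then A else if i = 1 then B else {})" for i :: nat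
  have "capacity p M {} \<le> energy (\<lambda>_. 0) (\<lambda>_. 0)"
    by (intro capacity_le_energy real_upper_gradientI) auto
  then have c0: "capacity p M {} = 0" using p_pos by (simp add: energy_def)
  have "capacity p M (E i) < ennreal (e / 2 * (1/2)^Suc i)" for i
    using assms c0 by (auto simp: E_def)
  then have "capacity p M (\<Union>i. E i) \<le> ennreal (e / 2)"
    using assms(1) by (intro capacity_UN_le) auto
  moreover have "(\<Union>i. E i) = A \<union> B"
    unfolding E_def by (auto split: if_splits)
  ultimately show ?thesis using assms(1) by (auto simp: ennreal_less_iff intro: le_less_trans)
qed

lemma lsc_add_real:
  fixes h h' :: "'b::topological_space \<Rightarrow> real"
  assumes "\<And>a. open {x. a < h x}" "\<And>a. open {x. a < h' x}"
  shows "open {x. a < h x + h' x}"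
proof -
  have "{x. a < h x + h' x} = (\<Union>q. {x. q < h x} \<inter> {x. a - q < h' x})"
  proof (intro equalityI subsetI)
    fix x assume "x \<in> {x. a < h x + h' x}"
    then have "a - h' x < h x" by simp
    then obtain q where "a - h' x < q" "q < h x" using dense by blast
    then show "x \<in> (\<Union>q. {x. q < h x} \<inter> {x. a - q < h' x})" by auto
  qed auto
  then show ?thesis using assms by (auto intro!: open_UN open_Int)
qed

text \<open>Majorants \<open>h j\<close> of w and \<open>h' j\<close> of \<open>b - w\<close> trap w
  between \<open>b - h' j\<close> and \<open>h j\<close>. The gap \<open>\<phi> j\<close> is small
  in energy, and it is lower semicontinuous, being a sum of two majorants minus a constant; so the
  set where it exceeds \<open>(1/2)^j\<close> is open and has small capacity. Off the union of these
  sets w is a uniform limit from both sides, which yields continuity.\<close>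

lemma bounded_quasicontinuous:
  fixes w :: "'a \<Rightarrow> real"
  assumes wm [measurable]: "w \<in> borel_measurable M" and w: "\<And>x. 0 \<le> w x" "\<And>x. w x \<le> b"
    and ug: "real_upper_gradient w g" and int: "(\<integral>\<^sup>+ x. epow (g x) p \<partial>M) < \<infinity>" and e: "0 < (e::real)"
  shows "\<exists>G. open G \<and> capacity p M G < ennreal e \<and> continuous_on (- G) w"
proof -
  define v where "v x = b - w x" for x
  have vm [measurable]: "v \<in> borel_measurable M" unfolding v_def by measurable
  have v: "\<And>x. 0 \<le> v x" "\<And>x. v x \<le> b" using w by (auto simp: v_def)
  have ugv: "real_upper_gradient v g"
    using ug by (auto simp: upper_gradient_def v_def abs_minus_commute)
  \<comment> \<open>Testing \<open>D j\<close> with \<open>2^j * \<phi> j\<close> costs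
    \<open>(2^j) powr p\<close>, and splitting the gap into its two summands costs
    \<open>2 powr p\<close>. The numbers \<open>d j\<close> are chosen to pay for both.\<close>
  define C where "C j = (2^j) powr p * 2 powr p" for j :: nat
  have C: "0 < C j" for j by (simp add: C_def)
  define d where "d j = e / 8 * (1/2)^Suc j / C j" for j
  have d: "0 < d j" for j using e C by (simp add: d_def)
  define P where "P w j h \<rho> \<longleftrightarrow> (\<forall>a. open {x. a < h x}) \<and> (\<forall>x. w x \<le> h x) \<and> real_upper_gradient (\<lambda>x. h x - w x) \<rho> \<and>
      energy (\<lambda>x. h x - w x) \<rho> < ennreal (d j)" for w j and h :: "'a \<Rightarrow> real" and \<rho>
  have "\<exists>h \<rho>. P w j h \<rho>" for j
    by (rule lsc_majorant[OF wm w ug int d[of j]]) (unfold P_def, blast)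
  then obtain h \<rho> where h: "\<And>j. P w j (h j) (\<rho> j)" by metis
  have "\<exists>h \<rho>. P v j h \<rho>" for j
    by (rule lsc_majorant[OF vm v ugv int d[of j]]) (unfold P_def, blast)
  then obtain h' \<rho>' where h': "\<And>j. P v j (h' j) (\<rho>' j)" by metis
  define \<phi> where "\<phi> j x = (h j x - w x) + (h' j x - v x)" for j x
  have \<phi>: "\<phi> j x = h j x + h' j x - b" for j x by (simp add: \<phi>_def v_def)
  define D where "D j = {x. (1/2)^j < \<phi> j x}" for j
  have lsch: "open {x. a < h j x}" "open {x. a < h' j x}" for a j
    using h[of j] h'[of j] by (auto simp: P_def)
  have oD: "open (D j)" for j
  proof -
    have "D j = {x. (1/2)^j + b < h j x + h' j x}" by (auto simp: D_def \<phi>)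
    then show ?thesis using lsc_add_real[OF lsch] by simp
  qed
  have cap: "capacity p M (D j) < ennreal (e / 2 * (1/2)^Suc j)" for j
  proof -
    have [measurable]: "h j \<in> borel_measurable borel" "h' j \<in> borel_measurable borel"
      using lsch by (auto intro!: lsc_borel_measurable)
    have u: "real_upper_gradient (\<lambda>x. h j x - w x) (\<rho> j)" "real_upper_gradient (\<lambda>x. h' j x - v x) (\<rho>' j)"
      using h[of j] h'[of j] by (auto simp: P_def)
    note [measurable] = real_upper_gradientD(1)[OF u(1)] real_upper_gradientD(1)[OF u(2)]
    have \<phi>m [measurable]: "\<phi> j \<in> borel_measurable M" unfolding \<phi>_def by measurable
    have "real_upper_gradient (\<phi> j) (\<lambda>x. \<rho> j x + \<rho>' j x)"
      unfolding \<phi>_def by (rule real_upper_gradient_add[OF u])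
    then have "real_upper_gradient (\<lambda>x. 2^j * \<phi> j x) (\<lambda>x. ennreal (2^j) * (\<rho> j x + \<rho>' j x))"
      by (rule real_upper_gradient_cmult) simp
    then have "capacity p M (D j) \<le> energy (\<lambda>x. 2^j * \<phi> j x) (\<lambda>x. ennreal (2^j) * (\<rho> j x + \<rho>' j x))"
      by (rule capacity_le_energy[rotated]) (auto simp: D_def power_one_over field_simps)
    also have "\<dots> = ennreal ((2^j) powr p) * energy (\<phi> j) (\<lambda>x. \<rho> j x + \<rho>' j x)"
      by (rule energy_cmult) auto
    also have "\<dots> \<le> ennreal ((2^j) powr p) * (ennreal (2 powr p) * (energy (\<lambda>x. h j x - w x) (\<rho> j) + energy (\<lambda>x. h' j x - v x) (\<rho>' j)))"
      unfolding \<phi>_def by (intro mult_left_mono energy_add_le) auto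
    also have "\<dots> \<le> ennreal ((2^j) powr p) * (ennreal (2 powr p) * (ennreal (d j) + ennreal (d j)))"
      using h[of j] h'[of j] by (intro mult_left_mono add_mono) (auto simp: P_def intro: less_imp_le)
    also have "\<dots> = ennreal (C j * (2 * d j))"
      using d[of j] by (simp add: C_def ennreal_mult[symmetric] ennreal_plus[symmetric] mult.assoc del: ennreal_plus)
    also have "C j * (2 * d j) = e / 4 * (1/2)^Suc j"
      using C[of j] by (simp add: d_def)
    also have "ennreal (e / 4 * (1/2)^Suc j) < ennreal (e / 2 * (1/2)^Suc j)"
      using e by (subst ennreal_less_iff) auto
    finally show ?thesis .
  qed
  define G where "G = (\<Union>j. D j)"
  have "open G" using oD by (auto simp: G_def)
  moreover have "capacity p M G < ennreal e"
  proof -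
    have "capacity p M G \<le> ennreal (e / 2)"
      unfolding G_def using e cap by (intro capacity_UN_le) auto
    then show ?thesis using e by (auto simp: ennreal_less_iff intro: le_less_trans)
  qed
  moreover have "continuous_on (- G) w"
    unfolding continuous_on_eq_continuous_within continuous_within tendsto_iff
  proof (intro ballI allI impI)
    fix x and r :: real assume x: "x \<in> - G" and r: "0 < r"
    \<comment> \<open>Half of r pays for the gap, half for semicontinuity at x: the bound for
      \<open>h j\<close> keeps \<open>w y\<close> from falling below \<open>w x - r\<close>, the one
      for \<open>h' j\<close> from rising above \<open>w x + r\<close>.\<close>
    obtain j where j: "(1/2)^j < r / 2"
      using real_arch_pow_inv[of "r / 2" "1/2"] r by auto
    have "\<forall>\<^sub>F y in at x within - G. y \<in> {y. h j x - r / 2 < h j y} \<inter> {y. h' j x - r / 2 < h' j y}"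
      unfolding eventually_at_topological
      using lsch(1)[of "h j x - r / 2" j] lsch(2)[of "h' j x - r / 2" j] r
      by (intro exI[of _ "{y. h j x - r / 2 < h j y} \<inter> {y. h' j x - r / 2 < h' j y}"]) auto
    moreover have "\<forall>\<^sub>F y in at x within - G. y \<in> - G"
      by (simp add: eventually_at_filter)
    ultimately show "\<forall>\<^sub>F y in at x within - G. dist (w y) (w x) < r"
    proof eventually_elim
      case (elim y)
      have ge: "w z \<le> h j z" "b - w z \<le> h' j z" for z
        using h[of j] h'[of j] by (auto simp: P_def v_def)
      have "h j y + h' j y - b \<le> (1/2)^j"
        using elim(2) by (auto simp: G_def D_def \<phi> not_less)
      then show ?case
        using ge[of x] ge[of y] elim(1) j by (auto simp: dist_real_def)
    qed
  qed
  ultimately show ?thesis by blast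
qed

text \<open>Outer regularity of capacity: with h a majorant of w, the set where
  \<open>1/2 < h x\<close> is open and contains all points with \<open>1 \<le> w x\<close>. It is
  tested by \<open>2 * h\<close>, written as twice the sum of \<open>h - w\<close> and w; one factor
  \<open>2 powr p\<close> comes from the doubling, the other from the sum.\<close>

lemma superlevel_open_capacity:
  fixes w :: "'a \<Rightarrow> real"
  assumes wm [measurable]: "w \<in> borel_measurable M" and w: "\<And>x. 0 \<le> w x" "\<And>x. w x \<le> b"
    and ug: "real_upper_gradient w g" and en: "energy w g < ennreal c" and c: "0 < c"
  shows "\<exists>G. open G \<and> {x. 1 \<le> w x} \<subseteq> G \<and> capacity p M G \<le> ennreal (2 powr p * 2 powr p * (2 * c))"
proof -
  have "(\<integral>\<^sup>+ x. epow (g x) p \<partial>M) \<le> energy w g" by (simp add: energy_def)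
  also have "\<dots> < \<infinity>" using en less_top by fastforce
  finally have int: "(\<integral>\<^sup>+ x. epow (g x) p \<partial>M) < \<infinity>" .
  obtain h \<rho> where h: "\<And>a. open {x. a < h x}" "\<And>x. w x \<le> h x" "\<And>x. h x \<le> b"
    "real_upper_gradient (\<lambda>x. h x - w x) \<rho>" "energy (\<lambda>x. h x - w x) \<rho> < ennreal c"
    by (rule lsc_majorant[OF wm w ug int c]) (rule that)
  have [measurable]: "h \<in> borel_measurable borel" using h(1) by (rule lsc_borel_measurable)
  note [measurable] = real_upper_gradientD(1)[OF ug] real_upper_gradientD(1)[OF h(4)]
  define G where "G = {x. 1/2 < h x}"
  have "real_upper_gradient (\<lambda>x. 2 * ((h x - w x) + w x)) (\<lambda>x. ennreal 2 * (\<rho> x + g x))"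
    by (intro real_upper_gradient_cmult real_upper_gradient_add h(4) ug) simp
  then have "capacity p M G \<le> energy (\<lambda>x. 2 * ((h x - w x) + w x)) (\<lambda>x. ennreal 2 * (\<rho> x + g x))"
    by (rule capacity_le_energy[rotated]) (auto simp: G_def)
  also have "\<dots> = ennreal (2 powr p) * energy (\<lambda>x. (h x - w x) + w x) (\<lambda>x. \<rho> x + g x)"
    by (rule energy_cmult) auto
  also have "\<dots> \<le> ennreal (2 powr p) * (ennreal (2 powr p) * (energy (\<lambda>x. h x - w x) \<rho> + energy w g))"
    by (intro mult_left_mono energy_add_le) auto
  also have "\<dots> \<le> ennreal (2 powr p) * (ennreal (2 powr p) * (ennreal c + ennreal c))"
    using h(5) en by (intro mult_left_mono add_mono) (auto intro: less_imp_le)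
  also have "\<dots> = ennreal (2 powr p * 2 powr p * (2 * c))"
    using c by (simp add: ennreal_mult[symmetric] ennreal_plus[symmetric] mult.assoc del: ennreal_plus)
  finally have "capacity p M G \<le> ennreal (2 powr p * 2 powr p * (2 * c))" .
  moreover have "open G" unfolding G_def by (rule h(1))
  moreover have "{x. 1 \<le> w x} \<subseteq> G"
  proof
    fix x assume "x \<in> {x. 1 \<le> w x}"
    then show "x \<in> G" using h(2)[of x] by (simp add: G_def)
  qed
  ultimately show ?thesis by blast
qed

end

subsection \<open>Extension of functions from quasiopen sets\<close>

text \<open>Truncate h at a height n such that the part above n has integral below
  \<open>e / 2\<close>; the truncated part contributes at most n times the measure of A.\<close>

lemma nn_integral_absolutely_continuous:
  fixes h :: "real \<Rightarrow> ennreal"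
  assumes h [measurable]: "h \<in> borel_measurable borel" and fin: "(\<integral>\<^sup>+ t. h t \<partial>lborel) < \<infinity>" and e: "0 < (e::real)"
  obtains d :: real where "0 < d" "\<And>A. A \<in> sets lborel \<Longrightarrow> emeasure lborel A < ennreal d \<Longrightarrow> (\<integral>\<^sup>+ t\<in>A. h t \<partial>lborel) < ennreal e"
proof -
  let ?m = "\<lambda>n t. min (h t) (of_nat n)"
  have mono: "incseq ?m"
    by (auto simp: incseq_def le_fun_def intro: min.coboundedI2)
  have "(SUP n. ?m n t) = h t" for t
  proof (cases "h t")
    case (real r)
    obtain n where "r \<le> real n" using real_arch_simple by blast
    then have "h t \<le> ?m n t" using real by (simp add: ennreal_of_nat_eq_real_of_nat ennreal_leI)
    then show ?thesis by (intro antisym SUP_least SUP_upper2[of n]) auto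
  next
    case top
    then show ?thesis by (simp add: ennreal_SUP_of_nat_eq_top)
  qed
  then have "(\<integral>\<^sup>+ t. h t \<partial>lborel) = (SUP n. \<integral>\<^sup>+ t. ?m n t \<partial>lborel)"
    using nn_integral_monotone_convergence_SUP[OF mono, of lborel] by simp
  moreover obtain I where I: "(\<integral>\<^sup>+ t. h t \<partial>lborel) = ennreal I" "0 \<le> I"
    using fin by (cases "\<integral>\<^sup>+ t. h t \<partial>lborel") auto
  ultimately have sup: "(SUP n. \<integral>\<^sup>+ t. ?m n t \<partial>lborel) = ennreal I" by simp
  have "\<exists>n. (\<integral>\<^sup>+ t. h t \<partial>lborel) < (\<integral>\<^sup>+ t. ?m n t \<partial>lborel) + ennreal (e / 2)"
  proof (rule ccontr)
    assume "\<not> ?thesis"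
    then have "(SUP n. (\<integral>\<^sup>+ t. ?m n t \<partial>lborel) + ennreal (e / 2)) \<le> ennreal I"
      by (intro SUP_least) (simp add: I not_less)
    then have "ennreal I + ennreal (e / 2) \<le> ennreal I"
      using sup by (simp add: ennreal_SUP_add_left)
    then show False using e I(2) by (simp flip: ennreal_plus)
  qed
  then obtain n where n: "(\<integral>\<^sup>+ t. h t \<partial>lborel) < (\<integral>\<^sup>+ t. ?m n t \<partial>lborel) + ennreal (e / 2)" by blast
  have split: "(\<integral>\<^sup>+ t. h t \<partial>lborel) = (\<integral>\<^sup>+ t. ?m n t \<partial>lborel) + (\<integral>\<^sup>+ t. h t - ?m n t \<partial>lborel)"
    by (subst nn_integral_add[symmetric]) (auto intro!: nn_integral_cong simp: add_diff_inverse_ennreal)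
  have "(\<integral>\<^sup>+ t. ?m n t \<partial>lborel) \<le> ennreal I"
    unfolding I(1)[symmetric] by (intro nn_integral_mono) auto
  then have "(\<integral>\<^sup>+ t. ?m n t \<partial>lborel) \<noteq> top" by (auto simp: top_unique)
  then have rest: "(\<integral>\<^sup>+ t. h t - ?m n t \<partial>lborel) < ennreal (e / 2)"
    using n unfolding split by (simp add: ennreal_add_left_cancel_less)
  show thesis
  proof (rule that)
    show "0 < e / (2 * real (Suc n))" using e by simp
    fix A :: "real set" assume A [measurable]: "A \<in> sets lborel" and small: "emeasure lborel A < ennreal (e / (2 * real (Suc n)))"
    have "(\<integral>\<^sup>+ t\<in>A. h t \<partial>lborel) \<le> (\<integral>\<^sup>+ t. of_nat n * indicator A t + (h t - ?m n t) \<partial>lborel)"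
    proof (rule nn_integral_mono)
      fix t
      have "h t = ?m n t + (h t - ?m n t)" by (simp add: add_diff_inverse_ennreal)
      also have "\<dots> \<le> of_nat n + (h t - ?m n t)" by (intro add_right_mono) simp
      finally show "h t * indicator A t \<le> of_nat n * indicator A t + (h t - ?m n t)"
        by (simp add: indicator_def)
    qed
    also have "\<dots> = of_nat n * emeasure lborel A + (\<integral>\<^sup>+ t. h t - ?m n t \<partial>lborel)"
      by (subst nn_integral_add) (simp_all only: nn_integral_cmult_indicator[OF A], measurable)
    also have "\<dots> \<le> ennreal (e / 2) + (\<integral>\<^sup>+ t. h t - ?m n t \<partial>lborel)"
    proof (rule add_right_mono)
      have "of_nat n * emeasure lborel A \<le> of_nat n * ennreal (e / (2 * real (Suc n)))"
        using small by (intro mult_left_mono) auto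
      also have "\<dots> = ennreal (real n * (e / (2 * real (Suc n))))"
        using e unfolding ennreal_of_nat_eq_real_of_nat by (intro ennreal_mult[symmetric]) auto
      also have "\<dots> \<le> ennreal (e / 2)"
        using e by (intro ennreal_leI) (simp add: field_simps)
      finally show "of_nat n * emeasure lborel A \<le> ennreal (e / 2)" .
    qed
    also have "\<dots> < ennreal (e / 2) + ennreal (e / 2)"
      using rest by (simp add: ennreal_add_left_cancel_less)
    also have "\<dots> = ennreal e" using e by (simp flip: ennreal_plus)
    finally show "(\<integral>\<^sup>+ t\<in>A. h t \<partial>lborel) < ennreal e" .
  qed
qed

text \<open>Each set where g exceeds a rational is the trace on U of a Borel set of the whole space.
  The supremum of rationals times indicators of these Borel sets recovers g on U, even if U itself
  is not Borel.\<close>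

lemma borel_measurable_restrict_extension:
  fixes g :: "'a::topological_space \<Rightarrow> ennreal"
  assumes g: "g \<in> borel_measurable (restrict_space borel U)"
  obtains g' where "g' \<in> borel_measurable borel" "\<And>x. x \<in> U \<Longrightarrow> g' x = g x"
proof -
  let ?r = "\<lambda>q::rat. ennreal (real_of_rat q)"
  have "\<exists>A\<in>sets borel. A \<inter> U = {x\<in>U. ?r q < g x}" for q
  proof -
    have "g -` {?r q<..} \<inter> space (restrict_space borel U) \<in> sets (restrict_space borel U)"
      using g by (rule measurable_sets) auto
    then obtain A where "A \<in> sets borel" "g -` {?r q<..} \<inter> U = U \<inter> A"
      by (auto simp: sets_restrict_space space_restrict_space)
    then show ?thesis by (intro bexI[of _ A]) auto
  qed
  then obtain A where A: "\<And>q. A q \<in> sets borel" "\<And>q. A q \<inter> U = {x\<in>U. ?r q < g x}" by metis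
  note [measurable] = A(1)
  define g' where "g' x = (SUP q. ?r q * indicator (A q) x)" for x
  have "g' \<in> borel_measurable borel" unfolding g'_def by measurable
  moreover have "g' x = g x" if "x \<in> U" for x
  proof (rule antisym)
    show "g' x \<le> g x"
      unfolding g'_def using A(2) that by (intro SUP_least) (auto simp: indicator_def intro: less_imp_le)
    show "g x \<le> g' x"
    proof (rule dense_le)
      fix y assume "y < g x"
      then obtain q where q: "y < ?r q" "?r q < g x" using ennreal_rat_dense by blast
      then have "x \<in> A q" using A(2)[of q] that by blast
      have "y \<le> ?r q * indicator (A q) x" using q \<open>x \<in> A q\<close> by simp
      also have "\<dots> \<le> g' x" unfolding g'_def by (rule SUP_upper) simp
      finally show "y \<le> g' x" .
    qed
  qed
  ultimately show thesis by (rule that)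
qed

lemma real_upper_gradient_lipschitz_one:
  fixes f :: "'a::metric_space \<Rightarrow> real"
  assumes "\<And>x y. \<bar>f x - f y\<bar> \<le> dist x y"
  shows "real_upper_gradient f (\<lambda>_. 1)"
proof (rule real_upper_gradientI)
  fix \<gamma> :: "real \<Rightarrow> 'a" and l assume \<gamma>: "is_curve \<gamma> l"
  then have l: "0 < l" by (simp add: is_curve_def)
  have "\<bar>f (\<gamma> 0) - f (\<gamma> l)\<bar> \<le> l"
    using assms[of "\<gamma> 0" "\<gamma> l"] lipschitz_onD[OF is_curve_lipschitz[OF \<gamma>], of 0 l] l by (simp add: dist_real_def)
  then show "ennreal \<bar>f (\<gamma> 0) - f (\<gamma> l)\<bar> \<le> (\<integral>\<^sup>+ t\<in>{0..l}. 1 \<partial>lborel)"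
    using l by (simp add: ennreal_leI)
qed simp

lemma real_upper_gradient_min:
  fixes f f' :: "'a::metric_space \<Rightarrow> real"
  assumes f: "real_upper_gradient f g" and f': "real_upper_gradient f' g'"
  shows "real_upper_gradient (\<lambda>x. min (f x) (f' x)) (\<lambda>x. g x + g' x)"
proof (rule real_upper_gradientI)
  note gm [measurable] = real_upper_gradientD(1)[OF f] real_upper_gradientD(1)[OF f']
  show "(\<lambda>x. g x + g' x) \<in> borel_measurable borel" by measurable
  fix \<gamma> :: "real \<Rightarrow> 'a" and l assume \<gamma>: "is_curve \<gamma> l"
  have "ennreal \<bar>min (f (\<gamma> 0)) (f' (\<gamma> 0)) - min (f (\<gamma> l)) (f' (\<gamma> l))\<bar> \<le> ennreal \<bar>f (\<gamma> 0) - f (\<gamma> l)\<bar> + ennreal \<bar>f' (\<gamma> 0) - f' (\<gamma> l)\<bar>"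
    by (auto simp flip: ennreal_plus intro!: ennreal_leI)
  also have "\<dots> \<le> (\<integral>\<^sup>+ t\<in>{0..l}. g (\<gamma> t) \<partial>lborel) + (\<integral>\<^sup>+ t\<in>{0..l}. g' (\<gamma> t) \<partial>lborel)"
    by (intro add_mono real_upper_gradientD(2)[OF _ \<gamma>] f f')
  also have "\<dots> = (\<integral>\<^sup>+ t\<in>{0..l}. g (\<gamma> t) + g' (\<gamma> t) \<partial>lborel)"
    using curve_measurable[OF \<gamma> gm(1), of 0 l] curve_measurable[OF \<gamma> gm(2), of 0 l]
    by (subst nn_integral_add[symmetric]) (auto intro!: nn_integral_cong simp: indicator_def)
  finally show "ennreal \<bar>min (f (\<gamma> 0)) (f' (\<gamma> 0)) - min (f (\<gamma> l)) (f' (\<gamma> l))\<bar> \<le> (\<integral>\<^sup>+ t\<in>{0..l}. g (\<gamma> t) + g' (\<gamma> t) \<partial>lborel)" .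
qed

text \<open>Suppose the integral were finite. Then \<open>\<eta>\<close> is continuous along the
  curve, hence positive near the time z, and the curve stays in U on a short interval about z. There
  the upper gradient inequality has an infinite left side, so the integral of g is infinite after
  all.\<close>

lemma infinite_value_line_integral:
  fixes v :: "'a::metric_space \<Rightarrow> ereal" and \<eta> :: "'a \<Rightarrow> real"
  assumes ug: "upper_gradient U v g" and ug\<eta>: "real_upper_gradient \<eta> g\<eta>" and U: "\<And>x. 0 < \<eta> x \<Longrightarrow> x \<in> U"
    and g': "g' \<in> borel_measurable borel" "\<And>x. x \<in> U \<Longrightarrow> g' x = g x"
    and \<gamma>: "is_curve \<gamma> l" and z: "z \<in> {0..l}" "0 < \<eta> (\<gamma> z)" "\<bar>v (\<gamma> z)\<bar> = \<infinity>"
  shows "(\<integral>\<^sup>+ t\<in>{0..l}. (g' (\<gamma> t) + g\<eta> (\<gamma> t)) \<partial>lborel) = \<infinity>"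
proof (rule ccontr)
  assume "\<not> ?thesis"
  then have fin: "(\<integral>\<^sup>+ t\<in>{0..l}. (g' (\<gamma> t) + g\<eta> (\<gamma> t)) \<partial>lborel) < \<infinity>" by (simp add: less_top)
  note gm = real_upper_gradientD(1)[OF ug\<eta>]
  have l: "0 < l" using \<gamma> by (simp add: is_curve_def)
  have "(\<integral>\<^sup>+ t. g\<eta> (\<gamma> t) * indicator {0..l} t \<partial>lborel) \<le> (\<integral>\<^sup>+ t\<in>{0..l}. (g' (\<gamma> t) + g\<eta> (\<gamma> t)) \<partial>lborel)"
    by (intro nn_integral_mono mult_right_mono) auto
  with fin have fin\<eta>: "(\<integral>\<^sup>+ t. g\<eta> (\<gamma> t) * indicator {0..l} t \<partial>lborel) < \<infinity>" by (rule le_less_trans[rotated])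
  obtain d where d: "0 < d" "\<And>A. A \<in> sets lborel \<Longrightarrow> emeasure lborel A < ennreal d \<Longrightarrow> (\<integral>\<^sup>+ t\<in>A. g\<eta> (\<gamma> t) * indicator {0..l} t \<partial>lborel) < ennreal (\<eta> (\<gamma> z))"
    using nn_integral_absolutely_continuous[OF curve_measurable[OF \<gamma> gm, of 0 l] fin\<eta> z(2)] by auto
  have close: "\<bar>\<eta> (\<gamma> a) - \<eta> (\<gamma> b)\<bar> < \<eta> (\<gamma> z)" if "0 \<le> a" "a \<le> b" "b \<le> l" "b - a < d" for a b
  proof -
    have "ennreal \<bar>\<eta> (\<gamma> a) - \<eta> (\<gamma> b)\<bar> \<le> (\<integral>\<^sup>+ t\<in>{a..b}. g\<eta> (\<gamma> t) \<partial>lborel)"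
      using that by (intro real_upper_gradient_subcurve[OF ug\<eta> \<gamma>]) auto
    also have "\<dots> = (\<integral>\<^sup>+ t\<in>{a..b}. g\<eta> (\<gamma> t) * indicator {0..l} t \<partial>lborel)"
      using that by (intro nn_integral_cong) (auto simp: indicator_def)
    also have "\<dots> < ennreal (\<eta> (\<gamma> z))"
      using that by (intro d) (auto simp: ennreal_less_iff)
    finally show ?thesis by (simp add: ennreal_less_iff)
  qed
  \<comment> \<open>The time z may be an endpoint of the curve, so only one of \<open>a < z\<close>
    and \<open>z < b\<close> is guaranteed; one nondegenerate side suffices.\<close>
  define a where "a = max 0 (z - min d l / 2)"
  define b where "b = min l (z + min d l / 2)"
  have ab: "0 \<le> a" "a \<le> z" "z \<le> b" "b \<le> l" "z - a < d" "b - z < d" "a < z \<or> z < b"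
    using z(1) d(1) l by (auto simp: a_def b_def min_def max_def)
  have "\<gamma> t \<in> U" if "t \<in> {a..b}" for t
  proof (rule U)
    show "0 < \<eta> (\<gamma> t)"
      using close[of t z] close[of z t] that ab z(2) by (cases "t \<le> z") auto
  qed
  then have sub: "\<gamma> ` {a..b} \<subseteq> U" by auto
  have inf: "(\<integral>\<^sup>+ t\<in>{a'..b'}. g (\<gamma> t) \<partial>lborel) = \<infinity>" if "a \<le> a'" "a' < b'" "b' \<le> b" "a' = z \<or> b' = z" for a' b'
  proof -
    have "ug_lhs (v (\<gamma> a')) (v (\<gamma> b')) \<le> (\<integral>\<^sup>+ t\<in>{a'..b'}. g (\<gamma> t) \<partial>lborel)"
      using that ab sub by (intro upper_gradient_subcurve[OF ug \<gamma>]) auto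
    then show ?thesis using that z(3) by (auto simp: ug_lhs_def top_unique)
  qed
  have "(\<integral>\<^sup>+ t\<in>{a'..b'}. g (\<gamma> t) \<partial>lborel) \<le> (\<integral>\<^sup>+ t\<in>{0..l}. (g' (\<gamma> t) + g\<eta> (\<gamma> t)) \<partial>lborel)" if "a \<le> a'" "b' \<le> b" for a' b'
    using sub that ab g'(2) by (intro nn_integral_mono) (auto simp: indicator_def image_subset_iff)
  with inf ab(7) fin show False
    using ab(2,3) by (metis infinity_ennreal_def leD order_refl)
qed

section \<open>Truncations, cutoffs and infinite values\<close>

context newtonian_space begin

lemma emeasure_le_capacity:
  assumes "E \<in> sets M"
  shows "emeasure M E \<le> capacity p M E"
proof (rule ccontr)
  assume "\<not> ?thesis"
  then have "capacity p M E < emeasure M E" by simp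
  then obtain f g where f: "\<And>x. x \<in> E \<Longrightarrow> f x = 1" "energy f g < emeasure M E"
    by (rule capacity_less_test) (rule that)
  have "emeasure M E = (\<integral>\<^sup>+ x. indicator E x \<partial>M)" using assms by simp
  also have "\<dots> \<le> (\<integral>\<^sup>+ x. ennreal (\<bar>f x\<bar> powr p) \<partial>M)"
    by (intro nn_integral_mono) (auto simp: indicator_def f(1))
  also have "\<dots> \<le> energy f g" by (simp add: energy_def)
  finally show False using f(2) by simp
qed

text \<open>The set U differs from a countable intersection of open sets
  \<open>U \<union> G n\<close> only by a subset of the intersection of the \<open>G n\<close>. That
  intersection is null because capacity dominates measure, and completeness makes its subsets
  measurable.\<close>

lemma quasiopen_sets:
  assumes "quasiopen p M U"
  shows "U \<in> sets M"
proof -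
  have "\<exists>G. open G \<and> capacity p M G < ennreal (1 / real (Suc n)) \<and> open (U \<union> G)" for n
    using assms unfolding quasiopen_def by simp
  then obtain G where G: "\<And>n. open (G n)" "\<And>n. capacity p M (G n) < ennreal (1 / real (Suc n))" "\<And>n. open (U \<union> G n)"
    by metis
  define N where "N = (\<Inter>n. G n)"
  have NM [measurable]: "N \<in> sets M" unfolding N_def using G(1) by (intro sets.countable_INT) auto
  have "emeasure M N \<le> ennreal (1 / real (Suc n))" for n
  proof -
    have "emeasure M N \<le> emeasure M (G n)"
      using G(1) by (intro emeasure_mono) (auto simp: N_def)
    also have "\<dots> \<le> capacity p M (G n)" using G(1) by (intro emeasure_le_capacity) auto
    finally show ?thesis using G(2)[of n] by simp
  qed
  moreover have "(\<lambda>n. ennreal (1 / real (Suc n))) \<longlonglongrightarrow> ennreal 0"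
    by (intro tendsto_ennrealI LIMSEQ_Suc[OF lim_const_over_n])
  ultimately have "emeasure M N \<le> ennreal 0"
    by (intro tendsto_lowerbound[of "\<lambda>n. ennreal (1 / real (Suc n))"]) auto
  then have "N \<in> null_sets M" by (simp add: null_sets_def)
  then have "N - U \<in> sets M" using null_subset[of N "N - U"] by auto
  moreover have "U = (\<Inter>n. U \<union> G n) - (N - U)" by (auto simp: N_def)
  moreover have "(\<Inter>n. U \<union> G n) \<in> sets M" using G(3) by (intro sets.countable_INT) auto
  ultimately show ?thesis by (metis sets.Diff)
qed

text \<open>Extension by zero outside U might not be Borel, so the extension is cut off by a Borel
  hull of U instead. The hull exceeds U by a null set and leaves the integral unchanged.\<close>

lemma gradient_extension:
  assumes U: "U \<in> sets M" and g: "g \<in> borel_measurable (restrict_space borel U)"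
  obtains g' where "g' \<in> borel_measurable borel" "\<And>x. x \<in> U \<Longrightarrow> g' x = g x"
    "(\<integral>\<^sup>+ x. epow (g' x) p \<partial>M) = (\<integral>\<^sup>+ x\<in>U. epow (g x) p \<partial>M)"
proof -
  obtain h where h [measurable]: "h \<in> borel_measurable borel" and hg: "\<And>x. x \<in> U \<Longrightarrow> h x = g x"
    by (rule borel_measurable_restrict_extension[OF g]) (rule that)
  obtain B where B: "B \<in> sets borel" "U \<subseteq> B" "B - U \<in> null_sets M"
    using sets_M_sandwich[OF U] .
  note [measurable] = B(1)
  have "(\<integral>\<^sup>+ x. epow (h x * indicator B x) p \<partial>M) = (\<integral>\<^sup>+ x\<in>U. epow (g x) p \<partial>M)"
  proof (rule nn_integral_cong_AE, use AE_not_in[OF B(3)] in eventually_elim)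
    fix x assume "x \<notin> B - U"
    then show "epow (h x * indicator B x) p = epow (g x) p * indicator U x"
      using B(2) hg by (auto simp: indicator_def)
  qed
  then show thesis
    using B(2) hg by (intro that[of "\<lambda>x. h x * indicator B x"]) auto
qed

text \<open>Along a curve inside U the truncation changes by at most the change of v plus that of
  \<open>\<eta>\<close>. A curve that leaves U passes through a zero of \<open>\<eta>\<close>, and
  then \<open>0 \<le> f \<le> \<eta>\<close> bounds the difference of the end values by the
  variation of \<open>\<eta>\<close> before and after that time. No information on v outside U is
  required.\<close>

lemma truncated_extension:
  fixes v :: "'a \<Rightarrow> ereal" and \<eta> :: "'a \<Rightarrow> real"
  assumes U [measurable]: "U \<in> sets M" and v: "v \<in> borel_measurable (restrict_space M U)"
    and ug: "upper_gradient U v g"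
    and g': "g' \<in> borel_measurable borel" "\<And>x. x \<in> U \<Longrightarrow> g' x = g x"
    and \<eta>m [measurable]: "\<eta> \<in> borel_measurable M" and ug\<eta>: "real_upper_gradient \<eta> g\<eta>"
    and \<eta>: "\<And>x. 0 \<le> \<eta> x" "\<And>x. x \<notin> U \<Longrightarrow> \<eta> x = 0"
    and f: "\<And>x. f x = (if x \<in> U then real_of_ereal (min (max 0 (v x)) (ereal (\<eta> x))) else 0)"
  shows "f \<in> borel_measurable M" "real_upper_gradient f (\<lambda>x. g' x + g\<eta> x)" "\<And>x. 0 \<le> f x" "\<And>x. f x \<le> \<eta> x"
proof -
  note [measurable] = v measurable_restrict_space1[OF \<eta>m, of U]
  have "(\<lambda>x. real_of_ereal (min (max 0 (v x)) (ereal (\<eta> x)))) \<in> borel_measurable (restrict_space M U)"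
    by measurable
  then have "(\<lambda>x. if x \<in> U then real_of_ereal (min (max 0 (v x)) (ereal (\<eta> x))) else 0) \<in> borel_measurable M"
    by (subst measurable_If_restrict_space_iff) (auto simp: U)
  then show "f \<in> borel_measurable M" using f by (simp add: ext[OF f])
  show f0: "0 \<le> f x" for x
    using \<eta>(1)[of x] by (cases "v x") (auto simp: f min_def max_def)
  show f\<eta>: "f x \<le> \<eta> x" for x
    using \<eta>(1)[of x] by (cases "v x") (auto simp: f min_def max_def)
  note gm = real_upper_gradientD(1)[OF ug\<eta>]
  show "real_upper_gradient f (\<lambda>x. g' x + g\<eta> x)"
  proof (rule real_upper_gradientI)
    show "(\<lambda>x. g' x + g\<eta> x) \<in> borel_measurable borel" using g'(1) gm by measurable
    fix \<gamma> :: "real \<Rightarrow> 'a" and l assume \<gamma>: "is_curve \<gamma> l"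
    then have l: "0 < l" by (simp add: is_curve_def)
    have sum: "(\<integral>\<^sup>+ t\<in>{0..l}. g' (\<gamma> t) + g\<eta> (\<gamma> t) \<partial>lborel) = (\<integral>\<^sup>+ t\<in>{0..l}. g' (\<gamma> t) \<partial>lborel) + (\<integral>\<^sup>+ t\<in>{0..l}. g\<eta> (\<gamma> t) \<partial>lborel)"
      using curve_measurable[OF \<gamma> gm, of 0 l] curve_measurable[OF \<gamma> g'(1), of 0 l]
      by (subst nn_integral_add[symmetric]) (auto intro!: nn_integral_cong simp: indicator_def)
    show "ennreal \<bar>f (\<gamma> 0) - f (\<gamma> l)\<bar> \<le> (\<integral>\<^sup>+ t\<in>{0..l}. g' (\<gamma> t) + g\<eta> (\<gamma> t) \<partial>lborel)"
    proof (cases "\<gamma> ` {0..l} \<subseteq> U")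
      case True
      then have in_U: "\<gamma> 0 \<in> U" "\<gamma> l \<in> U" using l by auto
      have "ennreal \<bar>f (\<gamma> 0) - f (\<gamma> l)\<bar> \<le> ug_lhs (v (\<gamma> 0)) (v (\<gamma> l)) + ennreal \<bar>\<eta> (\<gamma> 0) - \<eta> (\<gamma> l)\<bar>"
        using in_U by (cases "v (\<gamma> 0)"; cases "v (\<gamma> l)")
          (auto simp: f ug_lhs_def min_def max_def simp flip: ennreal_plus intro!: ennreal_leI)
      also have "\<dots> \<le> (\<integral>\<^sup>+ t\<in>{0..l}. g' (\<gamma> t) \<partial>lborel) + (\<integral>\<^sup>+ t\<in>{0..l}. g\<eta> (\<gamma> t) \<partial>lborel)"
      proof (rule add_mono)
        have "ug_lhs (v (\<gamma> 0)) (v (\<gamma> l)) \<le> (\<integral>\<^sup>+ t\<in>{0..l}. g (\<gamma> t) \<partial>lborel)"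
          using upper_gradient_subcurve[OF ug \<gamma>, of 0 l] True l by simp
        also have "\<dots> = (\<integral>\<^sup>+ t\<in>{0..l}. g' (\<gamma> t) \<partial>lborel)"
          using True g'(2) by (intro nn_integral_cong) (auto simp: indicator_def image_subset_iff)
        finally show "ug_lhs (v (\<gamma> 0)) (v (\<gamma> l)) \<le> (\<integral>\<^sup>+ t\<in>{0..l}. g' (\<gamma> t) \<partial>lborel)" .
      qed (rule real_upper_gradientD(2)[OF ug\<eta> \<gamma>])
      finally show ?thesis by (simp only: sum)
    next
      case False
      then obtain s where s: "0 \<le> s" "s \<le> l" "\<gamma> s \<notin> U"
        unfolding image_subset_iff by auto
      have "ennreal \<bar>f (\<gamma> 0) - f (\<gamma> l)\<bar> \<le> ennreal \<bar>\<eta> (\<gamma> 0) - \<eta> (\<gamma> s)\<bar> + ennreal \<bar>\<eta> (\<gamma> s) - \<eta> (\<gamma> l)\<bar>"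
        using f0[of "\<gamma> 0"] f0[of "\<gamma> l"] f\<eta>[of "\<gamma> 0"] f\<eta>[of "\<gamma> l"] \<eta>(2)[OF s(3)]
        by (auto simp flip: ennreal_plus intro!: ennreal_leI)
      also have "\<dots> \<le> (\<integral>\<^sup>+ t\<in>{0..s}. g\<eta> (\<gamma> t) \<partial>lborel) + (\<integral>\<^sup>+ t\<in>{s..l}. g\<eta> (\<gamma> t) \<partial>lborel)"
        using s by (intro add_mono real_upper_gradient_subcurve[OF ug\<eta> \<gamma>]) auto
      also have "\<dots> = (\<integral>\<^sup>+ t\<in>{0..l}. g\<eta> (\<gamma> t) \<partial>lborel)"
        using s by (intro set_nn_integral_Icc_split[symmetric] curve_measurable[OF \<gamma> gm]) auto
      also have "\<dots> \<le> (\<integral>\<^sup>+ t\<in>{0..l}. g' (\<gamma> t) + g\<eta> (\<gamma> t) \<partial>lborel)"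
        unfolding sum by simp
      finally show ?thesis .
    qed
  qed
qed

text \<open>The set E in question is null, so its indicator has energy only through its gradient.
  Every curve that starts or ends in E has infinite integral of \<open>g' + g\<eta>\<close>, so
  every positive multiple of this function is an upper gradient of the indicator, and small
  multiples have small energy.\<close>

lemma infinity_set_capacity:
  fixes v :: "'a \<Rightarrow> ereal" and \<eta> :: "'a \<Rightarrow> real"
  assumes U [measurable]: "U \<in> sets M" and v: "v \<in> borel_measurable (restrict_space M U)"
    and vint: "(\<integral>\<^sup>+ x\<in>U. epow (e2ennreal \<bar>v x\<bar>) p \<partial>M) < \<infinity>"
    and ug: "upper_gradient U v g"
    and g': "g' \<in> borel_measurable borel" "\<And>x. x \<in> U \<Longrightarrow> g' x = g x"
    and int: "(\<integral>\<^sup>+ x. epow (g' x + g\<eta> x) p \<partial>M) < \<infinity>"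
    and ug\<eta>: "real_upper_gradient \<eta> g\<eta>"
    and \<eta>: "\<And>x. 0 < \<eta> x \<Longrightarrow> x \<in> U" and e: "0 < (e::real)"
  shows "\<exists>G. open G \<and> {x\<in>U. \<bar>v x\<bar> = \<infinity> \<and> 0 < \<eta> x} \<subseteq> G \<and> capacity p M G < ennreal e"
proof -
  define E where "E = {x\<in>U. \<bar>v x\<bar> = \<infinity> \<and> 0 < \<eta> x}"
  note [measurable] = g'(1) real_upper_gradientD(1)[OF ug\<eta>]
  have "AE x in restrict_space M U. epow (e2ennreal \<bar>v x\<bar>) p \<noteq> \<infinity>"
  proof (rule nn_integral_noteq_infinite)
    show "(\<lambda>x. epow (e2ennreal \<bar>v x\<bar>) p) \<in> borel_measurable (restrict_space M U)" using v by measurable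
    show "(\<integral>\<^sup>+ x. epow (e2ennreal \<bar>v x\<bar>) p \<partial>restrict_space M U) \<noteq> \<infinity>"
      using vint by (subst nn_integral_restrict_space) auto
  qed
  then have "AE x in M. x \<in> U \<longrightarrow> epow (e2ennreal \<bar>v x\<bar>) p \<noteq> \<infinity>"
    by (subst (asm) AE_restrict_space_iff) auto
  then have "AE x in M. x \<notin> E"
    by eventually_elim (auto simp: E_def)
  then obtain N where "N \<in> null_sets M" "E \<subseteq> N"
    by (auto elim!: AE_E simp: null_sets_def subset_eq)
  then have null: "E \<in> null_sets M" using null_subset by blast
  then have [measurable]: "E \<in> sets M" by auto
  obtain I where I: "(\<integral>\<^sup>+ x. epow (g' x + g\<eta> x) p \<partial>M) = ennreal I" "0 \<le> I"
    using int by (cases "\<integral>\<^sup>+ x. epow (g' x + g\<eta> x) p \<partial>M") auto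
  \<comment> \<open>Chosen so that the bound \<open>2 powr p * 2 powr p * (2 * c)\<close> for the
    open superset equals \<open>e / 2\<close>; then t is chosen so that the scaled gradient has
    energy below c.\<close>
  define c where "c = e / (4 * 2 powr p * 2 powr p)"
  have c: "0 < c" using e by (simp add: c_def)
  define t where "t = (c / (I + 1)) powr (1 / p)"
  have t: "0 < t" "t powr p = c / (I + 1)"
    using c I(2) p_pos by (auto simp: t_def powr_powr)
  let ?w = "indicator E :: 'a \<Rightarrow> real"
  let ?g = "\<lambda>x. ennreal t * (g' x + g\<eta> x)"
  have "real_upper_gradient ?w ?g"
  proof (rule real_upper_gradientI)
    fix \<gamma> :: "real \<Rightarrow> 'a" and l assume \<gamma>: "is_curve \<gamma> l"
    then have l: "0 < l" by (simp add: is_curve_def)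
    show "ennreal \<bar>?w (\<gamma> 0) - ?w (\<gamma> l)\<bar> \<le> (\<integral>\<^sup>+ s\<in>{0..l}. ?g (\<gamma> s) \<partial>lborel)"
    proof (cases "\<gamma> 0 \<in> E \<or> \<gamma> l \<in> E")
      case True
      then obtain z where z: "z \<in> {0..l}" "\<gamma> z \<in> E"
      proof -
        show thesis using True that[of 0] that[of l] l by auto
      qed
      have m: "(\<lambda>s. (g' (\<gamma> s) + g\<eta> (\<gamma> s)) * indicator {0..l} s) \<in> borel_measurable borel"
        by (rule curve_measurable[OF \<gamma>, where g="\<lambda>x. g' x + g\<eta> x"]) auto
      have "(\<integral>\<^sup>+ s\<in>{0..l}. (g' (\<gamma> s) + g\<eta> (\<gamma> s)) \<partial>lborel) = \<infinity>"
        using z by (intro infinite_value_line_integral[OF ug ug\<eta> \<eta> g' \<gamma> z(1)]) (auto simp: E_def)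
      moreover have "(\<integral>\<^sup>+ s\<in>{0..l}. ?g (\<gamma> s) \<partial>lborel) = ennreal t * (\<integral>\<^sup>+ s\<in>{0..l}. (g' (\<gamma> s) + g\<eta> (\<gamma> s)) \<partial>lborel)"
        using m by (subst nn_integral_cmult[symmetric]) (auto simp: mult.assoc)
      ultimately show ?thesis using t(1) by (simp add: ennreal_mult_top)
    qed simp
  qed measurable
  moreover have "energy ?w ?g < ennreal c"
  proof -
    have "(\<integral>\<^sup>+ x. ennreal (\<bar>?w x\<bar> powr p) \<partial>M) = (\<integral>\<^sup>+ x. indicator E x \<partial>M)"
      using p_pos by (intro nn_integral_cong) (auto simp: indicator_def)
    also have "\<dots> = 0" using null by (auto simp: null_sets_def)
    finally have "energy ?w ?g = (\<integral>\<^sup>+ x. ennreal (t powr p) * epow (g' x + g\<eta> x) p \<partial>M)"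
      using t(1) by (simp add: energy_def epow_mult[OF p_pos] epow_ennreal)
    also have "\<dots> = ennreal (t powr p) * ennreal I"
      by (subst nn_integral_cmult) (auto simp: I)
    also have "\<dots> = ennreal (c / (I + 1) * I)"
      using I(2) c unfolding t(2) by (intro ennreal_mult[symmetric]) auto
    also have "\<dots> < ennreal c"
      using I(2) c by (simp add: ennreal_less_iff field_simps)
    finally show ?thesis .
  qed
  ultimately obtain G where G: "open G" "{x. 1 \<le> ?w x} \<subseteq> G" "capacity p M G \<le> ennreal (2 powr p * 2 powr p * (2 * c))"
    using superlevel_open_capacity[of ?w 1 ?g c] c by (auto simp: indicator_def)
  have "2 powr p * 2 powr p * (2 * c) = e / 2" by (simp add: c_def field_simps)
  then have "capacity p M G \<le> ennreal (e / 2)" using G(3) by (simp only:)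
  also have "\<dots> < ennreal e" using e by (simp add: ennreal_less_iff)
  finally have "capacity p M G < ennreal e" .
  moreover have "E \<subseteq> G" using G(2) by (auto simp: indicator_def subset_eq)
  ultimately show ?thesis using G(1) unfolding E_def by blast
qed


lemma nn_integral_epow_add_finite:
  assumes [measurable]: "g \<in> borel_measurable M" "g' \<in> borel_measurable M"
    and "(\<integral>\<^sup>+ x. epow (g x) p \<partial>M) < \<infinity>" "(\<integral>\<^sup>+ x. epow (g' x) p \<partial>M) < \<infinity>"
  shows "(\<integral>\<^sup>+ x. epow (g x + g' x) p \<partial>M) < \<infinity>"
proof -
  have "(\<integral>\<^sup>+ x. epow (g x + g' x) p \<partial>M) \<le> (\<integral>\<^sup>+ x. ennreal (2 powr p) * (epow (g x) p + epow (g' x) p) \<partial>M)"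
    by (intro nn_integral_mono epow_add_le p_pos)
  also have "\<dots> = ennreal (2 powr p) * ((\<integral>\<^sup>+ x. epow (g x) p \<partial>M) + (\<integral>\<^sup>+ x. epow (g' x) p \<partial>M))"
    by (simp add: nn_integral_cmult nn_integral_add)
  also have "\<dots> < \<infinity>" using assms(3,4) by (simp add: ennreal_mult_less_top)
  finally show ?thesis .
qed

lemma nn_integral_epow_cmult_finite:
  assumes [measurable]: "g \<in> borel_measurable M"
    and "(\<integral>\<^sup>+ x. epow (g x) p \<partial>M) < \<infinity>" "0 \<le> c"
  shows "(\<integral>\<^sup>+ x. epow (ennreal c * g x) p \<partial>M) < \<infinity>"
  using assms(2,3) by (simp add: epow_mult[OF p_pos] epow_ennreal nn_integral_cmult ennreal_mult_less_top)

lemma N1pE: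
  assumes "N1p p M U v"
  obtains g where "v \<in> borel_measurable (restrict_space M U)" "upper_gradient U v g"
    "(\<integral>\<^sup>+ x\<in>U. epow (e2ennreal \<bar>v x\<bar>) p \<partial>M) < \<infinity>" "(\<integral>\<^sup>+ x\<in>U. epow (g x) p \<partial>M) < \<infinity>"
proof -
  have "(\<integral>\<^sup>+ x\<in>U. epow (e2ennreal \<bar>v x\<bar>) p \<partial>M) + (INF g\<in>{g. upper_gradient U v g}. \<integral>\<^sup>+ x\<in>U. epow (g x) p \<partial>M) < \<infinity>"
    using assms by (simp add: N1p_def N1p_normp_def)
  then obtain g where "upper_gradient U v g"
    "(\<integral>\<^sup>+ x\<in>U. epow (e2ennreal \<bar>v x\<bar>) p \<partial>M) + (\<integral>\<^sup>+ x\<in>U. epow (g x) p \<partial>M) < \<infinity>"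
    using INF_add_lessD[of _ _ "{g. upper_gradient U v g}"] by blast
  with assms show thesis by (intro that[of g]) (auto simp: N1p_def)
qed

text \<open>The distance to the complement of V contributes a gradient 1, which need not be
  p-integrable on an unbounded space. The k-th cutoff is therefore also forced to vanish outside a
  ball of radius k, to which its gradient is then restricted. A fixed point eventually does not
  notice this, so its values stay away from 0.\<close>

lemma cutoff_functions:
  fixes w :: "'a \<Rightarrow> real"
  assumes V: "open V" and wm [measurable]: "w \<in> borel_measurable M" and w: "\<And>x. 0 \<le> w x" "\<And>x. w x \<le> 1"
    and ug: "real_upper_gradient w gw" and int: "(\<integral>\<^sup>+ x. epow (gw x) p \<partial>M) < \<infinity>"
  obtains \<eta> :: "nat \<Rightarrow> 'a \<Rightarrow> real" and g :: "nat \<Rightarrow> 'a \<Rightarrow> ennreal"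
  where "\<And>k. \<eta> k \<in> borel_measurable M" "\<And>k. real_upper_gradient (\<eta> k) (g k)"
    "\<And>k. (\<integral>\<^sup>+ x. epow (g k x) p \<partial>M) < \<infinity>" "\<And>k x. 0 \<le> \<eta> k x" "\<And>k x. \<eta> k x \<le> 1"
    "\<And>k x. x \<notin> V \<or> w x = 1 \<Longrightarrow> \<eta> k x = 0"
    "\<And>x. x \<in> V \<Longrightarrow> w x < 1 \<Longrightarrow> \<exists>d>0. \<exists>N. \<forall>k\<ge>N. d \<le> \<eta> k x"
proof -
  obtain x0 :: 'a where True by simp
  \<comment> \<open>\<open>infdist x {} = 0\<close>, hence the separate case.\<close>
  define dV where "dV x = (if V = UNIV then 1 else min 1 (infdist x (- V)))" for x
  have dV_lip: "\<bar>dV x - dV y\<bar> \<le> dist x y" for x y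
    using infdist_triangle_abs[of x "- V" y] by (auto simp: dV_def min_def)
  have dV01: "0 \<le> dV x" "dV x \<le> 1" for x by (auto simp: dV_def infdist_nonneg)
  have dV0: "dV x = 0" if "x \<notin> V" for x using that by (auto simp: dV_def)
  have dV_pos: "0 < dV x" if "x \<in> V" for x
  proof (cases "V = UNIV")
    case False
    then have "infdist x (- V) \<noteq> 0"
      using that V in_closed_iff_infdist_zero[of "- V" x] by (auto simp: closed_Compl)
    then show ?thesis using infdist_nonneg[of x "- V"] by (simp add: dV_def)
  qed (simp add: dV_def)
  define m where "m k x = min (dV x) (max 0 (real k - dist x x0))" for k :: nat and x
  have m_lip: "\<bar>m k x - m k y\<bar> \<le> dist x y" for k x y
    using dV_lip[of x y] dist_triangle[of x x0 y] dist_triangle[of y x0 x] by (auto simp: m_def min_def max_def dist_commute)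
  have m_cont: "continuous_on UNIV (m k)" for k
    by (rule lipschitz_on_continuous_on[of 1]) (auto intro!: lipschitz_onI simp: dist_real_def m_lip)
  define \<eta> where "\<eta> k x = min (1 - w x) (m k x)" for k x
  \<comment> \<open>The double complement matches the form of the gradient obtained for functions
    vanishing on a closed set, here the complement of the ball.\<close>
  define g where "g k x = (gw x + 1) * indicator (- (- ball x0 (real k))) x" for k x
  note [measurable] = real_upper_gradientD(1)[OF ug]
  have [measurable]: "m k \<in> borel_measurable borel" for k using m_cont by (rule borel_measurable_continuous_onI)
  have \<eta>m: "\<eta> k \<in> borel_measurable M" for k unfolding \<eta>_def by measurable
  have ug1: "real_upper_gradient (\<lambda>x. 1 - w x) gw"
    using ug by (auto simp: upper_gradient_def abs_minus_commute)
  have ug\<eta>: "real_upper_gradient (\<eta> k) (g k)" for k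
    unfolding g_def
  proof (rule real_upper_gradient_zero_on_closed)
    show "real_upper_gradient (\<eta> k) (\<lambda>x. gw x + 1)"
      unfolding \<eta>_def by (intro real_upper_gradient_min ug1 real_upper_gradient_lipschitz_one m_lip)
    show "closed (- ball x0 (real k))" by (simp add: closed_Compl)
    fix x assume "x \<in> - ball x0 (real k)"
    then show "\<eta> k x = 0" using w(2)[of x] dV01[of x] by (auto simp: \<eta>_def m_def dist_commute)
  qed
  have gint: "(\<integral>\<^sup>+ x. epow (g k x) p \<partial>M) < \<infinity>" for k
  proof -
    have "(\<integral>\<^sup>+ x. epow (g k x) p \<partial>M) \<le> (\<integral>\<^sup>+ x. epow (gw x + indicator (ball x0 (real k)) x) p \<partial>M)"
      by (intro nn_integral_mono epow_mono p_pos) (auto simp: g_def indicator_def)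
    also have "\<dots> < \<infinity>"
    proof (rule nn_integral_epow_add_finite)
      have "(\<integral>\<^sup>+ x. epow (indicator (ball x0 (real k)) x) p \<partial>M) = (\<integral>\<^sup>+ x. indicator (ball x0 (real k)) x \<partial>M)"
        by (intro nn_integral_cong) (auto simp: indicator_def)
      then show "(\<integral>\<^sup>+ x. epow (indicator (ball x0 (real k)) x) p \<partial>M) < \<infinity>"
        using emeasure_ball_finite[of x0 "real k"] by simp
    qed (use int in auto)
    finally show ?thesis .
  qed
  have \<eta>01: "0 \<le> \<eta> k x" "\<eta> k x \<le> 1" for k x
    using w[of x] dV01[of x] by (auto simp: \<eta>_def m_def)
  have \<eta>0: "\<eta> k x = 0" if "x \<notin> V \<or> w x = 1" for k x
    using that dV0[of x] dV01[of x] w(2)[of x] by (auto simp: \<eta>_def m_def)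
  have \<eta>_pos: "\<exists>d>0. \<exists>N. \<forall>k\<ge>N. d \<le> \<eta> k x" if x: "x \<in> V" "w x < 1" for x
  proof (intro exI conjI allI impI)
    show "0 < min (1 - w x) (dV x)" using dV_pos x by auto
    fix k assume "nat \<lceil>dist x x0 + 1\<rceil> \<le> k"
    then have "1 \<le> real k - dist x x0" by linarith
    then show "min (1 - w x) (dV x) \<le> \<eta> k x" using dV01[of x] by (auto simp: \<eta>_def m_def)
  qed
  show thesis by (rule that[OF \<eta>m ug\<eta> gint \<eta>01 \<eta>0 \<eta>_pos])
qed

text \<open>The truncations \<open>f k\<close> extend to the whole space as bounded functions with
  p-integrable gradients, so the bounded case applies to them and to the cutoffs. At a point outside
  the exceptional set v is finite and the cutoffs are bounded below by some \<open>d > 0\<close>;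
  for large k the ceiling \<open>k * d\<close> lies strictly above the positive part. By continuity
  the strict inequality persists nearby, where \<open>f k\<close> therefore equals the positive
  part.\<close>

lemma positive_part_quasicontinuous:
  fixes v :: "'a \<Rightarrow> ereal"
  assumes qo: "quasiopen p M U" and v: "N1p p M U v" and e: "0 < (e::real)"
  shows "\<exists>G. open G \<and> capacity p M G < ennreal e \<and> (\<forall>x\<in>U - G. \<bar>v x\<bar> \<noteq> \<infinity>) \<and>
    continuous_on (U - G) (\<lambda>x. real_of_ereal (max 0 (v x)))"
proof -
  have U [measurable]: "U \<in> sets M" by (rule quasiopen_sets[OF qo])
  obtain g where vm: "v \<in> borel_measurable (restrict_space M U)" and ug: "upper_gradient U v g"
    and vint: "(\<integral>\<^sup>+ x\<in>U. epow (e2ennreal \<bar>v x\<bar>) p \<partial>M) < \<infinity>" and gint: "(\<integral>\<^sup>+ x\<in>U. epow (g x) p \<partial>M) < \<infinity>"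
    by (rule N1pE[OF v]) (rule that)
  obtain g' where g' [measurable]: "g' \<in> borel_measurable borel" and g'g: "\<And>x. x \<in> U \<Longrightarrow> g' x = g x"
    and g'int: "(\<integral>\<^sup>+ x. epow (g' x) p \<partial>M) = (\<integral>\<^sup>+ x\<in>U. epow (g x) p \<partial>M)"
    using gradient_extension[OF U, of g] ug unfolding upper_gradient_def by blast
  have g'fin: "(\<integral>\<^sup>+ x. epow (g' x) p \<partial>M) < \<infinity>" using gint g'int by simp
  \<comment> \<open>With this c the open set W around the points where \<open>1 \<le> w x\<close>
    has capacity at most \<open>e / 8\<close>, below its share \<open>e / 4\<close>.\<close>
  define c where "c = e / (16 * 2 powr p * 2 powr p)"
  have c: "0 < c" using e by (simp add: c_def)
  obtain G0 where G0: "open G0" "capacity p M G0 < ennreal c" "open (U \<union> G0)"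
    using qo c unfolding quasiopen_def by blast
  obtain w gw where wm: "w \<in> borel_measurable M" and ugw: "real_upper_gradient w gw"
    and w: "\<And>x. 0 \<le> w x" "\<And>x. w x \<le> 1" and w1: "\<And>x. x \<in> G0 \<Longrightarrow> w x = 1" and wen: "energy w gw < ennreal c"
    by (rule capacity_less_test[OF G0(2)]) (rule that)
  have "(\<integral>\<^sup>+ x. epow (gw x) p \<partial>M) \<le> energy w gw" by (simp add: energy_def)
  also have "\<dots> < \<infinity>" using wen less_top by fastforce
  finally have gwint: "(\<integral>\<^sup>+ x. epow (gw x) p \<partial>M) < \<infinity>" .
  obtain W where W: "open W" "{x. 1 \<le> w x} \<subseteq> W" "capacity p M W < ennreal (e / 2 * (1/2)^Suc 0)"
  proof -
    obtain W where W: "open W" "{x. 1 \<le> w x} \<subseteq> W" "capacity p M W \<le> ennreal (2 powr p * 2 powr p * (2 * c))"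
      using superlevel_open_capacity[OF wm w ugw wen c] by blast
    have "2 powr p * 2 powr p * (2 * c) = e / 8" by (simp add: c_def field_simps)
    then have "capacity p M W \<le> ennreal (e / 8)" using W(3) by (simp only:)
    also have "\<dots> < ennreal (e / 2 * (1/2)^Suc 0)" using e by (simp add: ennreal_less_iff)
    finally show thesis using W that by blast
  qed
  obtain \<eta> :: "nat \<Rightarrow> 'a \<Rightarrow> real" and g\<eta> where \<eta>m [measurable]: "\<And>k. \<eta> k \<in> borel_measurable M"
    and ug\<eta>: "\<And>k. real_upper_gradient (\<eta> k) (g\<eta> k)"
    and g\<eta>int: "\<And>k. (\<integral>\<^sup>+ x. epow (g\<eta> k x) p \<partial>M) < \<infinity>" and \<eta>01: "\<And>k x. 0 \<le> \<eta> k x" "\<And>k x. \<eta> k x \<le> 1"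
    and \<eta>0: "\<And>k x. x \<notin> U \<union> G0 \<or> w x = 1 \<Longrightarrow> \<eta> k x = 0"
    and \<eta>_pos: "\<And>x. x \<in> U \<union> G0 \<Longrightarrow> w x < 1 \<Longrightarrow> \<exists>d>0. \<exists>N. \<forall>k\<ge>N. d \<le> \<eta> k x"
    by (rule cutoff_functions[OF G0(3) wm w ugw gwint]) (rule that)
  note [measurable] = real_upper_gradientD(1)[OF ug\<eta>]
  have \<eta>U: "\<eta> k x = 0" if "x \<notin> U" for k x using \<eta>0[of x k] w1[of x] that by auto
  define f where "f k x = (if x \<in> U then real_of_ereal (min (max 0 (v x)) (ereal (real k * \<eta> k x))) else 0)" for k x
  have kug: "real_upper_gradient (\<lambda>x. real k * \<eta> k x) (\<lambda>x. ennreal (real k) * g\<eta> k x)" for k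
    by (rule real_upper_gradient_cmult[OF ug\<eta>]) simp
  have k\<eta>: "(\<lambda>x. real k * \<eta> k x) \<in> borel_measurable M" "0 \<le> real k * \<eta> k x" "x \<notin> U \<Longrightarrow> real k * \<eta> k x = 0" for k x
    using \<eta>01[of k x] \<eta>U[of x k] by auto
  note ext = truncated_extension[OF U vm ug g' g'g k\<eta>(1) kug k\<eta>(2,3) f_def]
  define P where "P k A \<longleftrightarrow> open A \<and> capacity p M A < ennreal (e / 2 * (1/2)^Suc (Suc k)) \<and> continuous_on (- A) (f k) \<and>
      continuous_on (- A) (\<eta> k) \<and> {x\<in>U. \<bar>v x\<bar> = \<infinity> \<and> 0 < \<eta> k x} \<subseteq> A" for k A
  have ex_P: "\<exists>A. P k A" for k
  proof -
    \<comment> \<open>The share of the k-th exceptional set. It is split among three sets by two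
      uses of \<open>capacity_Un_small\<close>, whence \<open>d / 4\<close> for the first and
      \<open>d / 8 / 4\<close> and \<open>d / 8 / 8\<close> for the others.\<close>
    define d where "d = e / 2 * (1/2)^Suc (Suc k)"
    have d: "0 < d" using e by (simp add: d_def)
    have f_le: "f k x \<le> real k" for x
      using ext(4)[of k x] mult_left_le[of "\<eta> k x" "real k"] \<eta>01[of k x] by simp
    have "(\<integral>\<^sup>+ x. epow (ennreal (real k) * g\<eta> k x) p \<partial>M) < \<infinity>"
      by (rule nn_integral_epow_cmult_finite[OF _ g\<eta>int]) auto
    then have "(\<integral>\<^sup>+ x. epow (g' x + ennreal (real k) * g\<eta> k x) p \<partial>M) < \<infinity>"
      by (intro nn_integral_epow_add_finite g'fin) auto
    then obtain A1 where A1: "open A1" "capacity p M A1 < ennreal (d / 4)" "continuous_on (- A1) (f k)"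
      using bounded_quasicontinuous[OF ext(1) ext(3) f_le ext(2), of "d / 4"] d by auto
    obtain A2 where A2: "open A2" "capacity p M A2 < ennreal (d / 8 / 4)" "continuous_on (- A2) (\<eta> k)"
      using bounded_quasicontinuous[OF \<eta>m \<eta>01 ug\<eta> g\<eta>int, of "d / 8 / 4" k] d by auto
    have "(\<integral>\<^sup>+ x. epow (g' x + g\<eta> k x) p \<partial>M) < \<infinity>"
      by (intro nn_integral_epow_add_finite g'fin g\<eta>int) auto
    moreover have "x \<in> U" if "0 < \<eta> k x" for x using \<eta>U[of x k] that by auto
    ultimately obtain A3 where A3: "open A3" "{x\<in>U. \<bar>v x\<bar> = \<infinity> \<and> 0 < \<eta> k x} \<subseteq> A3" "capacity p M A3 < ennreal (d / 8 / 8)"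
      using infinity_set_capacity[OF U vm vint ug g' g'g _ ug\<eta>, of k "d / 8 / 8"] d by auto
    have "capacity p M (A2 \<union> A3) < ennreal (d / 8)"
      using A2(2) A3(3) d by (intro capacity_Un_small) auto
    with d A1(2) have "capacity p M (A1 \<union> (A2 \<union> A3)) < ennreal d"
      by (rule capacity_Un_small)
    moreover have "continuous_on (- (A1 \<union> (A2 \<union> A3))) (f k)" "continuous_on (- (A1 \<union> (A2 \<union> A3))) (\<eta> k)"
      using A1(3) A2(3) by (auto intro: continuous_on_subset)
    ultimately show ?thesis
      using A1(1) A2(1) A3(1,2) unfolding d_def P_def by (intro exI[of _ "A1 \<union> (A2 \<union> A3)"]) auto
  qed
  obtain A where "\<And>k. P k (A k)" using ex_P by metis
  then have A: "\<And>k. open (A k)" "\<And>k. capacity p M (A k) < ennreal (e / 2 * (1/2)^Suc (Suc k))"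
    "\<And>k. continuous_on (- A k) (f k)" "\<And>k. continuous_on (- A k) (\<eta> k)" "\<And>k. {x\<in>U. \<bar>v x\<bar> = \<infinity> \<and> 0 < \<eta> k x} \<subseteq> A k"
    unfolding P_def by auto
  \<comment> \<open>W takes the first place of the geometric series and \<open>A k\<close> the place
    \<open>Suc k\<close>, which explains the exponent \<open>Suc (Suc k)\<close> in its
    share.\<close>
  define H where "H i = (case i of 0 \<Rightarrow> W | Suc k \<Rightarrow> A k)" for i
  define G where "G = (\<Union>i. H i)"
  have WG: "W \<subseteq> G" and AG: "A k \<subseteq> G" for k
    unfolding G_def H_def by (auto intro: UN_I[of 0] UN_I[of "Suc k"])
  have "open G" unfolding G_def H_def using W(1) A(1) by (auto split: nat.split)
  have cap: "capacity p M G < ennreal e"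
  proof -
    have "capacity p M (H i) < ennreal (e / 2 * (1/2)^Suc i)" for i
      using W(3) A(2) unfolding H_def by (cases i) (simp_all only: nat.case)
    then have "capacity p M G \<le> ennreal (e / 2)"
      unfolding G_def using e by (intro capacity_UN_le) auto
    also have "\<dots> < ennreal e" using e by (simp add: ennreal_less_iff)
    finally show ?thesis .
  qed
  have \<eta>_pos': "\<exists>d>0. \<exists>N. \<forall>k\<ge>N. d \<le> \<eta> k x" if "x \<in> U - G" for x
  proof (rule \<eta>_pos)
    show "w x < 1" using that W(2) WG by (auto simp: subset_eq not_le[symmetric])
  qed (use that in auto)
  have fin: "\<bar>v x\<bar> \<noteq> \<infinity>" if "x \<in> U - G" for x
  proof -
    obtain d k where "0 < d" "d \<le> \<eta> k x" using \<eta>_pos'[OF \<open>x \<in> U - G\<close>] by blast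
    then show ?thesis using A(5)[of k] AG[of k] that by auto
  qed
  have cont: "continuous_on (U - G) (\<lambda>x. real_of_ereal (max 0 (v x)))"
    unfolding continuous_on_eq_continuous_within
  proof
    fix x assume x: "x \<in> U - G"
    obtain d N where d: "0 < d" "\<And>k. N \<le> k \<Longrightarrow> d \<le> \<eta> k x" using \<eta>_pos'[OF x] by blast
    let ?r = "\<lambda>x. real_of_ereal (max 0 (v x))"
    \<comment> \<open>This n lifts the ceiling above the value at x, and N makes the cutoff at least
      d there; their maximum k does both.\<close>
    obtain n :: nat where n: "?r x / d < real n" using reals_Archimedean2 by blast
    define k where "k = max n N"
    have fr: "f k y = min (?r y) (real k * \<eta> k y)" if "y \<in> U - G" for y
      using fin[OF that] that \<eta>01(1)[of k y] by (cases "v y") (auto simp: f_def min_def max_def)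
    have "?r x < real n * d" using n d(1) by (simp add: field_simps)
    also have "\<dots> \<le> real k * \<eta> k x" using d by (intro mult_mono) (auto simp: k_def)
    finally have less: "f k x < real k * \<eta> k x" using fr[OF x] by simp
    have sub: "U - G \<subseteq> - A k" using AG by auto
    have fc: "continuous (at x within U - G) (f k)" and \<eta>c: "continuous (at x within U - G) (\<eta> k)"
      using continuous_on_subset[OF A(3) sub] continuous_on_subset[OF A(4) sub] x
      by (auto simp: continuous_on_eq_continuous_within)
    have "((\<lambda>y. real k * \<eta> k y - f k y) \<longlongrightarrow> real k * \<eta> k x - f k x) (at x within U - G)"
      using fc \<eta>c unfolding continuous_within by (intro tendsto_intros)
    then have "\<forall>\<^sub>F y in at x within U - G. 0 < real k * \<eta> k y - f k y"
      using less by (intro order_tendstoD) auto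
    moreover have "\<forall>\<^sub>F y in at x within U - G. y \<in> U - G" by (simp add: eventually_at_filter)
    ultimately have "\<forall>\<^sub>F y in at x within U - G. f k y = ?r y"
      by eventually_elim (use fr in \<open>auto simp: min_def split: if_splits\<close>)
    moreover have "f k x = ?r x" using fr[OF x] less by (auto simp: min_def split: if_splits)
    ultimately show "continuous (at x within U - G) ?r"
      using fc tendsto_cong[of "f k" ?r "at x within U - G" "?r x"] unfolding continuous_within by simp
  qed
  show ?thesis
    using \<open>open G\<close> cap fin cont by (intro exI[of _ G]) auto
qed

lemma upper_gradient_uminus:
  assumes "upper_gradient U v g"
  shows "upper_gradient U (\<lambda>x. - v x) g"
proof -
  have "ug_lhs (- a) (- b) = ug_lhs a b" for a b
    by (cases a; cases b) (auto simp: ug_lhs_def abs_minus_commute)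
  then show ?thesis using assms by (simp add: upper_gradient_def)
qed

lemma N1p_uminus:
  assumes "N1p p M U v"
  shows "N1p p M U (\<lambda>x. - v x)"
proof -
  have "{g. upper_gradient U (\<lambda>x. - v x) g} = {g. upper_gradient U v g}"
    using upper_gradient_uminus[of U v] upper_gradient_uminus[of U "\<lambda>x. - v x"] by auto
  then have "N1p_normp p M U (\<lambda>x. - v x) = N1p_normp p M U v"
    by (simp add: N1p_normp_def)
  then show ?thesis using assms by (auto simp: N1p_def)
qed

text \<open>Truncation from above by a multiple of the cutoff makes sense for nonnegative functions,
  so v and \<open>- v\<close> are treated separately and v is recovered as the difference of
  positive and negative part. Finiteness of v excludes an undefined difference.\<close>

lemma N1p_quasicontinuous:
  assumes qo: "quasiopen p M U" and v: "N1p p M U v"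
  shows "quasicontinuous_on p M U v"
  unfolding quasicontinuous_on_def
proof (intro allI impI)
  fix e :: real assume e: "0 < e"
  obtain G where G: "open G" "capacity p M G < ennreal (e / 4)" "\<forall>x\<in>U - G. \<bar>v x\<bar> \<noteq> \<infinity>"
    "continuous_on (U - G) (\<lambda>x. real_of_ereal (max 0 (v x)))"
    using positive_part_quasicontinuous[OF qo v, of "e / 4"] e by auto
  obtain H where H: "open H" "capacity p M H < ennreal (e / 8)"
    "continuous_on (U - H) (\<lambda>x. real_of_ereal (max 0 (- v x)))"
    using positive_part_quasicontinuous[OF qo N1p_uminus[OF v], of "e / 8"] e by auto
  have "continuous_on (U - (G \<union> H)) (\<lambda>x. real_of_ereal (max 0 (v x)) - real_of_ereal (max 0 (- v x)))"
    by (intro continuous_on_diff continuous_on_subset[OF G(4)] continuous_on_subset[OF H(3)]) auto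
  moreover have "real_of_ereal (max 0 (v x)) - real_of_ereal (max 0 (- v x)) = real_of_ereal (v x)" if "x \<in> U - (G \<union> H)" for x
    using G(3) that by (cases "v x") (auto simp: max_def)
  ultimately have "continuous_on (U - (G \<union> H)) (\<lambda>x. real_of_ereal (v x))"
    by (metis (no_types, lifting) continuous_on_cong)
  moreover have "capacity p M (G \<union> H) < ennreal e"
    using e G(2) H(2) by (rule capacity_Un_small)
  ultimately show "\<exists>G. open G \<and> capacity p M G < ennreal e \<and> (\<forall>x\<in>U - G. \<bar>v x\<bar> \<noteq> \<infinity>) \<and> continuous_on (U - G) (\<lambda>x. real_of_ereal (v x))"
    using G(1,3) H(1) by (intro exI[of _ "G \<union> H"]) auto
qed

end

subsection \<open>Properties of almost every curve\<close>

text \<open>The points of the open interval where the functions differ form an open null set, hence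
  none; the endpoints follow by taking closures.\<close>

lemma continuous_AE_eq_on_interval:
  fixes \<phi> \<psi> :: "real \<Rightarrow> real"
  assumes "continuous_on {0..l} \<phi>" "continuous_on {0..l} \<psi>" "0 < l"
    and "AE t in lborel. t \<in> {0..l} \<longrightarrow> \<phi> t = \<psi> t" and t: "t \<in> {0..l}"
  shows "\<phi> t = \<psi> t"
proof -
  define d where "d t = \<phi> t - \<psi> t" for t
  have d: "continuous_on {0..l} d" unfolding d_def using assms(1,2) by (rule continuous_on_diff)
  define S where "S = {0<..<l} \<inter> d -` (- {0})"
  have "open S"
    unfolding S_def by (intro continuous_open_preimage continuous_on_subset[OF d]) auto
  have "AE t in lborel. t \<notin> S" using assms(4) by eventually_elim (auto simp: S_def d_def)
  then have "S \<in> null_sets lborel" using \<open>open S\<close> by (simp add: AE_iff_null_sets[symmetric])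
  then have "negligible S" by (simp add: negligible_iff_null_sets null_sets_completionI)
  then have "S = {}" using open_not_negligible[OF \<open>open S\<close>] by blast
  then have z: "d t = 0" if "t \<in> {0<..<l}" for t using that by (auto simp: S_def)
  have cl: "closure {0<..<l} = {0..l}" using assms(3) by simp
  have "d t = 0"
    by (rule continuous_constant_on_closure[of "{0<..<l}"]) (use d z t in \<open>auto simp: cl\<close>)
  then show ?thesis by (simp add: d_def)
qed

section \<open>Exceptional curve families\<close>

context newtonian_space begin

text \<open>Fuglede's description of exceptional families: a single p-integrable Borel function has
  infinite integral along all their curves. In this form two exceptional families combine by adding
  the functions, and the function itself can be added to an upper gradient. The two lemmas on
  \<open>p_modulus\<close> show that nothing changes compared with zero modulus.\<close>

definition ae_curve :: "'a set \<Rightarrow> ((real \<Rightarrow> 'a) \<Rightarrow> real \<Rightarrow> bool) \<Rightarrow> bool" where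
  "ae_curve U P \<longleftrightarrow> (\<exists>\<rho>. \<rho> \<in> borel_measurable borel \<and> (\<integral>\<^sup>+ x. epow (\<rho> x) p \<partial>M) < \<infinity> \<and>
     (\<forall>\<gamma> l. curve_in U \<gamma> l \<and> line_integral \<rho> \<gamma> l \<noteq> \<infinity> \<longrightarrow> P \<gamma> l))"

lemma line_integral_cmult:
  assumes "is_curve \<gamma> l" "\<rho> \<in> borel_measurable borel"
  shows "line_integral (\<lambda>x. c * \<rho> x) \<gamma> l = c * line_integral \<rho> \<gamma> l"
  using curve_measurable[OF assms, of 0 l] unfolding line_integral_def
  by (subst nn_integral_cmult[symmetric]) (auto simp: mult.assoc)

lemma line_integral_mono: "(\<And>x. \<rho> x \<le> \<rho>' x) \<Longrightarrow> line_integral \<rho> \<gamma> l \<le> line_integral \<rho>' \<gamma> l"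
  unfolding line_integral_def by (intro nn_integral_mono mult_right_mono) auto

lemma ae_curve_conj:
  assumes "ae_curve U P" "ae_curve U Q"
  shows "ae_curve U (\<lambda>\<gamma> l. P \<gamma> l \<and> Q \<gamma> l)"
proof -
  obtain \<rho> where \<rho>: "\<rho> \<in> borel_measurable borel" "(\<integral>\<^sup>+ x. epow (\<rho> x) p \<partial>M) < \<infinity>"
    "\<And>\<gamma> l. curve_in U \<gamma> l \<Longrightarrow> line_integral \<rho> \<gamma> l \<noteq> \<infinity> \<Longrightarrow> P \<gamma> l"
    using assms(1) unfolding ae_curve_def by auto
  obtain \<rho>' where \<rho>': "\<rho>' \<in> borel_measurable borel" "(\<integral>\<^sup>+ x. epow (\<rho>' x) p \<partial>M) < \<infinity>"
    "\<And>\<gamma> l. curve_in U \<gamma> l \<Longrightarrow> line_integral \<rho>' \<gamma> l \<noteq> \<infinity> \<Longrightarrow> Q \<gamma> l"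
    using assms(2) unfolding ae_curve_def by auto
  note [measurable] = \<rho>(1) \<rho>'(1)
  have "(\<lambda>x. \<rho> x + \<rho>' x) \<in> borel_measurable borel" by measurable
  moreover have "(\<integral>\<^sup>+ x. epow (\<rho> x + \<rho>' x) p \<partial>M) < \<infinity>"
    using \<rho>(2) \<rho>'(2) by (intro nn_integral_epow_add_finite) auto
  moreover have "P \<gamma> l \<and> Q \<gamma> l" if c: "curve_in U \<gamma> l" and fin: "line_integral (\<lambda>x. \<rho> x + \<rho>' x) \<gamma> l \<noteq> \<infinity>" for \<gamma> l
  proof -
    have "line_integral \<rho> \<gamma> l \<le> line_integral (\<lambda>x. \<rho> x + \<rho>' x) \<gamma> l"
      "line_integral \<rho>' \<gamma> l \<le> line_integral (\<lambda>x. \<rho> x + \<rho>' x) \<gamma> l"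
      by (auto intro: line_integral_mono)
    then have "line_integral \<rho> \<gamma> l \<noteq> \<infinity>" "line_integral \<rho>' \<gamma> l \<noteq> \<infinity>"
      using fin by (auto simp: top_unique)
    then show ?thesis using \<rho>(3)[OF c] \<rho>'(3)[OF c] by blast
  qed
  ultimately show ?thesis unfolding ae_curve_def by blast
qed

lemma ae_curve_mono:
  assumes "ae_curve U P" "\<And>\<gamma> l. curve_in U \<gamma> l \<Longrightarrow> P \<gamma> l \<Longrightarrow> Q \<gamma> l"
  shows "ae_curve U Q"
  using assms unfolding ae_curve_def by blast

text \<open>If the integral of \<open>\<rho>\<close> is infinite along every curve of the family,
  each positive multiple of \<open>\<rho>\<close> is admissible, and its p-th power integral tends
  to 0 with the factor.\<close>

lemma ae_curve_imp_modulus: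
  assumes "ae_curve U P"
  shows "\<exists>\<Gamma>. p_modulus p M \<Gamma> = 0 \<and> (\<forall>\<gamma> l. curve_in U \<gamma> l \<and> (\<gamma>, l) \<notin> \<Gamma> \<longrightarrow> P \<gamma> l)"
proof -
  obtain \<rho> where \<rho> [measurable]: "\<rho> \<in> borel_measurable borel" and fin: "(\<integral>\<^sup>+ x. epow (\<rho> x) p \<partial>M) < \<infinity>"
    and P: "\<And>\<gamma> l. curve_in U \<gamma> l \<Longrightarrow> line_integral \<rho> \<gamma> l \<noteq> \<infinity> \<Longrightarrow> P \<gamma> l"
    using assms unfolding ae_curve_def by auto
  obtain I where I: "(\<integral>\<^sup>+ x. epow (\<rho> x) p \<partial>M) = ennreal I" "0 \<le> I"
    using fin by (cases "\<integral>\<^sup>+ x. epow (\<rho> x) p \<partial>M") auto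
  define \<Gamma> where "\<Gamma> = {(\<gamma>, l). curve_in U \<gamma> l \<and> line_integral \<rho> \<gamma> l = \<infinity>}"
  have small: "p_modulus p M \<Gamma> \<le> 0 + ennreal e" if e: "0 < e" for e :: real
  proof -
    define t where "t = (e / (I + 1)) powr (1 / p)"
    have t: "0 < t" "t powr p = e / (I + 1)"
      using e I(2) p_pos by (auto simp: t_def powr_powr)
    have "1 \<le> line_integral (\<lambda>x. ennreal t * \<rho> x) \<gamma> l" if "(\<gamma>, l) \<in> \<Gamma>" for \<gamma> l
    proof -
      have "line_integral (\<lambda>x. ennreal t * \<rho> x) \<gamma> l = ennreal t * line_integral \<rho> \<gamma> l"
        using that by (intro line_integral_cmult) (auto simp: \<Gamma>_def curve_in_def)
      then show ?thesis using that t(1) by (simp add: \<Gamma>_def ennreal_mult_top)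
    qed
    then have "p_modulus p M \<Gamma> \<le> (\<integral>\<^sup>+ x. epow (ennreal t * \<rho> x) p \<partial>M)"
      unfolding p_modulus_def by (intro INF_lower) auto
    also have "\<dots> = ennreal (t powr p) * ennreal I"
      using t(1) by (simp add: epow_mult[OF p_pos] epow_ennreal nn_integral_cmult I)
    also have "\<dots> = ennreal (e / (I + 1) * I)"
      using I(2) e unfolding t(2) by (intro ennreal_mult[symmetric]) auto
    also have "\<dots> \<le> ennreal e"
      using I(2) e by (intro ennreal_leI) (simp add: field_simps)
    finally show ?thesis by simp
  qed
  have "p_modulus p M \<Gamma> \<le> 0" by (rule ennreal_le_epsilon) (rule small)
  then show ?thesis using P by (intro exI[of _ \<Gamma>]) (auto simp: \<Gamma>_def)
qed

text \<open>Admissible functions with rapidly decreasing p-th power integrals are weighted by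
  \<open>2^i\<close>. Their supremum remains p-integrable, by the choice of \<open>c i\<close>,
  while its integral along a curve of the family is at least \<open>2^i\<close> for every i.\<close>

lemma modulus_imp_ae_curve:
  assumes \<Gamma>: "p_modulus p M \<Gamma> = 0" and P: "\<And>\<gamma> l. curve_in U \<gamma> l \<Longrightarrow> (\<gamma>, l) \<notin> \<Gamma> \<Longrightarrow> P \<gamma> l"
  shows "ae_curve U P"
proof -
  define c where "c i = (1/2)^Suc i / (2^i) powr p" for i :: nat
  have c: "0 < c i" for i by (simp add: c_def)
  define A where "A i \<rho> \<longleftrightarrow> \<rho> \<in> borel_measurable borel \<and> (\<forall>(\<gamma>, l)\<in>\<Gamma>. 1 \<le> line_integral \<rho> \<gamma> l) \<and>
    (\<integral>\<^sup>+ x. epow (\<rho> x) p \<partial>M) < ennreal (c i)" for i \<rho>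
  have "\<exists>\<rho>. A i \<rho>" for i
  proof -
    have "p_modulus p M \<Gamma> < ennreal (c i)" using \<Gamma> c by simp
    then show ?thesis unfolding p_modulus_def INF_less_iff A_def by auto
  qed
  then obtain \<rho> where "\<And>i. A i (\<rho> i)" by metis
  then have \<rho>: "\<And>i. \<rho> i \<in> borel_measurable borel" "\<And>i. \<forall>(\<gamma>, l)\<in>\<Gamma>. 1 \<le> line_integral (\<rho> i) \<gamma> l"
    "\<And>i. (\<integral>\<^sup>+ x. epow (\<rho> i x) p \<partial>M) < ennreal (c i)"
    unfolding A_def by blast+
  note [measurable] = \<rho>(1)
  define R where "R x = (SUP i. ennreal (2^i) * \<rho> i x)" for x
  have R [measurable]: "R \<in> borel_measurable borel" unfolding R_def by measurable
  have "(\<integral>\<^sup>+ x. epow (R x) p \<partial>M) \<le> (\<integral>\<^sup>+ x. (\<Sum>i. epow (ennreal (2^i) * \<rho> i x) p) \<partial>M)"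
    unfolding R_def by (intro nn_integral_mono epow_SUP_le p_pos)
  also have "\<dots> = (\<Sum>i. \<integral>\<^sup>+ x. epow (ennreal (2^i) * \<rho> i x) p \<partial>M)"
    by (rule nn_integral_suminf) measurable
  also have "\<dots> \<le> (\<Sum>i. ennreal (1 * (1/2)^Suc i))"
  proof (intro suminf_le)
    fix i
    have "(\<integral>\<^sup>+ x. epow (ennreal (2^i) * \<rho> i x) p \<partial>M) = ennreal ((2^i) powr p) * (\<integral>\<^sup>+ x. epow (\<rho> i x) p \<partial>M)"
      by (simp add: epow_mult[OF p_pos] epow_ennreal nn_integral_cmult)
    also have "\<dots> \<le> ennreal ((2^i) powr p) * ennreal (c i)"
      using \<rho>(3)[of i] by (intro mult_left_mono) auto
    also have "\<dots> = ennreal (1 * (1/2)^Suc i)"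
      by (simp add: c_def ennreal_mult[symmetric])
    finally show "(\<integral>\<^sup>+ x. epow (ennreal (2^i) * \<rho> i x) p \<partial>M) \<le> ennreal (1 * (1/2)^Suc i)" .
  qed auto
  also have "\<dots> = ennreal 1" by (rule suminf_half_powers) simp
  finally have "(\<integral>\<^sup>+ x. epow (R x) p \<partial>M) \<le> 1" by simp
  then have "(\<integral>\<^sup>+ x. epow (R x) p \<partial>M) < \<infinity>" by (rule le_less_trans) simp
  moreover have "P \<gamma> l" if \<gamma>: "curve_in U \<gamma> l" "line_integral R \<gamma> l \<noteq> \<infinity>" for \<gamma> l
  proof (rule P[OF \<gamma>(1)], rule)
    assume in_\<Gamma>: "(\<gamma>, l) \<in> \<Gamma>"
    obtain b where b: "line_integral R \<gamma> l = ennreal b" "0 \<le> b"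
      using \<gamma>(2) by (cases "line_integral R \<gamma> l") auto
    obtain i where i: "b < 2^i" using real_arch_pow[of 2 b] by auto
    have "ennreal (2^i) * 1 \<le> ennreal (2^i) * line_integral (\<rho> i) \<gamma> l"
      using \<rho>(2)[of i] in_\<Gamma> by (intro mult_left_mono) auto
    also have "\<dots> = line_integral (\<lambda>x. ennreal (2^i) * \<rho> i x) \<gamma> l"
      using \<gamma>(1) by (intro line_integral_cmult[symmetric]) (auto simp: curve_in_def)
    also have "\<dots> \<le> line_integral R \<gamma> l"
      unfolding R_def by (intro line_integral_mono SUP_upper) simp
    finally show False using b i by (simp del: ennreal_power)
  qed
  ultimately show ?thesis unfolding ae_curve_def using R by blast
qed

text \<open>Along a curve with finite integral of the gradient, the increments of v over separated
  intervals add up to at most the integral over their union, which is small when the total length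
  is. An infinite value of v on the curve would force that integral to be infinite.\<close>

lemma N1p_ae_absolutely_continuous:
  assumes U: "U \<in> sets M" and v: "N1p p M U v"
  shows "ae_curve U (\<lambda>\<gamma> l. abs_continuous_on 0 l (v \<circ> \<gamma>))"
proof -
  obtain g where ug: "upper_gradient U v g" and gint: "(\<integral>\<^sup>+ x\<in>U. epow (g x) p \<partial>M) < \<infinity>"
    by (rule N1pE[OF v]) (rule that)
  obtain g' where g': "g' \<in> borel_measurable borel" and g'g: "\<And>x. x \<in> U \<Longrightarrow> g' x = g x"
    and g'int: "(\<integral>\<^sup>+ x. epow (g' x) p \<partial>M) = (\<integral>\<^sup>+ x\<in>U. epow (g x) p \<partial>M)"
    using gradient_extension[OF U, of g] ug unfolding upper_gradient_def by blast
  have "abs_continuous_on 0 l (v \<circ> \<gamma>)" if c: "curve_in U \<gamma> l" and fin: "line_integral g' \<gamma> l \<noteq> \<infinity>" for \<gamma> l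
  proof -
    have \<gamma>: "is_curve \<gamma> l" and sub: "\<gamma> ` {0..l} \<subseteq> U" using c by (auto simp: curve_in_def)
    have l: "0 < l" using \<gamma> by (simp add: is_curve_def)
    define h where "h t = g' (\<gamma> t) * indicator {0..l} t" for t
    have hm [measurable]: "h \<in> borel_measurable borel"
      unfolding h_def by (rule curve_measurable[OF \<gamma> g']) auto
    have hfin: "(\<integral>\<^sup>+ t. h t \<partial>lborel) < \<infinity>"
      using fin by (simp add: line_integral_def h_def less_top)
    have ineq: "ug_lhs (v (\<gamma> a)) (v (\<gamma> b)) \<le> (\<integral>\<^sup>+ t\<in>{a<..b}. h t \<partial>lborel)" if ab: "0 \<le> a" "a < b" "b \<le> l" for a b
    proof -
      have "ug_lhs (v (\<gamma> a)) (v (\<gamma> b)) \<le> (\<integral>\<^sup>+ t\<in>{a..b}. g (\<gamma> t) \<partial>lborel)"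
        using sub ab by (intro upper_gradient_subcurve[OF ug \<gamma>]) auto
      also have "\<dots> = (\<integral>\<^sup>+ t\<in>{a<..b}. h t \<partial>lborel)"
      proof (rule nn_integral_cong_AE, rule AE_mp[OF AE_lborel_singleton[of a]], intro AE_I2 impI)
        fix t assume "t \<noteq> a"
        then show "g (\<gamma> t) * indicator {a..b} t = h t * indicator {a<..b} t"
          using ab sub g'g[of "\<gamma> t"] by (auto simp: h_def indicator_def image_subset_iff)
      qed
      finally show ?thesis .
    qed
    have finite_v: "\<bar>v (\<gamma> t)\<bar> \<noteq> \<infinity>" if t: "t \<in> {0..l}" for t
    proof -
      have lt: "(\<integral>\<^sup>+ t\<in>{a<..b}. h t \<partial>lborel) < \<infinity>" for a b
        by (rule le_less_trans[OF _ hfin]) (auto intro!: nn_integral_mono simp: indicator_def)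
      show ?thesis
      proof (cases "t < l")
        case True
        then show ?thesis using ineq[of t l] lt[of t l] t by (auto simp: ug_lhs_def top_unique)
      next
        case False
        then show ?thesis using ineq[of 0 t] lt[of 0 t] t l by (auto simp: ug_lhs_def top_unique)
      qed
    qed
    show ?thesis
      unfolding abs_continuous_on_def
    proof (intro conjI ballI allI impI)
      fix t assume "t \<in> {0..l}"
      then show "\<bar>(v \<circ> \<gamma>) t\<bar> \<noteq> \<infinity>" using finite_v by simp
    next
      fix e :: real assume "0 < e"
      obtain d where d: "0 < d" "\<And>A. A \<in> sets lborel \<Longrightarrow> emeasure lborel A < ennreal d \<Longrightarrow> (\<integral>\<^sup>+ t\<in>A. h t \<partial>lborel) < ennreal e"
        by (rule nn_integral_absolutely_continuous[OF hm hfin \<open>0 < e\<close>]) (rule that)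
      show "\<exists>\<delta>>0. \<forall>(n::nat) (s::nat \<Rightarrow> real) (t::nat \<Rightarrow> real). (\<forall>i<n. 0 \<le> s i \<and> s i \<le> t i \<and> t i \<le> l) \<and> (\<forall>i<n. \<forall>j<n. i \<noteq> j \<longrightarrow> t i \<le> s j \<or> t j \<le> s i) \<and>
          (\<Sum>i<n. t i - s i) < \<delta> \<longrightarrow> (\<Sum>i<n. \<bar>real_of_ereal ((v \<circ> \<gamma>) (t i)) - real_of_ereal ((v \<circ> \<gamma>) (s i))\<bar>) < e"
      proof (intro exI[of _ d] conjI allI impI)
        fix n :: nat and s t :: "nat \<Rightarrow> real"
        assume "(\<forall>i<n. 0 \<le> s i \<and> s i \<le> t i \<and> t i \<le> l) \<and> (\<forall>i<n. \<forall>j<n. i \<noteq> j \<longrightarrow> t i \<le> s j \<or> t j \<le> s i) \<and> (\<Sum>i<n. t i - s i) < d"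
        then have st: "\<And>i. i < n \<Longrightarrow> 0 \<le> s i \<and> s i \<le> t i \<and> t i \<le> l"
          and sep: "\<And>i j. i < n \<Longrightarrow> j < n \<Longrightarrow> i \<noteq> j \<Longrightarrow> t i \<le> s j \<or> t j \<le> s i" and small: "(\<Sum>i<n. t i - s i) < d"
          by auto
        \<comment> \<open>Half-open intervals, since the given closed ones may share endpoints and
          the integrals are to be added over disjoint sets.\<close>
        define A where "A i = {s i<..t i}" for i
        have disj: "disjoint_family_on A {..<n}"
          unfolding disjoint_family_on_def A_def using sep by fastforce
        have "ennreal (\<Sum>i<n. \<bar>real_of_ereal (v (\<gamma> (t i))) - real_of_ereal (v (\<gamma> (s i)))\<bar>)
            = (\<Sum>i<n. ennreal \<bar>real_of_ereal (v (\<gamma> (t i))) - real_of_ereal (v (\<gamma> (s i)))\<bar>)"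
          by (simp add: sum_ennreal)
        also have "\<dots> \<le> (\<Sum>i<n. \<integral>\<^sup>+ r. h r * indicator (A i) r \<partial>lborel)"
        proof (rule sum_mono)
          fix i assume "i \<in> {..<n}"
          then have i: "0 \<le> s i" "s i \<le> t i" "t i \<le> l" using st by auto
          show "ennreal \<bar>real_of_ereal (v (\<gamma> (t i))) - real_of_ereal (v (\<gamma> (s i)))\<bar> \<le> (\<integral>\<^sup>+ r. h r * indicator (A i) r \<partial>lborel)"
          proof (cases "s i < t i")
            case True
            have "ennreal \<bar>real_of_ereal (v (\<gamma> (t i))) - real_of_ereal (v (\<gamma> (s i)))\<bar> = ug_lhs (v (\<gamma> (s i))) (v (\<gamma> (t i)))"
              using finite_v[of "s i"] finite_v[of "t i"] i
              by (cases "v (\<gamma> (s i))"; cases "v (\<gamma> (t i))") (auto simp: ug_lhs_def abs_minus_commute)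
            also have "\<dots> \<le> (\<integral>\<^sup>+ r\<in>{s i<..t i}. h r \<partial>lborel)" using True i by (intro ineq)
            finally show ?thesis by (simp add: A_def)
          qed (use i in simp)
        qed
        also have "\<dots> = (\<integral>\<^sup>+ r. (\<Sum>i<n. h r * indicator (A i) r) \<partial>lborel)"
          by (rule nn_integral_sum[symmetric]) (auto simp: A_def)
        also have "\<dots> = (\<integral>\<^sup>+ r\<in>(\<Union>i<n. A i). h r \<partial>lborel)"
          using disj by (simp add: indicator_UN_disjoint sum_distrib_left)
        also have "\<dots> < ennreal e"
        proof (rule d(2))
          show "(\<Union>i<n. A i) \<in> sets lborel" by (auto simp: A_def)
          have "emeasure lborel (\<Union>i<n. A i) \<le> (\<Sum>i<n. emeasure lborel (A i))"
            by (intro emeasure_subadditive_finite) (auto simp: A_def)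
          also have "\<dots> = (\<Sum>i<n. ennreal (t i - s i))" using st by (intro sum.cong) (auto simp: A_def)
          also have "\<dots> = ennreal (\<Sum>i<n. t i - s i)" using st by (intro sum_ennreal) auto
          also have "\<dots> < ennreal d" using small d(1) by (intro ennreal_lessI)
          finally show "emeasure lborel (\<Union>i<n. A i) < ennreal d" .
        qed
        finally show "(\<Sum>i<n. \<bar>real_of_ereal ((v \<circ> \<gamma>) (t i)) - real_of_ereal ((v \<circ> \<gamma>) (s i))\<bar>) < e"
          by (simp add: ennreal_less_iff sum_nonneg)
      qed (rule d(1))
    qed
  qed
  then show ?thesis unfolding ae_curve_def using g' g'int gint by (intro exI[of _ g']) auto
qed

lemma abs_continuous_imp_continuous:
  assumes "abs_continuous_on 0 l h"
  shows "continuous_on {0..l} (\<lambda>t. real_of_ereal (h t))"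
  unfolding continuous_on_iff
proof (intro ballI allI impI)
  fix x e :: real assume x: "x \<in> {0..l}" and e: "0 < e"
  obtain d where d: "0 < d" and D: "\<forall>n (s::nat\<Rightarrow>real) t. (\<forall>i<n. 0 \<le> s i \<and> s i \<le> t i \<and> t i \<le> l) \<and>
      (\<forall>i<n. \<forall>j<n. i \<noteq> j \<longrightarrow> t i \<le> s j \<or> t j \<le> s i) \<and> (\<Sum>i<n. t i - s i) < d \<longrightarrow>
      (\<Sum>i<n. \<bar>real_of_ereal (h (t i)) - real_of_ereal (h (s i))\<bar>) < e"
    using assms[unfolded abs_continuous_on_def, THEN conjunct2, THEN spec, THEN mp, OF e] by (elim exE conjE)
  have *: "\<bar>real_of_ereal (h b) - real_of_ereal (h a)\<bar> < e" if "0 \<le> a" "a \<le> b" "b \<le> l" "b - a < d" for a b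
    using D[THEN spec, of "Suc 0", THEN spec, of "\<lambda>_. a", THEN spec, of "\<lambda>_. b"] that by simp
  show "\<exists>d>0. \<forall>x'\<in>{0..l}. dist x' x < d \<longrightarrow> dist (real_of_ereal (h x')) (real_of_ereal (h x)) < e"
  proof (intro exI[of _ d] conjI ballI impI)
    fix y assume y: "y \<in> {0..l}" "dist y x < d"
    show "dist (real_of_ereal (h y)) (real_of_ereal (h x)) < e"
    proof (cases "x \<le> y")
      case True
      then show ?thesis using *[of x y] x y by (simp add: dist_real_def)
    next
      case False
      then show ?thesis using *[of y x] x y by (simp add: dist_real_def abs_minus_commute)
    qed
  qed (rule d)
qed

text \<open>Off a Borel null set f equals a Borel function, and on that null set the majorant is
  infinite. Domination must hold at every point because a curve may spend time in a null set;
  equality is needed only under the p-th power integral.\<close>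

lemma borel_majorant:
  fixes f :: "'a \<Rightarrow> real"
  assumes f: "f \<in> borel_measurable M"
  obtains F :: "'a \<Rightarrow> ennreal" where "F \<in> borel_measurable borel" "\<And>x. ennreal (f x) \<le> F x" "AE x in M. F x = ennreal (f x)"
proof -
  obtain \<nu> where \<nu>: "sets \<nu> = sets borel" "M = completion \<nu>" using borel_completion by blast
  obtain h :: "'a \<Rightarrow> real" where h: "h \<in> borel_measurable \<nu>" "AE x in \<nu>. f x = h x"
    using completion_ex_borel_measurable_real[of f \<nu>] f unfolding \<nu>(2) by blast
  obtain N where N: "{x\<in>space \<nu>. f x \<noteq> h x} \<subseteq> N" "N \<in> null_sets \<nu>"
    using h(2) by (auto elim!: AE_E simp: null_sets_def)
  have sp: "space \<nu> = UNIV" using \<nu>(1) sets_eq_imp_space_eq[of \<nu> borel] by simp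
  have [measurable]: "N \<in> sets borel" using N(2) \<nu>(1) by auto
  have [measurable]: "h \<in> borel_measurable borel" using h(1) measurable_cong_sets[OF \<nu>(1) refl] by blast
  show thesis
  proof (rule that[of "\<lambda>x. if x \<in> N then top else ennreal (h x)"])
    show "(\<lambda>x. if x \<in> N then top else ennreal (h x)) \<in> borel_measurable borel" by measurable
    show "ennreal (f x) \<le> (if x \<in> N then top else ennreal (h x))" for x
      using N(1) sp by (cases "f x = h x") auto
    have "N \<in> null_sets M" using N(2) \<nu>(2) by (simp add: null_sets_completionI)
    then have "AE x in M. x \<notin> N" by (rule AE_not_in)
    then show "AE x in M. (if x \<in> N then top else ennreal (h x)) = ennreal (f x)"
    proof eventually_elim
      case (elim x)
      then have "f x = h x" using N(1) sp by auto
      then show ?case using elim by simp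
    qed
  qed
qed

text \<open>For sets \<open>G j\<close> of rapidly decreasing capacity, weighted test functions and
  gradients have a p-integrable supremum R. Along a curve with finite integral of R, the integrals
  of the test function and of its gradient both become small. If the curve met \<open>G j\<close>,
  the test function would equal 1 somewhere and, varying little, be at least 1/2 throughout,
  contradicting its small integral. The predicate Q transports whatever is known off each G.\<close>

lemma ae_curve_avoids:
  assumes cap: "\<And>e::real. 0 < e \<Longrightarrow> \<exists>G. Q G \<and> capacity p M G < ennreal e"
  shows "ae_curve U (\<lambda>\<gamma> l. \<exists>G. Q G \<and> \<gamma> ` {0..l} \<inter> G = {})"
proof -
  define C where "C j = (2^j) powr p * 2 powr p" for j :: nat
  have C: "0 < C j" for j by (simp add: C_def)
  define P where "P j G f g \<longleftrightarrow> Q G \<and> f \<in> borel_measurable M \<and> real_upper_gradient f g \<and> (\<forall>x. 0 \<le> f x) \<and>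
    (\<forall>x\<in>G. f x = 1) \<and> energy f g < ennreal ((1/2)^Suc j / C j)" for j G and f :: "'a \<Rightarrow> real" and g
  have "\<exists>G f g. P j G f g" for j
  proof -
    obtain G where G: "Q G" "capacity p M G < ennreal ((1/2)^Suc j / C j)"
      using cap[of "(1/2)^Suc j / C j"] C[of j] by auto
    show ?thesis
      by (rule capacity_less_test[OF G(2)]) (use G(1) in \<open>unfold P_def, blast\<close>)
  qed
  then obtain G f g where P: "\<And>j. P j (G j) (f j) (g j)" by metis
  have fm: "f j \<in> borel_measurable M" and ug: "real_upper_gradient (f j) (g j)" and f0: "0 \<le> f j x"
    and fG: "x \<in> G j \<Longrightarrow> f j x = 1" and en: "energy (f j) (g j) < ennreal ((1/2)^Suc j / C j)" and QG: "Q (G j)" for j x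
    using P[of j] by (auto simp: P_def)
  have "\<exists>F :: 'a \<Rightarrow> ennreal. F \<in> borel_measurable borel \<and> (\<forall>x. ennreal (f j x) \<le> F x) \<and> (AE x in M. F x = ennreal (f j x))" for j
    by (rule borel_majorant[OF fm[of j]]) blast
  then obtain F :: "nat \<Rightarrow> 'a \<Rightarrow> ennreal" where F: "\<And>j. F j \<in> borel_measurable borel" "\<And>j x. ennreal (f j x) \<le> F j x" "\<And>j. AE x in M. F j x = ennreal (f j x)"
    by metis
  note [measurable] = F(1) real_upper_gradientD(1)[OF ug]
  define R where "R x = (SUP j. ennreal (2^j) * (F j x + g j x))" for x
  have R [measurable]: "R \<in> borel_measurable borel" unfolding R_def by measurable
  have "(\<integral>\<^sup>+ x. epow (R x) p \<partial>M) \<le> (\<integral>\<^sup>+ x. (\<Sum>j. epow (ennreal (2^j) * (F j x + g j x)) p) \<partial>M)"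
    unfolding R_def by (intro nn_integral_mono epow_SUP_le p_pos)
  also have "\<dots> = (\<Sum>j. \<integral>\<^sup>+ x. epow (ennreal (2^j) * (F j x + g j x)) p \<partial>M)"
    by (rule nn_integral_suminf) measurable
  also have "\<dots> \<le> (\<Sum>j. ennreal (1 * (1/2)^Suc j))"
  proof (intro suminf_le)
    fix j
    have "(\<integral>\<^sup>+ x. epow (ennreal (2^j) * (F j x + g j x)) p \<partial>M) = ennreal ((2^j) powr p) * (\<integral>\<^sup>+ x. epow (F j x + g j x) p \<partial>M)"
      by (simp add: epow_mult[OF p_pos] epow_ennreal nn_integral_cmult)
    also have "(\<integral>\<^sup>+ x. epow (F j x + g j x) p \<partial>M) \<le> (\<integral>\<^sup>+ x. ennreal (2 powr p) * (epow (F j x) p + epow (g j x) p) \<partial>M)"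
      by (intro nn_integral_mono epow_add_le p_pos)
    also have "\<dots> = ennreal (2 powr p) * ((\<integral>\<^sup>+ x. epow (F j x) p \<partial>M) + (\<integral>\<^sup>+ x. epow (g j x) p \<partial>M))"
      by (simp add: nn_integral_cmult nn_integral_add)
    also have "(\<integral>\<^sup>+ x. epow (F j x) p \<partial>M) = (\<integral>\<^sup>+ x. ennreal (\<bar>f j x\<bar> powr p) \<partial>M)"
      by (rule nn_integral_cong_AE, use F(3)[of j] in eventually_elim) (use f0 in \<open>simp add: epow_ennreal\<close>)
    also have "(\<integral>\<^sup>+ x. ennreal (\<bar>f j x\<bar> powr p) \<partial>M) + (\<integral>\<^sup>+ x. epow (g j x) p \<partial>M) = energy (f j) (g j)"
      by (simp add: energy_def)
    also have "ennreal (2 powr p) * energy (f j) (g j) \<le> ennreal (2 powr p) * ennreal ((1/2)^Suc j / C j)"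
      using en[of j] by (intro mult_left_mono) auto
    finally have "(\<integral>\<^sup>+ x. epow (ennreal (2^j) * (F j x + g j x)) p \<partial>M) \<le> ennreal ((2^j) powr p) * (ennreal (2 powr p) * ennreal ((1/2)^Suc j / C j))"
      by (simp add: mult_left_mono)
    also have "\<dots> = ennreal (C j * ((1/2)^Suc j / C j))"
      using C[of j] by (simp add: C_def ennreal_mult[symmetric] mult.assoc del: power_Suc)
    also have "C j * ((1/2)^Suc j / C j) = 1 * (1/2)^Suc j" using C[of j] by simp
    finally show "(\<integral>\<^sup>+ x. epow (ennreal (2^j) * (F j x + g j x)) p \<partial>M) \<le> ennreal (1 * (1/2)^Suc j)" .
  qed auto
  also have "\<dots> = ennreal 1" by (rule suminf_half_powers) simp
  finally have "(\<integral>\<^sup>+ x. epow (R x) p \<partial>M) \<le> 1" by simp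
  then have "(\<integral>\<^sup>+ x. epow (R x) p \<partial>M) < \<infinity>" by (rule le_less_trans) simp
  moreover have "\<exists>G. Q G \<and> \<gamma> ` {0..l} \<inter> G = {}" if c: "curve_in U \<gamma> l" and fin: "line_integral R \<gamma> l \<noteq> \<infinity>" for \<gamma> l
  proof -
    have \<gamma>: "is_curve \<gamma> l" using c by (simp add: curve_in_def)
    then have l: "0 < l" by (simp add: is_curve_def)
    obtain b where b: "line_integral R \<gamma> l = ennreal b" "0 \<le> b"
      using fin by (cases "line_integral R \<gamma> l") auto
    \<comment> \<open>The bound \<open>a < m / 2\<close> serves twice: the variation of the test
      function is below 1/2, and its integral is below \<open>l / 2\<close>.\<close>
    define m where "m = min 1 l"
    have m: "0 < m" "m \<le> 1" "m \<le> l" using l by (auto simp: m_def)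
    obtain j where j: "2 * b / m < 2^j" using real_arch_pow[of 2 "2 * b / m"] by auto
    have bj: "b / 2^j < m / 2" using j m(1) by (simp add: field_simps)
    have "ennreal (2^j) * line_integral (\<lambda>x. F j x + g j x) \<gamma> l = line_integral (\<lambda>x. ennreal (2^j) * (F j x + g j x)) \<gamma> l"
      by (rule line_integral_cmult[symmetric, OF \<gamma>]) measurable
    also have "\<dots> \<le> ennreal b"
      unfolding b(1)[symmetric] R_def by (intro line_integral_mono SUP_upper) simp
    finally have le: "ennreal (2^j) * line_integral (\<lambda>x. F j x + g j x) \<gamma> l \<le> ennreal b" .
    then obtain a where a: "line_integral (\<lambda>x. F j x + g j x) \<gamma> l = ennreal a" "0 \<le> a"
      by (cases "line_integral (\<lambda>x. F j x + g j x) \<gamma> l") (auto simp: ennreal_mult_top top_unique simp del: ennreal_power)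
    have "2^j * a \<le> b" using le a b(2) by (simp add: ennreal_mult[symmetric] del: ennreal_power)
    then have "a \<le> b / 2^j" by (simp add: field_simps)
    then have a_small: "a < m / 2" using bj by linarith
    have "\<gamma> ` {0..l} \<inter> G j = {}"
    proof (rule ccontr)
      assume "\<not> ?thesis"
      then obtain z where z: "z \<in> {0..l}" "\<gamma> z \<in> G j" by blast
      have half: "1 / 2 \<le> f j (\<gamma> t)" if t: "t \<in> {0..l}" for t
      proof -
        have "ennreal \<bar>f j (\<gamma> (min z t)) - f j (\<gamma> (max z t))\<bar> \<le> (\<integral>\<^sup>+ r\<in>{min z t..max z t}. g j (\<gamma> r) \<partial>lborel)"
          using z t by (intro real_upper_gradient_subcurve[OF ug \<gamma>]) auto
        also have "\<dots> \<le> line_integral (\<lambda>x. F j x + g j x) \<gamma> l"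
          unfolding line_integral_def using z t by (intro nn_integral_mono) (auto simp: indicator_def)
        finally have "\<bar>f j (\<gamma> (min z t)) - f j (\<gamma> (max z t))\<bar> \<le> a" using a by simp
        then have "\<bar>f j (\<gamma> z) - f j (\<gamma> t)\<bar> \<le> a" by (cases "z \<le> t") (auto simp: min_def max_def abs_minus_commute)
        then show ?thesis using fG[OF z(2)] a_small m by linarith
      qed
      have "ennreal (l / 2) = (\<integral>\<^sup>+ t\<in>{0..l}. ennreal (1/2) \<partial>lborel)"
        using l by (simp add: nn_integral_cmult_indicator ennreal_mult[symmetric] del: ennreal_half)
      also have "\<dots> \<le> line_integral (\<lambda>x. F j x + g j x) \<gamma> l"
        unfolding line_integral_def
      proof (rule nn_integral_mono)
        fix t
        show "ennreal (1/2) * indicator {0..l} t \<le> (F j (\<gamma> t) + g j (\<gamma> t)) * indicator {0..l} t"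
        proof (cases "t \<in> {0..l}")
          case True
          have "ennreal (1/2) \<le> ennreal (f j (\<gamma> t))" using half[OF True] by (rule ennreal_leI)
          also have "\<dots> \<le> F j (\<gamma> t) + g j (\<gamma> t)" using F(2)[of j "\<gamma> t"] by (simp add: add_increasing2)
          finally show ?thesis using True by simp
        qed simp
      qed
      finally have "l / 2 \<le> a" using a by simp
      then show False using a_small m by linarith
    qed
    then show ?thesis using QG by blast
  qed
  ultimately show ?thesis unfolding ae_curve_def using R by blast
qed

text \<open>The exceptional null set is enclosed in a Borel null set B. The function that is
  infinite on B and 0 elsewhere has zero p-th power integral, and a curve along which its integral
  is finite spends no time in B.\<close>

lemma ae_curve_AE_eq:
  fixes u v :: "'a \<Rightarrow> ereal"
  assumes "AE x in M. x \<in> U \<longrightarrow> u x = v x"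
  shows "ae_curve U (\<lambda>\<gamma> l. AE t in lborel. t \<in> {0..l} \<longrightarrow> u (\<gamma> t) = v (\<gamma> t))"
proof -
  obtain N where N: "{x\<in>space M. \<not> (x \<in> U \<longrightarrow> u x = v x)} \<subseteq> N" "N \<in> null_sets M"
    using assms by (auto elim!: AE_E simp: null_sets_def)
  obtain B where B [measurable]: "B \<in> sets borel" and B': "N \<subseteq> B" "B - N \<in> null_sets M"
    using sets_M_sandwich[of N] N(2) by auto
  have "B \<in> null_sets M"
    using null_sets.Un[OF N(2) B'(2)] null_subset[of "N \<union> (B - N)" B] by auto
  define \<rho> :: "'a \<Rightarrow> ennreal" where "\<rho> x = \<infinity> * indicator B x" for x
  have \<rho> [measurable]: "\<rho> \<in> borel_measurable borel" unfolding \<rho>_def by measurable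
  have "(\<integral>\<^sup>+ x. epow (\<rho> x) p \<partial>M) = (\<integral>\<^sup>+ x. 0 \<partial>M)"
    by (rule nn_integral_cong_AE, use AE_not_in[OF \<open>B \<in> null_sets M\<close>] in eventually_elim) (simp add: \<rho>_def)
  moreover have "AE t in lborel. t \<in> {0..l} \<longrightarrow> u (\<gamma> t) = v (\<gamma> t)"
    if c: "curve_in U \<gamma> l" and fin: "line_integral \<rho> \<gamma> l \<noteq> \<infinity>" for \<gamma> l
  proof -
    have \<gamma>: "is_curve \<gamma> l" and sub: "\<gamma> ` {0..l} \<subseteq> U" using c by (auto simp: curve_in_def)
    have "AE t in lborel. \<rho> (\<gamma> t) * indicator {0..l} t \<noteq> \<infinity>"
      using fin curve_measurable[OF \<gamma> \<rho>, of 0 l] unfolding line_integral_def by (intro nn_integral_noteq_infinite) auto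
    then show ?thesis
    proof eventually_elim
      case (elim t)
      show ?case
      proof
        assume t: "t \<in> {0..l}"
        then have "\<gamma> t \<notin> B" using elim by (auto simp: \<rho>_def)
        moreover have "\<gamma> t \<in> U" using sub t by blast
        ultimately show "u (\<gamma> t) = v (\<gamma> t)" using N(1) B'(1) by (simp add: subset_iff) blast
      qed
    qed
  qed
  ultimately show ?thesis unfolding ae_curve_def using \<rho> by (intro exI[of _ \<rho>]) auto
qed

text \<open>Agreement at almost every time improves to every time, since along almost every curve
  both functions are finite and continuous. Finiteness allows passing from real values back to
  extended ones.\<close>

lemma ae_curve_eq:
  assumes U: "U \<in> sets M" and v: "N1p p M U v" and eq: "AE x in M. x \<in> U \<longrightarrow> u x = v x"
    and u: "ae_curve U (\<lambda>\<gamma> l. (\<forall>t\<in>{0..l}. \<bar>u (\<gamma> t)\<bar> \<noteq> \<infinity>) \<and> continuous_on {0..l} (\<lambda>t. real_of_ereal (u (\<gamma> t))))"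
  shows "ae_curve U (\<lambda>\<gamma> l. \<forall>t\<in>{0..l}. u (\<gamma> t) = v (\<gamma> t))"
proof (rule ae_curve_mono[OF ae_curve_conj[OF u ae_curve_conj[OF N1p_ae_absolutely_continuous[OF U v] ae_curve_AE_eq[OF eq]]]])
  fix \<gamma> l assume c: "curve_in U \<gamma> l"
  assume "((\<forall>t\<in>{0..l}. \<bar>u (\<gamma> t)\<bar> \<noteq> \<infinity>) \<and> continuous_on {0..l} (\<lambda>t. real_of_ereal (u (\<gamma> t)))) \<and>
    abs_continuous_on 0 l (v \<circ> \<gamma>) \<and> (AE t in lborel. t \<in> {0..l} \<longrightarrow> u (\<gamma> t) = v (\<gamma> t))"
  then have u: "\<And>t. t \<in> {0..l} \<Longrightarrow> \<bar>u (\<gamma> t)\<bar> \<noteq> \<infinity>" "continuous_on {0..l} (\<lambda>t. real_of_ereal (u (\<gamma> t)))"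
    and v: "abs_continuous_on 0 l (v \<circ> \<gamma>)" and ae: "AE t in lborel. t \<in> {0..l} \<longrightarrow> u (\<gamma> t) = v (\<gamma> t)"
    by auto
  have l: "0 < l" using c by (simp add: curve_in_def is_curve_def)
  have v_fin: "\<bar>v (\<gamma> t)\<bar> \<noteq> \<infinity>" if "t \<in> {0..l}" for t
    using v that by (simp add: abs_continuous_on_def)
  have "continuous_on {0..l} (\<lambda>t. real_of_ereal (v (\<gamma> t)))"
    using abs_continuous_imp_continuous[OF v] by simp
  moreover have "AE t in lborel. t \<in> {0..l} \<longrightarrow> real_of_ereal (u (\<gamma> t)) = real_of_ereal (v (\<gamma> t))"
    using ae by eventually_elim auto
  ultimately have "real_of_ereal (u (\<gamma> t)) = real_of_ereal (v (\<gamma> t))" if "t \<in> {0..l}" for t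
    using continuous_AE_eq_on_interval[OF u(2) _ l _ that] by blast
  then show "\<forall>t\<in>{0..l}. u (\<gamma> t) = v (\<gamma> t)"
    using u(1) v_fin by (metis ereal_real')
qed

text \<open>Adding to the gradient of v the function that is infinite in integral on the exceptional
  curves makes the inequality trivial there; on all other curves u has the same end values as v. The
  norm stays finite because the added function is p-integrable.\<close>

lemma ae_eq_curves_imp_N1p:
  assumes U: "U \<in> sets M" and v: "N1p p M U v" and eq: "AE x in M. x \<in> U \<longrightarrow> u x = v x"
    and u: "ae_curve U (\<lambda>\<gamma> l. \<forall>t\<in>{0..l}. u (\<gamma> t) = v (\<gamma> t))"
  shows "N1p p M U u"
proof -
  obtain g where vm: "v \<in> borel_measurable (restrict_space M U)" and ug: "upper_gradient U v g"
    and vint: "(\<integral>\<^sup>+ x\<in>U. epow (e2ennreal \<bar>v x\<bar>) p \<partial>M) < \<infinity>" and gint: "(\<integral>\<^sup>+ x\<in>U. epow (g x) p \<partial>M) < \<infinity>"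
    by (rule N1pE[OF v]) (rule that)
  obtain g' where g' [measurable]: "g' \<in> borel_measurable borel" and g'g: "\<And>x. x \<in> U \<Longrightarrow> g' x = g x"
    and g'int: "(\<integral>\<^sup>+ x. epow (g' x) p \<partial>M) = (\<integral>\<^sup>+ x\<in>U. epow (g x) p \<partial>M)"
    using gradient_extension[OF U, of g] ug unfolding upper_gradient_def by blast
  obtain \<rho> where \<rho> [measurable]: "\<rho> \<in> borel_measurable borel" and \<rho>int: "(\<integral>\<^sup>+ x. epow (\<rho> x) p \<partial>M) < \<infinity>"
    and uv: "\<And>\<gamma> l. curve_in U \<gamma> l \<Longrightarrow> line_integral \<rho> \<gamma> l \<noteq> \<infinity> \<Longrightarrow> \<forall>t\<in>{0..l}. u (\<gamma> t) = v (\<gamma> t)"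
    using u unfolding ae_curve_def by auto
  let ?g = "\<lambda>x. g' x + \<rho> x"
  have "upper_gradient U u ?g"
    unfolding upper_gradient_def
  proof (intro conjI allI impI)
    show "?g \<in> borel_measurable (restrict_space borel U)"
      by (rule measurable_restrict_space1) measurable
    fix \<gamma> l assume c: "curve_in U \<gamma> l"
    then have l: "0 < l" by (simp add: curve_in_def is_curve_def)
    show "ug_lhs (u (\<gamma> 0)) (u (\<gamma> l)) \<le> line_integral ?g \<gamma> l"
    proof (cases "line_integral \<rho> \<gamma> l = \<infinity>")
      case True
      have "line_integral \<rho> \<gamma> l \<le> line_integral ?g \<gamma> l" by (rule line_integral_mono) simp
      then show ?thesis using True by (simp add: top_unique)
    next
      case False
      then have "ug_lhs (u (\<gamma> 0)) (u (\<gamma> l)) = ug_lhs (v (\<gamma> 0)) (v (\<gamma> l))"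
        using uv[OF c] l by simp
      also have "\<dots> \<le> line_integral g \<gamma> l" using ug c by (simp add: upper_gradient_def)
      also have "\<dots> \<le> line_integral ?g \<gamma> l"
        unfolding line_integral_def using c g'g
        by (intro nn_integral_mono) (auto simp: indicator_def curve_in_def image_subset_iff)
      finally show ?thesis .
    qed
  qed
  moreover have "(\<integral>\<^sup>+ x\<in>U. epow (?g x) p \<partial>M) < \<infinity>"
  proof (rule le_less_trans)
    show "(\<integral>\<^sup>+ x\<in>U. epow (?g x) p \<partial>M) \<le> (\<integral>\<^sup>+ x. epow (?g x) p \<partial>M)"
      by (intro nn_integral_mono) (auto simp: indicator_def)
    show "(\<integral>\<^sup>+ x. epow (?g x) p \<partial>M) < \<infinity>"
      using g'int gint \<rho>int by (intro nn_integral_epow_add_finite) auto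
  qed
  moreover have "(\<integral>\<^sup>+ x\<in>U. epow (e2ennreal \<bar>u x\<bar>) p \<partial>M) = (\<integral>\<^sup>+ x\<in>U. epow (e2ennreal \<bar>v x\<bar>) p \<partial>M)"
    by (rule nn_integral_cong_AE, use eq in eventually_elim) (auto simp: indicator_def)
  ultimately have "N1p_normp p M U u < \<infinity>"
    unfolding N1p_normp_def using vint
    by (auto simp: INF_less_iff)
  \<comment> \<open>Preimages under u and v differ inside a null set, every subset of which is
    measurable by completeness.\<close>
  moreover have "u \<in> borel_measurable (restrict_space M U)"
  proof (rule measurableI)
    obtain N where N: "{x\<in>space M. \<not> (x \<in> U \<longrightarrow> u x = v x)} \<subseteq> N" "N \<in> null_sets M"
      using eq by (auto elim!: AE_E simp: null_sets_def)
    fix A :: "ereal set" assume "A \<in> sets borel"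
    then have "v -` A \<inter> space (restrict_space M U) \<in> sets (restrict_space M U)"
      by (rule measurable_sets[OF vm])
    then have vA: "v -` A \<inter> U \<in> sets M"
      using U by (simp add: sets_restrict_space_iff space_restrict_space)
    have "N \<inter> (u -` A \<inter> U) \<in> null_sets M" by (rule null_subset[OF N(2)]) auto
    moreover have "u -` A \<inter> U = (v -` A \<inter> U - N) \<union> (N \<inter> (u -` A \<inter> U))"
      using N(1) by auto
    moreover have "v -` A \<inter> U - N \<in> sets M" using vA N(2) by auto
    ultimately have "u -` A \<inter> U \<in> sets M" by (metis null_setsD2 sets.Un)
    then show "u -` A \<inter> space (restrict_space M U) \<in> sets (restrict_space M U)"
      using U by (simp add: sets_restrict_space_iff space_restrict_space)
  qed simp
  ultimately show ?thesis by (simp add: N1p_def)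
qed

lemma quasicontinuous_ae_continuous:
  assumes "quasicontinuous_on p M U u"
  shows "ae_curve U (\<lambda>\<gamma> l. (\<forall>t\<in>{0..l}. \<bar>u (\<gamma> t)\<bar> \<noteq> \<infinity>) \<and> continuous_on {0..l} (\<lambda>t. real_of_ereal (u (\<gamma> t))))"
proof -
  let ?Q = "\<lambda>G. (\<forall>x\<in>U - G. \<bar>u x\<bar> \<noteq> \<infinity>) \<and> continuous_on (U - G) (\<lambda>x. real_of_ereal (u x))"
  have "\<exists>G. ?Q G \<and> capacity p M G < ennreal e" if "0 < e" for e :: real
    using assms that unfolding quasicontinuous_on_def by blast
  from ae_curve_avoids[of ?Q, OF this] show ?thesis
  proof (rule ae_curve_mono)
    fix \<gamma> l assume c: "curve_in U \<gamma> l" and "\<exists>G. ?Q G \<and> \<gamma> ` {0..l} \<inter> G = {}"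
    then obtain G where G: "?Q G" "\<gamma> ` {0..l} \<inter> G = {}" by blast
    then have sub: "\<gamma> ` {0..l} \<subseteq> U - G" using c by (auto simp: curve_in_def)
    have "continuous_on {0..l} \<gamma>"
      using c lipschitz_on_continuous_on[OF is_curve_lipschitz] by (auto simp: curve_in_def)
    then have "continuous_on {0..l} (\<lambda>t. real_of_ereal (u (\<gamma> t)))"
      using continuous_on_compose2[of "U - G" "\<lambda>x. real_of_ereal (u x)" "{0..l}" \<gamma>] G(1) sub by blast
    then show "(\<forall>t\<in>{0..l}. \<bar>u (\<gamma> t)\<bar> \<noteq> \<infinity>) \<and> continuous_on {0..l} (\<lambda>t. real_of_ereal (u (\<gamma> t)))"
      using G(1) sub by (simp add: image_subset_iff)
  qed
qed

end

theorem theorem7p9: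
  fixes p :: real and M :: "'a::{metric_space,complete_space} measure"
    and U :: "'a set" and u :: "'a \<Rightarrow> ereal"
  assumes "standing_assumptions p M"
    and "quasiopen p M U"
    and "N1p_hat p M U u"
  shows "(N1p p M U u \<longleftrightarrow> quasicontinuous_on p M U u) \<and>
         (quasicontinuous_on p M U u \<longleftrightarrow>
            (\<exists>\<Gamma>. p_modulus p M \<Gamma> = 0 \<and>
               (\<forall>\<gamma> l. curve_in U \<gamma> l \<and> (\<gamma>, l) \<notin> \<Gamma> \<longrightarrow> abs_continuous_on 0 l (u \<circ> \<gamma>))))"
proof -
  interpret newtonian_space p M by standard fact
  have U: "U \<in> sets M" by (rule quasiopen_sets) fact
  obtain v where v: "N1p p M U v" and eq: "AE x in M. x \<in> U \<longrightarrow> u x = v x"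
    using assms(3) unfolding N1p_hat_def by blast
  let ?c = "\<lambda>\<gamma> l. (\<forall>t\<in>{0..l}. \<bar>u (\<gamma> t)\<bar> \<noteq> \<infinity>) \<and> continuous_on {0..l} (\<lambda>t. real_of_ereal (u (\<gamma> t)))"
  \<comment> \<open>The common way back to (a): quasicontinuity and absolute continuity both imply
    finiteness and continuity along almost every curve, and together with the representative v this
    already suffices.\<close>
  have N1p: "N1p p M U u" if "ae_curve U ?c"
    by (rule ae_eq_curves_imp_N1p[OF U v eq ae_curve_eq[OF U v eq that]])
  have ab: "quasicontinuous_on p M U u" if "N1p p M U u"
    by (rule N1p_quasicontinuous[OF assms(2) that])
  have ba: "N1p p M U u" if "quasicontinuous_on p M U u"
    by (rule N1p[OF quasicontinuous_ae_continuous[OF that]])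
  have ac: "\<exists>\<Gamma>. p_modulus p M \<Gamma> = 0 \<and>
      (\<forall>\<gamma> l. curve_in U \<gamma> l \<and> (\<gamma>, l) \<notin> \<Gamma> \<longrightarrow> abs_continuous_on 0 l (u \<circ> \<gamma>))" if "N1p p M U u"
    by (rule ae_curve_imp_modulus[OF N1p_ae_absolutely_continuous[OF U that]])
  have ca: "N1p p M U u" if "p_modulus p M \<Gamma> = 0"
    "\<forall>\<gamma> l. curve_in U \<gamma> l \<and> (\<gamma>, l) \<notin> \<Gamma> \<longrightarrow> abs_continuous_on 0 l (u \<circ> \<gamma>)" for \<Gamma>
  proof (rule N1p, rule modulus_imp_ae_curve[OF that(1)])
    fix \<gamma> l assume "curve_in U \<gamma> l" "(\<gamma>, l) \<notin> \<Gamma>"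
    then have "abs_continuous_on 0 l (u \<circ> \<gamma>)" using that(2) by blast
    then show "?c \<gamma> l"
      using abs_continuous_imp_continuous[of l "u \<circ> \<gamma>"] by (auto simp: abs_continuous_on_def)
  qed
  show ?thesis using ab ba ac ca by blast
qed

end
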